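(* Let $n\ge 1$ and let $\mathcal{N}$ be the Newtonian potential in $\mathbb{R}^n$. There exists a constant $c(n)>0$ depending only on $n$ such that for every $R\in(0,\infty)$ and every $\rho\in L^1_+(\mathbb{R}^n)\cap L^\infty(\mathbb{R}^n)$, not identically zero (a.e.), with $\mathrm{supp}\,\rho\subset B(0,R)$ and center of mass $x_0:=\frac{\int_{\mathbb{R}^n} x\rho(x)\,dx}{\|\rho\|_1}$, $$\mathcal{E}_{\mathcal{N}}[\rho^*]-\mathcal{E}_{\mathcal{N}}[\rho]\ \ge\ \frac{c(n)\,\|\rho\|_1}{\|\rho\|_\infty R^n}\ \mathcal{E}_{\mathcal{N}}[T_{x_0}\rho-\rho^*].$$
   Context: $L^1_+(\mathbb{R}^n)$ is the set of nonnegative functions in $L^1(\mathbb{R}^n)$; $\|\cdot\|_p$ is the $L^p(\mathbb{R}^n)$ norm; $B(a,r)$ is the ball in $\mathbb{R}^n$ centered at $a$ with radius $r$; $\omega_n$ is the volume of the unit ball. The Newtonian potential is the fundamental solution of $-\Delta$: $\mathcal{N}(x)=-\frac{|x|}{2}$ for $n=1$, $\mathcal{N}(x)=-\frac1{2\pi}\log|x|$ for $n=2$, and $\mathcal{N}(x)=\frac{1}{n(n-2)\omega_n}|x|^{2-n}$ for $n\ge3$. For a (possibly sign-changing) function $f$, $$\mathcal{E}_{\mathcal{N}}[f]:=\int_{\mathbb{R}^n}\int_{\mathbb{R}^n}f(x)f(y)\mathcal{N}(x-y)\,dx\,dy .$$ $\rho^*$ denotes the radially symmetric decreasing rearrangement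 of $\rho$: $\rho^*(x)=\int_0^\infty 1_{D_h^*}(x)\,dh$ with $D_h=\{\rho>h\}$, where for a set $D$ of finite measure $D^*$ is the ball centered at the origin with $|D^*|=|D|$. For $a\in\mathbb{R}^n$, $T_a\rho:=\rho(\cdot+a)$. *)

theory Defs
  imports "HOL-Analysis.Analysis" "HOL-Probability.Essential_Supremum"
begin

text \<open>Functions stand for Lebesgue measurable representatives of \<open>L\<^sup>p\<close> classes. The Newtonian potential
  is singular at the origin if \<open>n \<ge> 2\<close>; its value there plays no role.\<close>

definition newtonian :: "'a::euclidean_space \<Rightarrow> real" where
  "newtonian x =
    (if DIM('a) = 1 then - norm x / 2
     else if DIM('a) = 2 then - ln (norm x) / (2 * pi)
     else norm x powr (2 - real DIM('a)) /
       (real DIM('a) * (real DIM('a) - 2) * unit_ball_vol (real DIM('a))))"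

definition interaction_energy :: "('a::euclidean_space \<Rightarrow> real) \<Rightarrow> ('a \<Rightarrow> real) \<Rightarrow> real" where
  "interaction_energy K f =
    (\<integral>y. (\<integral>x. f x * f y * K (x - y) \<partial>lebesgue) \<partial>lebesgue)"

definition L1_plus :: "('a::euclidean_space \<Rightarrow> real) set" where
  "L1_plus = {f. integrable lebesgue f \<and> (AE x in lebesgue. 0 \<le> f x)}"

definition L_infinity :: "('a::euclidean_space \<Rightarrow> real) set" where
  "L_infinity = {f \<in> borel_measurable lebesgue. esssup lebesgue (\<lambda>x. ereal \<bar>f x\<bar>) < \<infinity>}"

definition L1_norm :: "('a::euclidean_space \<Rightarrow> real) \<Rightarrow> real" where
  "L1_norm f = (\<integral>x. \<bar>f x\<bar> \<partial>lebesgue)"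

definition Linf_norm :: "('a::euclidean_space \<Rightarrow> real) \<Rightarrow> real" where
  "Linf_norm f = real_of_ereal (esssup lebesgue (\<lambda>x. ereal \<bar>f x\<bar>))"

text \<open>The support of an \<open>L\<^sup>p\<close> class: the complement of the largest open set on which
  the function vanishes almost everywhere.\<close>

definition ess_support :: "('a::euclidean_space \<Rightarrow> real) \<Rightarrow> 'a set" where
  "ess_support f = - \<Union>{U. open U \<and> (AE x in lebesgue. x \<in> U \<longrightarrow> f x = 0)}"

text \<open>The radius is unique for every \<open>D\<close>, since the volume of a ball is strictly increasing in its
  radius. The rearranged set is meant for measurable sets of finite measure; for other sets
  \<^const>\<open>measure\<close> takes the value 0.\<close>

definition set_rearrangement :: "'a::euclidean_space set \<Rightarrow> 'a set" where
  "set_rearrangement D =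
    ball 0 (THE r. 0 \<le> r \<and> measure lebesgue (ball (0::'a) r) = measure lebesgue D)"

lemma measure_set_rearrangement:
  "measure lebesgue (set_rearrangement D) = measure lebesgue (D::'a::euclidean_space set)"
proof -
  define v where "v = unit_ball_vol (real DIM('a))"
  define m where "m = measure lebesgue D"
  have v: "v > 0" by (simp add: v_def)
  have m: "m \<ge> 0" by (simp add: m_def)
  have ball: "measure lebesgue (ball (0::'a) r) = v * r ^ DIM('a)" if "0 \<le> r" for r
    using that by (simp add: content_ball v_def)
  have "\<exists>!r. 0 \<le> r \<and> measure lebesgue (ball (0::'a) r) = m"
  proof (rule ex1I[of _ "root DIM('a) (m / v)"])
    show "0 \<le> root DIM('a) (m / v) \<and> measure lebesgue (ball (0::'a) (root DIM('a) (m / v))) = m"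
      using v m ball[of "root DIM('a) (m / v)"] by (auto simp: real_root_pow_pos2)
    show "r = root DIM('a) (m / v)" if "0 \<le> r \<and> measure lebesgue (ball (0::'a) r) = m" for r
    proof -
      have "r ^ DIM('a) = m / v" using that v ball[of r] by (auto simp: field_simps)
      then show ?thesis using that by (metis DIM_positive real_root_power_cancel)
    qed
  qed
  from theI'[OF this] show ?thesis by (simp add: set_rearrangement_def m_def)
qed

definition rearrangement :: "('a::euclidean_space \<Rightarrow> real) \<Rightarrow> 'a \<Rightarrow> real" where
  "rearrangement f x =
    (LINT h:{0..}|lborel. indicator (set_rearrangement {y. f y > h}) x)"

definition center_of_mass :: "('a::euclidean_space \<Rightarrow> real) \<Rightarrow> 'a" where
  "center_of_mass f = (\<integral>x. f x *\<^sub>R x \<partial>lebesgue) /\<^sub>R L1_norm f"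

definition translate :: "'a::euclidean_space \<Rightarrow> ('a \<Rightarrow> real) \<Rightarrow> 'a \<Rightarrow> real" where
  "translate a f = (\<lambda>x. f (x + a))"

end

theory Submission
  imports Defs
begin

text \<open>
  Write \<open>f\<close> for the density, \<open>g\<close> for its rearrangement, \<open>f'\<close> for the translate of \<open>f\<close> centred at the origin,
  \<open>n\<close> for the dimension and \<open>M\<close> for the supremum of \<open>f\<close>.
  On the ball of radius \<open>2 * R\<close> the kernel \<open>N x + c * (norm x)\<^sup>2\<close> is still radially decreasing if \<open>c\<close> is a
  suitable multiple of \<open>1 / R ^ n\<close>. Riesz' rearrangement inequality for this kernel bounds the energy
  gap \<open>E g - E f\<close> from below by \<open>2 * c * mass f * W\<close>, where \<open>W\<close> is the second moment of \<open>f'\<close> minus that of \<open>g\<close>.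
  Conversely \<open>E (f' - g) = E f - 2 * E (f', g) + E g\<close> is at most \<open>2 * (E g - E (f', g))\<close>, the integral of
  \<open>2 * (g - f')\<close> against the potential of \<open>g\<close>. Since \<open>g \<le> M\<close>, adding \<open>C * M * (norm x)\<^sup>2\<close> to this potential makes it
  radially increasing for some \<open>C\<close> depending on \<open>n\<close> only, so its integral against \<open>g - f'\<close> becomes nonpositive
  and \<open>E (f' - g) \<le> 2 * C * M * W\<close>.

  Riesz' inequality and its analogue for a single radial weight follow by polarization: averaged over a
  family of reflections, polarizing \<open>f\<close> decreases the \<open>L\<^sup>1\<close> distance \<open>d\<close> between \<open>f\<close> and \<open>g\<close> by at least a
  constant times \<open>d\<^sup>2\<close>.
\<close>

section \<open>Reflections\<close>

text \<open>Both quadratic corrections come from comparing slopes. The radial slope of the kernel is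
  \<open>- 1 / (n * \<omega> * r ^ (n - 1))\<close>, with \<open>\<omega>\<close> the volume of the
  unit ball, and it dominates the slope \<open>2 * c * r\<close> up to \<open>r = 2 * R\<close>, the
  largest distance between points of the support, if \<open>c\<close> is of order
  \<open>1 / R ^ n\<close>; this is where \<open>R ^ n\<close> enters. For the potential, minus the
  Laplacian of the potential of \<open>g\<close> is formally \<open>g\<close>, so adding
  \<open>M / (2 * n)\<close> times the squared norm gives a radial subharmonic function, which must
  increase outwards. The proof reaches the same conclusion by kernel estimates: \<open>g\<close> is
  sliced into indicators of centred balls, and the potential of one ball is compared at two points
  by reflection and mean value bounds. The price is the larger factor \<open>2 ^ (n + 5)\<close>.
  The centre of mass is forced by the quadratic term: the double integral of the squared distance
  against \<open>f\<close> twice is \<open>2 * mass f\<close> times the second moment about the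
  centre of mass, and both bounds must be expressed by the same \<open>W\<close>. Averages over
  reflections use Lebesgue measure on pairs \<open>w\<close>, \<open>t\<close> with \<open>w\<close>
  of variable length, which takes the place of surface measure on the sphere.\<close>

lemma nn_integral_lborel_translate:
  fixes f :: "'a::euclidean_space \<Rightarrow> ennreal"
  assumes [measurable]: "f \<in> borel_measurable borel"
  shows "(\<integral>\<^sup>+x. f (c + x) \<partial>lborel) = (\<integral>\<^sup>+x. f x \<partial>lborel)"
  by (subst (2) lborel_distr_plus[of c, symmetric]) (simp add: nn_integral_distr)

lemma nn_integral_lborel_scale:
  fixes f :: "'a::euclidean_space \<Rightarrow> ennreal"
  assumes [measurable]: "f \<in> borel_measurable borel" and c: "c \<noteq> 0"
  shows "(\<integral>\<^sup>+x. f x \<partial>lborel) = ennreal (\<bar>c\<bar> ^ DIM('a)) * (\<integral>\<^sup>+x. f (t + c *\<^sub>R x) \<partial>lborel)"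
  by (subst lborel_affine[OF c, of t])
     (simp add: nn_integral_density nn_integral_distr nn_integral_cmult)

lemma nn_integral_lborel_point_reflection:
  fixes f :: "'a::euclidean_space \<Rightarrow> ennreal"
  assumes [measurable]: "f \<in> borel_measurable borel"
  shows "(\<integral>\<^sup>+x. f (c - x) \<partial>lborel) = (\<integral>\<^sup>+x. f x \<partial>lborel)"
  using nn_integral_lborel_scale[OF assms, of "-1" c] by simp

text \<open>Uniqueness of translation invariant measures: for a ball \<open>B\<close> centred at the origin, translation
  invariance of both measures yields \<open>\<mu> A * \<lambda> B = \<lambda> A * \<mu> B\<close>, and an isometry fixes \<open>B\<close>.\<close>

lemma distr_lborel_isometry:
  fixes T :: "'a::euclidean_space \<Rightarrow> 'a"
  assumes lin: "linear T" and norm: "\<And>x. norm (T x) = norm x"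
  shows "distr lborel borel T = lborel"
proof (rule measure_eqI)
  define \<mu> where "\<mu> = distr lborel borel T"
  have cont: "continuous_on UNIV T"
    using lin by (simp add: linear_continuous_on linear_conv_bounded_linear)
  then have [measurable]: "T \<in> borel_measurable borel" by (rule borel_measurable_continuous_onI)
  have sets[measurable_cong]: "sets \<mu> = sets borel" by (simp add: \<mu>_def)
  have surj: "surj T"
  proof -
    have "inj T" using norm lin by (metis linear_injective_0 norm_eq_zero)
    then show ?thesis using lin by (simp add: linear_injective_imp_surjective)
  qed
  have nn_\<mu>: "(\<integral>\<^sup>+x. f x \<partial>\<mu>) = (\<integral>\<^sup>+x. f (T x) \<partial>lborel)"
    if "f \<in> borel_measurable borel" for f :: "'a \<Rightarrow> ennreal"
    using that by (simp add: \<mu>_def nn_integral_distr)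
  have trans: "(\<integral>\<^sup>+x. f (x + c) \<partial>\<mu>) = (\<integral>\<^sup>+x. f x \<partial>\<mu>)"
    if [measurable]: "f \<in> borel_measurable borel" for f :: "'a \<Rightarrow> ennreal" and c
  proof -
    obtain d where d: "T d = c" using surj by (metis surjD)
    have "(\<integral>\<^sup>+x. f (x + c) \<partial>\<mu>) = (\<integral>\<^sup>+x. f (T (d + x)) \<partial>lborel)"
      by (simp add: nn_\<mu> linear_add[OF lin] d add.commute)
    also have "\<dots> = (\<integral>\<^sup>+x. f (T x) \<partial>lborel)"
      by (rule nn_integral_lborel_translate) simp
    finally show ?thesis by (simp add: nn_\<mu>)
  qed
  interpret \<mu>: sigma_finite_measure \<mu>
  proof (rule sigma_finite_measure.intro)
    show "\<exists>A. countable A \<and> A \<subseteq> sets \<mu> \<and> \<Union> A = space \<mu> \<and> (\<forall>a\<in>A. emeasure \<mu> a \<noteq> \<infinity>)"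
    proof (intro exI[of _ "range (\<lambda>n::nat. ball (0::'a) (real n))"] conjI ballI)
      show "\<Union> (range (\<lambda>n::nat. ball (0::'a) (real n))) = space \<mu>"
        by (auto simp: \<mu>_def dist_norm intro: reals_Archimedean2)
      fix a assume "a \<in> range (\<lambda>n::nat. ball (0::'a) (real n))"
      then obtain n :: nat where a: "a = ball 0 (real n)" by auto
      have "T -` ball 0 (real n) = ball 0 (real n)" by (auto simp: norm)
      then have "emeasure \<mu> a = emeasure lborel (ball (0::'a) (real n))"
        by (simp add: \<mu>_def emeasure_distr a)
      then show "emeasure \<mu> a \<noteq> \<infinity>" using emeasure_lborel_ball_finite[of "0::'a" "real n"] by auto
    qed (auto simp: sets)
  qed
  interpret P: pair_sigma_finite \<mu> lborel ..
  define B where "B = ball (0::'a) 1"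
  have [measurable]: "B \<in> sets borel" by (simp add: B_def)
  have eB: "emeasure \<mu> B = emeasure lborel B"
  proof -
    have "T -` B = B" by (auto simp: norm B_def)
    then show ?thesis by (simp add: \<mu>_def emeasure_distr)
  qed
  fix A assume "A \<in> sets (distr lborel borel T)"
  then have [measurable]: "A \<in> sets borel" by simp
  \<comment> \<open>Integrating \<open>x\<close> first collapses by invariance of
    \<open>\<mu>\<close>. In the other order, replacing \<open>x + y\<close> by a new variable and
    using that \<open>B\<close> is symmetric gives the product with the roles of the measures
    exchanged.\<close>
  have "emeasure \<mu> A * emeasure lborel B = (\<integral>\<^sup>+y. (\<integral>\<^sup>+x. indicator A (x + y) * indicator B y \<partial>\<mu>) \<partial>lborel)"
    by (simp add: nn_integral_multc trans[of "indicator A"] nn_integral_cmult_indicator sets)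
  also have "\<dots> = (\<integral>\<^sup>+x. (\<integral>\<^sup>+y. indicator A (x + y) * indicator B y \<partial>lborel) \<partial>\<mu>)"
    by (rule P.Fubini') measurable
  also have "\<dots> = (\<integral>\<^sup>+x. (\<integral>\<^sup>+y. indicator A y * indicator B (x - y) \<partial>lborel) \<partial>\<mu>)"
  proof (rule nn_integral_cong)
    fix x
    have "(\<integral>\<^sup>+y. indicator A (x + y) * indicator B y \<partial>lborel)
      = (\<integral>\<^sup>+y. (\<lambda>z. indicator A z * indicator B (x - z) :: ennreal) (x + y) \<partial>lborel)"
      by (intro nn_integral_cong) (simp add: indicator_def B_def)
    also have "\<dots> = (\<integral>\<^sup>+y. indicator A y * indicator B (x - y) \<partial>lborel)"
      by (rule nn_integral_lborel_translate) measurable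
    finally show "(\<integral>\<^sup>+y. indicator A (x + y) * indicator B y \<partial>lborel)
      = (\<integral>\<^sup>+y. indicator A y * indicator B (x - y) \<partial>lborel)" .
  qed
  also have "\<dots> = (\<integral>\<^sup>+y. (\<integral>\<^sup>+x. indicator A y * indicator B (x - y) \<partial>\<mu>) \<partial>lborel)"
    by (rule P.Fubini'[symmetric]) measurable
  also have "\<dots> = emeasure lborel A * emeasure \<mu> B"
    using trans[of "indicator B" "- y" for y]
    by (simp add: nn_integral_cmult nn_integral_multc sets)
  finally have "emeasure \<mu> A * emeasure lborel B = emeasure lborel A * emeasure lborel B"
    by (simp add: eB)
  moreover have "emeasure lborel B \<noteq> 0" "emeasure lborel B \<noteq> \<infinity>"
    using emeasure_lborel_ball_finite[of "0::'a" 1] less_imp_neq[OF unit_ball_vol_pos[of "real DIM('a)"]]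
    by (auto simp: B_def emeasure_ball)
  ultimately show "emeasure (distr lborel borel T) A = emeasure lborel A"
    unfolding \<mu>_def by (simp add: mult.commute[of _ "emeasure lborel B"] ennreal_mult_cancel_left)
qed simp

text \<open>Reflection in the hyperplane \<open>x \<bullet> w = t\<close>. The normal
  \<open>w\<close> is not normalized, so that averages over reflections can be taken with Lebesgue
  measure in \<open>w\<close>.\<close>

definition mirror :: "'a::euclidean_space \<Rightarrow> real \<Rightarrow> 'a \<Rightarrow> 'a" where
  "mirror w t x = x - (2 * (x \<bullet> w - t) / (w \<bullet> w)) *\<^sub>R w"

lemma mirror_measurable[measurable]: "mirror w t \<in> borel_measurable borel"
  unfolding mirror_def[abs_def] by measurable

lemma inner_mirror: "w \<noteq> 0 \<Longrightarrow> mirror w t x \<bullet> w = 2 * t - x \<bullet> w"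
  by (simp add: mirror_def inner_diff_left)

lemma mirror_mirror[simp]: "w \<noteq> 0 \<Longrightarrow> mirror w t (mirror w t x) = x"
  unfolding mirror_def[of w t "mirror w t x"] by (simp add: inner_mirror) (simp add: mirror_def field_simps flip: scaleR_add_left)

text \<open>The last term carries the sign of the position of the two points: reflecting
  \<open>x\<close> moves it away from \<open>y\<close> if both lie on the same side of the
  hyperplane, and towards \<open>y\<close> if they are separated. The distance comparisons behind
  polarization are read off from it.\<close>

lemma norm_mirror_diff_left:
  assumes "w \<noteq> 0"
  shows "(norm (mirror w t x - y))\<^sup>2 = (norm (x - y))\<^sup>2 + 4 * (x \<bullet> w - t) * (y \<bullet> w - t) / (w \<bullet> w)"
proof -
  define k where "k = 2 * (x \<bullet> w - t) / (w \<bullet> w)"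
  have k: "k * (w \<bullet> w) = 2 * (x \<bullet> w - t)" using assms by (simp add: k_def)
  have "(norm (mirror w t x - y))\<^sup>2 = (norm (x - y))\<^sup>2 - 2 * k * ((x - y) \<bullet> w) + k * (k * (w \<bullet> w))"
    unfolding mirror_def k_def[symmetric] power2_norm_eq_inner
    by (simp add: algebra_simps inner_commute)
  also have "\<dots> = (norm (x - y))\<^sup>2 + 2 * k * (y \<bullet> w - t)"
    unfolding k by (simp add: algebra_simps)
  also have "2 * k * (y \<bullet> w - t) = 4 * (x \<bullet> w - t) * (y \<bullet> w - t) / (w \<bullet> w)"
    by (simp add: k_def)
  finally show ?thesis .
qed

lemma norm_mirror_diff_mirror:
  assumes "w \<noteq> 0"
  shows "norm (mirror w t x - mirror w t y) = norm (x - y)"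
proof -
  have "(norm (mirror w t x - mirror w t y))\<^sup>2 = (norm (x - mirror w t y))\<^sup>2
    - 4 * (x \<bullet> w - t) * (y \<bullet> w - t) / (w \<bullet> w)"
    by (simp add: norm_mirror_diff_left[OF assms] inner_mirror[OF assms] algebra_simps add_divide_distrib diff_divide_distrib)
  also have "(norm (x - mirror w t y))\<^sup>2 = (norm (x - y))\<^sup>2 + 4 * (x \<bullet> w - t) * (y \<bullet> w - t) / (w \<bullet> w)"
    using norm_mirror_diff_left[OF assms, of t y x] by (simp add: norm_minus_commute algebra_simps)
  finally show ?thesis by simp
qed

lemma norm_mirror:
  assumes "w \<noteq> 0"
  shows "(norm (mirror w t x))\<^sup>2 = (norm x)\<^sup>2 - 4 * t * (x \<bullet> w - t) / (w \<bullet> w)"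
  using norm_mirror_diff_left[OF assms, of t x 0] by simp

lemma nn_integral_mirror:
  fixes f :: "'a::euclidean_space \<Rightarrow> ennreal"
  assumes [measurable]: "f \<in> borel_measurable borel" and w: "w \<noteq> 0"
  shows "(\<integral>\<^sup>+x. f (mirror w t x) \<partial>lborel) = (\<integral>\<^sup>+x. f x \<partial>lborel)"
proof -
  define c where "c = (2 * t / (w \<bullet> w)) *\<^sub>R w"
  have eq: "mirror w t x = c + mirror w 0 x" for x
    by (simp add: mirror_def c_def algebra_simps diff_divide_distrib)
  have "linear (mirror w 0)"
    by (rule linearI) (simp_all add: mirror_def algebra_simps add_divide_distrib)
  moreover have "norm (mirror w 0 x) = norm x" for x
    using norm_mirror[OF w, of 0 x] by simp
  ultimately have d: "distr lborel borel (mirror w 0) = lborel" by (rule distr_lborel_isometry)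
  have "(\<integral>\<^sup>+x. f (mirror w t x) \<partial>lborel) = (\<integral>\<^sup>+x. f (c + x) \<partial>distr lborel borel (mirror w 0))"
    by (simp add: eq nn_integral_distr)
  also have "\<dots> = (\<integral>\<^sup>+x. f x \<partial>lborel)"
    unfolding d by (rule nn_integral_lborel_translate) simp
  finally show ?thesis .
qed

text \<open>Reduces an integral inequality under polarization to a pointwise one for the pair formed
  by a point and its mirror image.\<close>

lemma nn_integral_mirror_average:
  fixes f :: "'a::euclidean_space \<Rightarrow> ennreal"
  assumes [measurable]: "f \<in> borel_measurable borel" and w: "w \<noteq> 0"
  shows "(\<integral>\<^sup>+x. f x + f (mirror w t x) \<partial>lborel) = 2 * (\<integral>\<^sup>+x. f x \<partial>lborel)"
  using nn_integral_mirror[OF assms, of t] by (simp add: nn_integral_add mult_2)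

section \<open>Polarization\<close>

text \<open>All bounds hold everywhere rather than almost everywhere, so that evaluating at mirror
  images meets no exceptional sets. The almost everywhere classes are reduced to this form at the
  very end.\<close>

definition density_on :: "real \<Rightarrow> real \<Rightarrow> ('a::euclidean_space \<Rightarrow> real) \<Rightarrow> bool" where
  "density_on R M f \<longleftrightarrow> f \<in> borel_measurable borel \<and> (\<forall>x. 0 \<le> f x \<and> f x \<le> M) \<and> (\<forall>x. R < norm x \<longrightarrow> f x = 0)"

definition equimeasurable :: "('a::euclidean_space \<Rightarrow> real) \<Rightarrow> ('a \<Rightarrow> real) \<Rightarrow> bool" where
  "equimeasurable f g \<longleftrightarrow> (\<forall>h. emeasure lborel {x. h < f x} = emeasure lborel {x. h < g x})"

text \<open>Applied to two points of equal norm in both orders, the condition also says that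
  \<open>g\<close> is radial. The codomain is general because it serves real densities as well as
  kernels with values in \<open>ennreal\<close>.\<close>

definition radially_decreasing :: "('a::euclidean_space \<Rightarrow> 'b::order) \<Rightarrow> bool" where
  "radially_decreasing g \<longleftrightarrow> (\<forall>x y. norm x \<le> norm y \<longrightarrow> g y \<le> g x)"

text \<open>The larger of the two values goes to the side \<open>x \<bullet> w \<le> t\<close>,
  which contains the origin for \<open>t \<ge> 0\<close>.\<close>

definition polarize :: "'a::euclidean_space \<Rightarrow> real \<Rightarrow> ('a \<Rightarrow> real) \<Rightarrow> 'a \<Rightarrow> real" where
  "polarize w t f x = (if x \<bullet> w \<le> t then max (f x) (f (mirror w t x)) else min (f x) (f (mirror w t x)))"

lemma density_onD:
  assumes "density_on R M f"
  shows density_on_measurable: "f \<in> borel_measurable borel"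
    and density_on_nonneg: "0 \<le> f x" and density_on_le: "f x \<le> M"
    and density_on_outside: "R < norm x \<Longrightarrow> f x = 0"
  using assms by (auto simp: density_on_def)

lemma polarize_low:
  assumes "w \<noteq> 0" "x \<bullet> w \<le> t"
  shows "polarize w t f x = max (f x) (f (mirror w t x))"
    and "polarize w t f (mirror w t x) = min (f x) (f (mirror w t x))"
proof -
  show "polarize w t f x = max (f x) (f (mirror w t x))"
    using assms by (simp add: polarize_def)
  show "polarize w t f (mirror w t x) = min (f x) (f (mirror w t x))"
  proof (cases "x \<bullet> w = t")
    case True
    then have "mirror w t x = x" by (simp add: mirror_def)
    then show ?thesis using True by (simp add: polarize_def)
  next
    case False
    then show ?thesis using assms by (simp add: polarize_def inner_mirror min.commute)
  qed
qed

lemma polarize_high: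
  assumes "w \<noteq> 0" "t \<le> x \<bullet> w"
  shows "polarize w t f x = min (f x) (f (mirror w t x))"
    and "polarize w t f (mirror w t x) = max (f x) (f (mirror w t x))"
  using polarize_low[of w "mirror w t x" t f] assms
  by (simp_all add: inner_mirror min.commute max.commute)

lemma polarize_measurable[measurable]:
  assumes [measurable]: "f \<in> borel_measurable borel"
  shows "polarize w t f \<in> borel_measurable borel"
  unfolding polarize_def[abs_def] by measurable

lemma norm_mirror_ge:
  assumes "w \<noteq> 0" "t \<ge> 0" "x \<bullet> w \<le> t"
  shows "norm x \<le> norm (mirror w t x)"
proof (rule power2_le_imp_le)
  have "4 * t * (x \<bullet> w - t) / (w \<bullet> w) \<le> 0"
    using assms by (intro divide_nonpos_nonneg mult_nonneg_nonpos) auto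
  then show "(norm x)\<^sup>2 \<le> (norm (mirror w t x))\<^sup>2" by (simp add: norm_mirror[OF assms(1)])
qed simp

lemma norm_mirror_le:
  assumes "w \<noteq> 0" "t \<ge> 0" "t \<le> x \<bullet> w"
  shows "norm (mirror w t x) \<le> norm x"
  using norm_mirror_ge[of w t "mirror w t x"] assms by (simp add: inner_mirror)

lemma polarize_density_on:
  assumes f: "density_on R M f" and w: "w \<noteq> 0" and t: "t \<ge> 0"
  shows "density_on R M (polarize w t f)"
  unfolding density_on_def
proof (intro conjI allI impI)
  note [measurable] = density_on_measurable[OF f]
  note D = density_onD[OF f]
  show "polarize w t f \<in> borel_measurable borel" by measurable
  fix x
  show "0 \<le> polarize w t f x" "polarize w t f x \<le> M"
    using D(2)[of x] D(2)[of "mirror w t x"] D(3)[of x] D(3)[of "mirror w t x"]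
    by (auto simp: polarize_def)
  \<comment> \<open>On the side of the origin the mirror image is even farther out, so both values
    vanish; on the other side the minimum with \<open>f x = 0\<close> is taken.\<close>
  show "polarize w t f x = 0" if "R < norm x"
    using D(4)[of x] D(4)[of "mirror w t x"] D(2)[of "mirror w t x"] that norm_mirror_ge[OF w t, of x]
    by (auto simp: polarize_def)
qed

text \<open>Polarizing at most swaps the two values at a point and its mirror image, so the
  indicator of a superlevel set summed over the pair does not change.\<close>

lemma polarize_equimeasurable:
  assumes [measurable]: "f \<in> borel_measurable borel" and w: "w \<noteq> 0"
  shows "equimeasurable (polarize w t f) f"
  unfolding equimeasurable_def
proof
  fix h
  let ?i = "\<lambda>(f :: 'a \<Rightarrow> real) x. indicator {x. h < f x} x :: ennreal"
  have "2 * emeasure lborel {x. h < polarize w t f x}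
      = (\<integral>\<^sup>+x. ?i (polarize w t f) x + ?i (polarize w t f) (mirror w t x) \<partial>lborel)"
    by (subst nn_integral_mirror_average[OF _ w]) simp_all
  also have "\<dots> = (\<integral>\<^sup>+x. ?i f x + ?i f (mirror w t x) \<partial>lborel)"
  proof (intro nn_integral_cong)
    fix x
    show "?i (polarize w t f) x + ?i (polarize w t f) (mirror w t x) = ?i f x + ?i f (mirror w t x)"
      using polarize_low[OF w, of x t f] polarize_high[OF w, of t x f]
      by (cases "x \<bullet> w \<le> t") (auto simp: indicator_def max_def min_def add.commute)
  qed
  also have "\<dots> = 2 * emeasure lborel {x. h < f x}"
    by (subst nn_integral_mirror_average[OF _ w]) simp_all
  finally show "emeasure lborel {x. h < polarize w t f x} = emeasure lborel {x. h < f x}"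
    by (simp add: ennreal_mult_cancel_left)
qed

text \<open>The height interval on which the mirror image of a surplus point of \<open>f\<close> over \<open>g\<close> is a deficit
  point; its length is gained in \<open>L\<^sup>1\<close> distance by polarizing.\<close>

definition gain :: "'a::euclidean_space \<Rightarrow> real \<Rightarrow> ('a \<Rightarrow> real) \<Rightarrow> ('a \<Rightarrow> real) \<Rightarrow> 'a \<Rightarrow> real" where
  "gain w t f g x = max 0 (min (f x) (g (mirror w t x)) - max (g x) (f (mirror w t x)))"

lemma gain_nonneg: "0 \<le> gain w t f g x"
  by (simp add: gain_def)

lemma gain_measurable[measurable]:
  assumes [measurable]: "f \<in> borel_measurable borel" "g \<in> borel_measurable borel"
  shows "gain w t f g \<in> borel_measurable borel"
  unfolding gain_def[abs_def] by measurable

text \<open>Here \<open>a\<close>, \<open>b\<close> are the values of \<open>f\<close> and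
  \<open>\<alpha>\<close>, \<open>\<beta>\<close> those of \<open>g\<close> at a point and its
  mirror image. If \<open>b \<le> a\<close> nothing is swapped and both gains vanish. Otherwise the
  swap shortens the total distance by twice the length of the overlap of the intervals from
  \<open>a\<close> to \<open>b\<close> and from \<open>\<beta>\<close> to
  \<open>\<alpha>\<close>.\<close>

lemma two_point_gain:
  fixes a b \<alpha> \<beta> :: real
  assumes "\<beta> \<le> \<alpha>"
  shows "\<bar>max a b - \<alpha>\<bar> + \<bar>min a b - \<beta>\<bar> + 2 * (max 0 (min a \<beta> - max \<alpha> b) + max 0 (min b \<alpha> - max \<beta> a))
    \<le> \<bar>a - \<alpha>\<bar> + \<bar>b - \<beta>\<bar>"
proof -
  have 1: "max 0 (min a \<beta> - max \<alpha> b) = 0" using assms by linarith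
  show ?thesis
  proof (cases "b \<le> a")
    case True
    then have "max 0 (min b \<alpha> - max \<beta> a) = 0" by linarith
    with 1 True show ?thesis by simp
  next
    case False
    then have m: "max a b = b" "min a b = a" by simp_all
    have "\<bar>b - \<alpha>\<bar> + \<bar>a - \<beta>\<bar> + 2 * (min b \<alpha> - max \<beta> a) \<le> \<bar>a - \<alpha>\<bar> + \<bar>b - \<beta>\<bar>"
      using False assms unfolding min_def max_def by (cases "a \<le> \<beta>"; cases "b \<le> \<alpha>"; auto)
    moreover have "\<bar>b - \<alpha>\<bar> + \<bar>a - \<beta>\<bar> \<le> \<bar>a - \<alpha>\<bar> + \<bar>b - \<beta>\<bar>"
      using False assms by linarith
    ultimately show ?thesis unfolding m 1 by (simp add: max_def)
  qed
qed

lemma polarize_L1_decrease: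
  assumes f: "f \<in> borel_measurable borel" and g: "g \<in> borel_measurable borel"
    and rad: "radially_decreasing g" and w: "w \<noteq> 0" and t: "t \<ge> 0"
  shows "(\<integral>\<^sup>+x. ennreal \<bar>polarize w t f x - g x\<bar> \<partial>lborel) + 2 * (\<integral>\<^sup>+x. ennreal (gain w t f g x) \<partial>lborel)
    \<le> (\<integral>\<^sup>+x. ennreal \<bar>f x - g x\<bar> \<partial>lborel)" (is "?P + 2 * ?G \<le> ?F")
proof -
  note [measurable] = f g
  let ?m = "mirror w t"
  have pt: "\<bar>polarize w t f x - g x\<bar> + 2 * gain w t f g x
      + (\<bar>polarize w t f (?m x) - g (?m x)\<bar> + 2 * gain w t f g (?m x))
      \<le> \<bar>f x - g x\<bar> + \<bar>f (?m x) - g (?m x)\<bar>" for x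
  proof (cases "x \<bullet> w \<le> t")
    case True
    have "g (?m x) \<le> g x"
      using rad norm_mirror_ge[OF w t True] by (simp add: radially_decreasing_def)
    from two_point_gain[OF this, of "f x" "f (?m x)"] show ?thesis
      by (simp add: polarize_low[OF w True] gain_def w)
  next
    case False
    then have le: "t \<le> x \<bullet> w" by simp
    have "g x \<le> g (?m x)"
      using rad norm_mirror_le[OF w t le] by (simp add: radially_decreasing_def)
    from two_point_gain[OF this, of "f (?m x)" "f x"] show ?thesis
      by (simp add: polarize_high[OF w le] gain_def w max.commute min.commute)
  qed
  let ?u = "\<lambda>x. ennreal (\<bar>polarize w t f x - g x\<bar> + 2 * gain w t f g x)"
  have "2 * (\<integral>\<^sup>+x. ?u x \<partial>lborel) = (\<integral>\<^sup>+x. ?u x + ?u (?m x) \<partial>lborel)"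
    by (subst nn_integral_mirror_average[OF _ w]) simp_all
  also have "\<dots> \<le> (\<integral>\<^sup>+x. ennreal \<bar>f x - g x\<bar> + ennreal \<bar>f (?m x) - g (?m x)\<bar> \<partial>lborel)"
    using pt by (intro nn_integral_mono) (simp add: gain_nonneg flip: ennreal_plus)
  also have "\<dots> = 2 * ?F"
    by (subst nn_integral_mirror_average[OF _ w, of "\<lambda>x. ennreal \<bar>f x - g x\<bar>"]) simp_all
  finally have "(\<integral>\<^sup>+x. ?u x \<partial>lborel) \<le> ?F"
    by (metis ennreal_mult_le_mult_iff ennreal_numeral ennreal_neq_top  zero_neq_numeral)
  moreover have "(\<integral>\<^sup>+x. ?u x \<partial>lborel) = ?P + 2 * ?G"
    by (simp add: gain_nonneg ennreal_plus ennreal_mult nn_integral_add nn_integral_cmult)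
  ultimately show ?thesis by simp
qed

text \<open>Writes the gain as a measure of heights, which turns its average over reflections into
  an iterated integral over \<open>w\<close>, \<open>t\<close>, \<open>x\<close> and
  \<open>h\<close> that Fubini can reorder.\<close>

lemma gain_layers:
  "ennreal (gain w t f g x) = (\<integral>\<^sup>+h. indicator {g x..<f x} h *
     indicator {f (mirror w t x)..<g (mirror w t x)} h \<partial>lborel)"
proof -
  have "(\<integral>\<^sup>+h. indicator {g x..<f x} h * indicator {f (mirror w t x)..<g (mirror w t x)} h \<partial>lborel)
    = (\<integral>\<^sup>+h. indicator {max (g x) (f (mirror w t x))..<min (f x) (g (mirror w t x))} h \<partial>lborel)"
    by (intro nn_integral_cong) (auto simp: indicator_def)
  also have "\<dots> = ennreal (gain w t f g x)"
    by (cases "max (g x) (f (mirror w t x)) \<le> min (f x) (g (mirror w t x))") (auto simp: gain_def)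
  finally show ?thesis by simp
qed

section \<open>Symmetrization by polarizations\<close>

text \<open>Stands in for the unit sphere of normals. The lower bound on the norm controls a
  Jacobian, the upper bound the range of offsets \<open>t\<close>; the ratio 2 leaves, for a given
  image point, an interval of admissible lengths.\<close>

abbreviation annulus :: "'a::euclidean_space set" where
  "annulus \<equiv> {w. 1 \<le> norm w \<and> norm w \<le> 2}"

lemma mirror_measurable_compose[measurable (raw)]:
  assumes [measurable]: "w \<in> borel_measurable M" "t \<in> borel_measurable M" "x \<in> borel_measurable M"
  shows "(\<lambda>p. mirror (w p) (t p) (x p)) \<in> borel_measurable M"
  unfolding mirror_def[abs_def] by measurable

lemma mirror_offset:
  assumes "w \<noteq> 0"
  shows "mirror w (x \<bullet> w - s * (w \<bullet> w) / 2) x = x - s *\<^sub>R w"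
  using assms by (simp add: mirror_def)

text \<open>Mirror images of a fixed point spread over the whole space: writing the image as \<open>x - s *\<^sub>R w\<close>,
  the offset \<open>t\<close> is traded for \<open>s\<close> and then \<open>w\<close> for the image point.\<close>

lemma nn_integral_mirror_images_ge:
  fixes x :: "'a::euclidean_space"
  assumes [measurable]: "B \<in> sets borel" and B: "\<And>y. y \<in> B \<Longrightarrow> norm y \<le> norm x"
    and x: "norm x \<le> R" and R: "R > 0"
  shows "ennreal (1 / (4 * (2 * R) ^ (DIM('a) - 1))) * emeasure lborel B
    \<le> (\<integral>\<^sup>+w. \<integral>\<^sup>+t. indicator annulus w * indicator {0..2*R} t * indicator B (mirror w t x) \<partial>lborel \<partial>lborel)"
proof -
  let ?n = "DIM('a)"
  have annulus_sets[measurable]: "annulus \<in> sets (borel :: 'a measure)" by measurable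
  \<comment> \<open>Substitutes \<open>t = x \<bullet> w - s * (w \<bullet> w) / 2\<close>. The
    Jacobian is \<open>w \<bullet> w / 2\<close>, at least one half on the annulus.\<close>
  have offset: "ennreal (1/2) * (\<integral>\<^sup>+s. indicator annulus w * indicator {0<..} s * indicator B (x - s *\<^sub>R w) \<partial>lborel)
    \<le> (\<integral>\<^sup>+t. indicator annulus w * indicator {0..2*R} t * indicator B (mirror w t x) \<partial>lborel)" for w :: 'a
  proof (cases "w \<in> annulus")
    case True
    then have w: "w \<noteq> 0" and ww: "w \<bullet> w \<ge> 1" and w2: "norm w \<le> 2"
      by (auto simp: dot_square_norm power2_eq_square intro: mult_ge1_I)
    have "(\<integral>\<^sup>+t. indicator annulus w * indicator {0..2*R} t * indicator B (mirror w t x) \<partial>lborel)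
      = ennreal \<bar>- (w \<bullet> w / 2)\<bar> * (\<integral>\<^sup>+s. indicator annulus w * indicator {0..2*R} (x \<bullet> w + - (w \<bullet> w / 2) * s)
          * indicator B (mirror w (x \<bullet> w + - (w \<bullet> w / 2) * s) x) \<partial>lborel)"
      using w by (intro nn_integral_real_affine) auto
    also have "\<dots> \<ge> ennreal (1/2) * (\<integral>\<^sup>+s. indicator annulus w * indicator {0<..} s * indicator B (x - s *\<^sub>R w) \<partial>lborel)"
    proof (rule mult_mono[OF _ nn_integral_mono])
      show "ennreal (1/2) \<le> ennreal \<bar>- (w \<bullet> w / 2)\<bar>" using ww by (intro ennreal_leI) simp
      fix s :: real
      have eq: "x \<bullet> w + - (w \<bullet> w / 2) * s = x \<bullet> w - s * (w \<bullet> w) / 2" by simp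
      \<comment> \<open>Restricting \<open>t\<close> to \<open>{0..2*R}\<close> loses nothing: an
        image no farther from the origin than \<open>x\<close> forces a nonnegative offset, and
        Cauchy-Schwarz with \<open>norm w \<le> 2\<close> gives the upper bound.\<close>
      have "0 \<le> x \<bullet> w - s * (w \<bullet> w) / 2 \<and> x \<bullet> w - s * (w \<bullet> w) / 2 \<le> 2 * R"
        if s: "s > 0" and y: "x - s *\<^sub>R w \<in> B"
      proof
        have "(norm (x - s *\<^sub>R w))\<^sup>2 \<le> (norm x)\<^sup>2" using B[OF y] by (simp add: power_mono)
        then have "0 \<le> 2 * s * (x \<bullet> w - s * (w \<bullet> w) / 2)"
          by (simp add: power2_norm_eq_inner algebra_simps inner_commute)
        then show "0 \<le> x \<bullet> w - s * (w \<bullet> w) / 2" using s by (simp add: zero_le_mult_iff)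
        have "x \<bullet> w - s * (w \<bullet> w) / 2 \<le> x \<bullet> w" using s ww by simp
        also have "\<dots> \<le> norm x * norm w" by (rule norm_cauchy_schwarz)
        also have "\<dots> \<le> R * 2" using x w2 R by (intro mult_mono) auto
        finally show "x \<bullet> w - s * (w \<bullet> w) / 2 \<le> 2 * R" by simp
      qed
      then show "indicator annulus w * indicator {0<..} s * indicator B (x - s *\<^sub>R w)
        \<le> (indicator annulus w * indicator {0..2*R} (x \<bullet> w + - (w \<bullet> w / 2) * s)
          * indicator B (mirror w (x \<bullet> w + - (w \<bullet> w / 2) * s) x) :: ennreal)"
        unfolding eq mirror_offset[OF w] by (auto simp: indicator_def)
    qed auto
    finally show ?thesis .
  qed simp
  \<comment> \<open>Substitutes \<open>y = x - s *\<^sub>R w\<close> with Jacobian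
    \<open>s ^ n\<close>; the annulus condition on \<open>w\<close> becomes an interval for
    \<open>s\<close> between half the distance and the distance from \<open>x\<close> to
    \<open>y\<close>.\<close>
  have image: "(\<integral>\<^sup>+w. indicator annulus w * indicator {0<..} s * indicator B (x - s *\<^sub>R w) \<partial>lborel)
     = (\<integral>\<^sup>+y. ennreal (1 / s ^ ?n) * (indicator {0<..} s * indicator {norm (x - y) / 2..norm (x - y)} s * indicator B y) \<partial>lborel)"
     (is "?l = ?r") for s :: real
  proof (cases "s > 0")
    case True
    have "(\<integral>\<^sup>+y. indicator {norm (x - y) / 2..norm (x - y)} s * indicator B y \<partial>lborel)
      = ennreal (\<bar>-s\<bar> ^ ?n) * (\<integral>\<^sup>+w. indicator {norm (x - (x + (-s) *\<^sub>R w)) / 2..norm (x - (x + (-s) *\<^sub>R w))} s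
          * indicator B (x + (-s) *\<^sub>R w) \<partial>lborel)"
      using True by (intro nn_integral_lborel_scale[where f = "\<lambda>y. indicator {norm (x - y) / 2..norm (x - y)} s * indicator B y"])
        (auto simp: indicator_def[of "{_.._}"])
    also have "(\<integral>\<^sup>+w. indicator {norm (x - (x + (-s) *\<^sub>R w)) / 2..norm (x - (x + (-s) *\<^sub>R w))} s
          * indicator B (x + (-s) *\<^sub>R w) \<partial>lborel) = ?l"
      using True by (intro nn_integral_cong) (auto simp: indicator_def)
    finally have "(\<integral>\<^sup>+y. indicator {norm (x - y) / 2..norm (x - y)} s * indicator B y \<partial>lborel) = ennreal (s ^ ?n) * ?l"
      using True by simp
    moreover have "?r = ennreal (1 / s ^ ?n) * (\<integral>\<^sup>+y. indicator {norm (x - y) / 2..norm (x - y)} s * indicator B y \<partial>lborel)"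
      using True by (subst nn_integral_cmult[symmetric]) (auto simp: indicator_def[of "{_.._}"])
    moreover have "ennreal (1 / s ^ ?n) * (ennreal (s ^ ?n) * ?l) = ?l"
      using True by (simp add: mult.assoc[symmetric] flip: ennreal_mult)
    ultimately show ?thesis by simp
  qed simp
  \<comment> \<open>For a fixed image \<open>y\<close> at distance \<open>d\<close> the admissible
    \<open>s\<close> fill an interval of length \<open>d / 2\<close>, on which
    \<open>1 / s ^ n\<close> is at least \<open>1 / d ^ n\<close>; then
    \<open>d \<le> 2 * R\<close>.\<close>
  have radial: "ennreal (1 / (2 * (2 * R) ^ (?n - 1))) * indicator B y
    \<le> (\<integral>\<^sup>+s. ennreal (1 / s ^ ?n) * (indicator {0<..} s * indicator {norm (x - y) / 2..norm (x - y)} s * indicator B y) \<partial>lborel)"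
    if yx: "y \<noteq> x" for y
  proof (cases "y \<in> B")
    case True
    define d where "d = norm (x - y)"
    have d: "d > 0" "d \<le> 2 * R"
      using yx B[OF True] x norm_triangle_ineq4[of x y] by (auto simp: d_def)
    have n: "d ^ ?n = d * d ^ (?n - 1)" using DIM_positive[where 'a='a] by (metis power_eq_if neq0_conv)
    have "1 / (2 * (2 * R) ^ (?n - 1)) \<le> 1 / (2 * d ^ (?n - 1))"
      using d by (intro divide_left_mono mult_left_mono power_mono) auto
    also have "\<dots> = (1 / d ^ ?n) * (d / 2)" using d by (subst n) simp
    finally have "ennreal (1 / (2 * (2 * R) ^ (?n - 1))) \<le> ennreal (1 / d ^ ?n) * ennreal (d / 2)"
      using d by (subst ennreal_mult[symmetric]) (auto intro: ennreal_leI)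
    also have "ennreal (d / 2) = emeasure lborel {d / 2..d}" using d by (simp add: field_simps)
    also have "ennreal (1 / d ^ ?n) * \<dots> = (\<integral>\<^sup>+s. ennreal (1 / d ^ ?n) * indicator {d / 2..d} s \<partial>lborel)"
      by (simp add: nn_integral_cmult_indicator)
    also have "\<dots> \<le> (\<integral>\<^sup>+s. ennreal (1 / s ^ ?n) * (indicator {0<..} s * indicator {d / 2..d} s) \<partial>lborel)"
    proof (intro nn_integral_mono)
      fix s
      have "1 / d ^ ?n \<le> 1 / s ^ ?n" if "d / 2 \<le> s" "s \<le> d"
        using that d by (intro divide_left_mono power_mono mult_pos_pos) auto
      then show "ennreal (1 / d ^ ?n) * indicator {d / 2..d} s
        \<le> ennreal (1 / s ^ ?n) * (indicator {0<..} s * indicator {d / 2..d} s)"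
        using d by (auto simp: indicator_def intro: ennreal_leI)
    qed
    finally show ?thesis using True by (simp add: d_def)
  qed simp
  have c: "1 / (4 * (2 * R) ^ (?n - 1)) = (1/2) * (1 / (2 * (2 * R) ^ (?n - 1)))" by simp
  have "ennreal (1 / (4 * (2 * R) ^ (?n - 1))) * emeasure lborel B
    = ennreal (1/2) * (\<integral>\<^sup>+y. ennreal (1 / (2 * (2 * R) ^ (?n - 1))) * indicator B y \<partial>lborel)"
    unfolding c using R by (subst ennreal_mult) (auto simp: nn_integral_cmult_indicator mult.assoc)
  also have "\<dots> \<le> ennreal (1/2) * (\<integral>\<^sup>+y. \<integral>\<^sup>+s. ennreal (1 / s ^ ?n) * (indicator {0<..} s
      * indicator {norm (x - y) / 2..norm (x - y)} s * indicator B y) \<partial>lborel \<partial>lborel)"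
    using radial AE_lborel_singleton[of x] by (intro mult_left_mono nn_integral_mono_AE) auto
  also have "\<dots> = ennreal (1/2) * (\<integral>\<^sup>+s. \<integral>\<^sup>+y. ennreal (1 / s ^ ?n) * (indicator {0<..} s
      * indicator {norm (x - y) / 2..norm (x - y)} s * indicator B y) \<partial>lborel \<partial>lborel)"
    by (subst lborel_pair.Fubini') (auto simp: indicator_def[of "{_.._}"])
  also have "\<dots> = ennreal (1/2) * (\<integral>\<^sup>+s. \<integral>\<^sup>+w. indicator annulus w * indicator {0<..} s * indicator B (x - s *\<^sub>R w) \<partial>lborel \<partial>lborel)"
    by (simp add: image)
  also have "\<dots> = ennreal (1/2) * (\<integral>\<^sup>+w. \<integral>\<^sup>+s. indicator annulus w * indicator {0<..} s * indicator B (x - s *\<^sub>R w) \<partial>lborel \<partial>lborel)"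
    by (subst lborel_pair.Fubini') auto
  also have "\<dots> = (\<integral>\<^sup>+w. ennreal (1/2) * (\<integral>\<^sup>+s. indicator annulus w * indicator {0<..} s * indicator B (x - s *\<^sub>R w) \<partial>lborel) \<partial>lborel)"
    by (subst nn_integral_cmult) auto
  also have "\<dots> \<le> (\<integral>\<^sup>+w. \<integral>\<^sup>+t. indicator annulus w * indicator {0..2*R} t * indicator B (mirror w t x) \<partial>lborel \<partial>lborel)"
    by (intro nn_integral_mono offset)
  finally show ?thesis .
qed

section \<open>Average gain of a reflection in terms of the \<open>L1\<close> distance\<close>

lemma nn_integral_abs_diff_layers:
  fixes a b :: real
  shows "ennreal \<bar>a - b\<bar> = (\<integral>\<^sup>+h. indicator {b..<a} h + indicator {a..<b} h \<partial>lborel)"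
  by (cases "a \<le> b") (simp_all add: nn_integral_add)

lemma density_on_emeasure_finite:
  assumes f: "density_on R M f" and "h \<ge> 0"
  shows "emeasure lborel {x. h < f x} < \<infinity>"
proof -
  have "norm x \<le> R" if "h < f x" for x
    using density_on_outside[OF f, of x] that assms(2) by (cases "norm x \<le> R") auto
  then have "{x. h < f x} \<subseteq> cball 0 R" by auto
  then have "emeasure lborel {x. h < f x} \<le> emeasure lborel (cball (0::'a) R)"
    by (intro emeasure_mono) auto
  then show ?thesis using emeasure_lborel_cball_finite[of "0::'a" R] by (auto simp: top_unique less_top)
qed

text \<open>Both superlevel sets have the same measure, finite because \<open>h \<ge> 0\<close>, so
  their common part can be cancelled.\<close>

lemma equimeasurable_diff:
  assumes f: "density_on R M f" and g: "density_on R M g" and eq: "equimeasurable f g" and h: "h \<ge> 0"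
  shows "emeasure lborel {x. f x \<le> h \<and> h < g x} = emeasure lborel {x. g x \<le> h \<and> h < f x}"
proof -
  note [measurable] = density_on_measurable[OF f] density_on_measurable[OF g]
  let ?I = "emeasure lborel {x. h < f x \<and> h < g x}"
  have "emeasure lborel {x. h < f x} = ?I + emeasure lborel {x. g x \<le> h \<and> h < f x}"
    by (subst plus_emeasure) (auto intro!: arg_cong[where f="emeasure lborel"])
  moreover have "emeasure lborel {x. h < g x} = ?I + emeasure lborel {x. f x \<le> h \<and> h < g x}"
    by (subst plus_emeasure) (auto intro!: arg_cong[where f="emeasure lborel"])
  moreover have "?I \<le> emeasure lborel {x. h < f x}" by (intro emeasure_mono) auto
  then have "?I \<noteq> \<infinity>" using density_on_emeasure_finite[OF f h] by (auto simp: top_unique)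
  ultimately show ?thesis
    using eq unfolding equimeasurable_def by (metis ennreal_add_left_cancel)
qed

text \<open>At height \<open>h\<close> the surplus set \<open>P\<close> and the deficit set
  \<open>Q\<close> have the same measure \<open>a h\<close>. By the estimate on mirror images,
  reflections carry surplus points into \<open>Q\<close> with average at least a constant times
  \<open>(a h)\<^sup>2\<close>. The \<open>L1\<close> distance is twice the integral of
  \<open>a\<close>, and Cauchy-Schwarz compares the two.\<close>

lemma gain_average:
  fixes f g :: "'a::euclidean_space \<Rightarrow> real"
  assumes f: "density_on R M f" and g: "density_on R M g" and rad: "radially_decreasing g"
    and eq: "equimeasurable f g" and R: "R > 0"
  shows "ennreal (1 / (4 * (2 * R) ^ (DIM('a) - 1))) * (\<integral>\<^sup>+x. ennreal \<bar>f x - g x\<bar> \<partial>lborel)\<^sup>2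
    \<le> 4 * ennreal M * (\<integral>\<^sup>+w. \<integral>\<^sup>+t. indicator annulus w * indicator {0..2*R} t
        * (\<integral>\<^sup>+x. ennreal (gain w t f g x) \<partial>lborel) \<partial>lborel \<partial>lborel)"
    (is "ennreal ?\<kappa> * ?\<delta>\<^sup>2 \<le> 4 * ennreal M * ?S")
proof -
  note [measurable] = density_on_measurable[OF f] density_on_measurable[OF g]
  have annulus_sets[measurable]: "annulus \<in> sets (borel :: 'a measure)" by measurable
  have M: "M \<ge> 0" using density_on_nonneg[OF f, of 0] density_on_le[OF f, of 0] by linarith
  define P :: "'a \<Rightarrow> real \<Rightarrow> bool" where "P x h \<longleftrightarrow> g x \<le> h \<and> h < f x" for x h
  define Q :: "'a \<Rightarrow> real \<Rightarrow> bool" where "Q x h \<longleftrightarrow> f x \<le> h \<and> h < g x" for x h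
  have [measurable]: "Measurable.pred M (\<lambda>p. P (x p) (h p))" "Measurable.pred M (\<lambda>p. Q (x p) (h p))"
    if [measurable]: "x \<in> borel_measurable M" "h \<in> borel_measurable M" for x h and M :: "'b measure"
    unfolding P_def Q_def by measurable
  \<comment> \<open>Since \<open>g x \<le> h < g y\<close> and \<open>g\<close> decreases radially,
    every deficit point is at least as close to the origin as every surplus point, as the estimate
    on mirror images demands.\<close>
  have PQ: "norm y \<le> norm x \<and> norm x \<le> R" if "P x h" "Q y h" "h \<ge> 0" for x y h
  proof
    show "norm y \<le> norm x"
      using that rad unfolding P_def Q_def radially_decreasing_def by (meson linorder_le_cases not_le order_trans)
    show "norm x \<le> R"
      using that density_on_outside[OF f, of x] unfolding P_def by force
  qed
  define a where "a h = emeasure lborel {x. P x h}" for h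
  have a_eq: "a h = (\<integral>\<^sup>+x. of_bool (P x h) \<partial>lborel)" for h
    by (simp add: a_def flip: nn_integral_indicator) (simp add: indicator_def of_bool_def)
  have [measurable]: "a \<in> borel_measurable borel"
    unfolding a_eq[abs_def] by measurable
  have aQ: "emeasure lborel {x. Q x h} = a h" if "h \<ge> 0" for h
    using equimeasurable_diff[OF f g eq that] by (simp add: a_def P_def Q_def)
  let ?T = "\<integral>\<^sup>+h. indicator {0..M} h * (a h)\<^sup>2 \<partial>lborel"
  define F :: "'a \<Rightarrow> real \<Rightarrow> 'a \<Rightarrow> real \<Rightarrow> ennreal" where
    "F w t x h = of_bool (w \<in> annulus \<and> 0 \<le> t \<and> t \<le> 2 * R \<and> P x h \<and> Q (mirror w t x) h)" for w t x h
  have [measurable]: "(\<lambda>p. F (w p) (t p) (x p) (h p)) \<in> borel_measurable M"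
    if [measurable]: "w \<in> borel_measurable M" "t \<in> borel_measurable M" "x \<in> borel_measurable M" "h \<in> borel_measurable M"
    for w t x h and M :: "'b measure"
    unfolding F_def of_bool_def by measurable
  \<comment> \<open>The exchanges of integrals move \<open>h\<close> and \<open>x\<close> outermost.
    For a fixed surplus point \<open>x\<close> at height \<open>h\<close>, what remains inside is
    the measure of reflections bounded by \<open>nn_integral_mirror_images_ge\<close>.\<close>
  have "?S = (\<integral>\<^sup>+w. \<integral>\<^sup>+t. \<integral>\<^sup>+x. \<integral>\<^sup>+h. F w t x h \<partial>lborel \<partial>lborel \<partial>lborel \<partial>lborel)"
    unfolding gain_layers F_def P_def Q_def
    by (subst nn_integral_cmult[symmetric], measurable)+
      (auto intro!: nn_integral_cong simp: indicator_def)
  also have "\<dots> = (\<integral>\<^sup>+w. \<integral>\<^sup>+t. \<integral>\<^sup>+h. \<integral>\<^sup>+x. F w t x h \<partial>lborel \<partial>lborel \<partial>lborel \<partial>lborel)"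
    by (intro nn_integral_cong lborel_pair.Fubini') measurable
  also have "\<dots> = (\<integral>\<^sup>+w. \<integral>\<^sup>+h. \<integral>\<^sup>+t. \<integral>\<^sup>+x. F w t x h \<partial>lborel \<partial>lborel \<partial>lborel \<partial>lborel)"
    by (intro nn_integral_cong lborel_pair.Fubini') measurable
  also have "\<dots> = (\<integral>\<^sup>+h. \<integral>\<^sup>+w. \<integral>\<^sup>+t. \<integral>\<^sup>+x. F w t x h \<partial>lborel \<partial>lborel \<partial>lborel \<partial>lborel)"
    by (intro lborel_pair.Fubini') measurable
  also have "\<dots> = (\<integral>\<^sup>+h. \<integral>\<^sup>+w. \<integral>\<^sup>+x. \<integral>\<^sup>+t. F w t x h \<partial>lborel \<partial>lborel \<partial>lborel \<partial>lborel)"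
    by (intro nn_integral_cong lborel_pair.Fubini') measurable
  also have "\<dots> = (\<integral>\<^sup>+h. \<integral>\<^sup>+x. \<integral>\<^sup>+w. \<integral>\<^sup>+t. F w t x h \<partial>lborel \<partial>lborel \<partial>lborel \<partial>lborel)"
    by (intro nn_integral_cong lborel_pair.Fubini') measurable
  also have "\<dots> \<ge> (\<integral>\<^sup>+h. ennreal ?\<kappa> * (indicator {0..M} h * (a h)\<^sup>2) \<partial>lborel)"
  proof (rule nn_integral_mono)
    fix h :: real
    show "ennreal ?\<kappa> * (indicator {0..M} h * (a h)\<^sup>2) \<le> (\<integral>\<^sup>+x. \<integral>\<^sup>+w. \<integral>\<^sup>+t. F w t x h \<partial>lborel \<partial>lborel \<partial>lborel)"
    proof (cases "h \<in> {0..M}")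
      case True
      have "ennreal ?\<kappa> * (a h)\<^sup>2 = (\<integral>\<^sup>+x. of_bool (P x h) * (ennreal ?\<kappa> * a h) \<partial>lborel)"
        by (subst nn_integral_multc) (auto simp: power2_eq_square mult_ac simp flip: a_eq)
      also have "\<dots> \<le> (\<integral>\<^sup>+x. \<integral>\<^sup>+w. \<integral>\<^sup>+t. F w t x h \<partial>lborel \<partial>lborel \<partial>lborel)"
      proof (rule nn_integral_mono)
        fix x
        show "of_bool (P x h) * (ennreal ?\<kappa> * a h) \<le> (\<integral>\<^sup>+w. \<integral>\<^sup>+t. F w t x h \<partial>lborel \<partial>lborel)"
        proof (cases "P x h \<and> (\<exists>y. Q y h)")
          case True': True
          have "ennreal ?\<kappa> * emeasure lborel {y. Q y h} \<le> (\<integral>\<^sup>+w. \<integral>\<^sup>+t. indicator annulus w * indicator {0..2*R} t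
              * indicator {y. Q y h} (mirror w t x) \<partial>lborel \<partial>lborel)"
            using PQ[of x h] True True' R by (intro nn_integral_mirror_images_ge) auto
          also have "\<dots> = (\<integral>\<^sup>+w. \<integral>\<^sup>+t. F w t x h \<partial>lborel \<partial>lborel)"
            using True' by (intro nn_integral_cong) (auto simp: F_def indicator_def)
          finally show ?thesis using True True' by (simp add: aQ)
        next
          case False
          then have "P x h \<Longrightarrow> {y. Q y h} = {}" by blast
          then have "of_bool (P x h) * a h = 0" using aQ[of h] True by (auto simp: of_bool_def)
          then show ?thesis by (auto simp: of_bool_def)
        qed
      qed
      finally show ?thesis using True by simp
    qed simp
  qed
  finally have S: "ennreal ?\<kappa> * ?T \<le> ?S"
    by (subst (asm) nn_integral_cmult) auto
  have "?\<delta> = (\<integral>\<^sup>+x. \<integral>\<^sup>+h. indicator {0..M} h * (of_bool (P x h) + of_bool (Q x h)) \<partial>lborel \<partial>lborel)"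
  proof (rule nn_integral_cong)
    fix x
    have "indicator {g x..<f x} h + indicator {f x..<g x} h
      = indicator {0..M} h * (of_bool (P x h) + of_bool (Q x h) :: ennreal)" for h
      using density_on_nonneg[OF f, of x] density_on_nonneg[OF g, of x] density_on_le[OF f, of x] density_on_le[OF g, of x]
      by (auto simp: indicator_def P_def Q_def)
    then show "ennreal \<bar>f x - g x\<bar> = (\<integral>\<^sup>+h. indicator {0..M} h * (of_bool (P x h) + of_bool (Q x h)) \<partial>lborel)"
      by (simp add: nn_integral_abs_diff_layers)
  qed
  also have "\<dots> = (\<integral>\<^sup>+h. \<integral>\<^sup>+x. indicator {0..M} h * (of_bool (P x h) + of_bool (Q x h)) \<partial>lborel \<partial>lborel)"
    by (intro lborel_pair.Fubini') measurable
  also have "\<dots> = (\<integral>\<^sup>+h. 2 * (a h * indicator {0..M} h) \<partial>lborel)"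
  proof (rule nn_integral_cong)
    fix h :: real
    have "(\<integral>\<^sup>+x. of_bool (Q x h) \<partial>lborel) = emeasure lborel {x. Q x h}"
      by (simp flip: nn_integral_indicator) (simp add: indicator_def of_bool_def)
    then show "(\<integral>\<^sup>+x. indicator {0..M} h * (of_bool (P x h) + of_bool (Q x h)) \<partial>lborel) = 2 * (a h * indicator {0..M} h)"
      by (cases "h \<in> {0..M}") (simp_all add: nn_integral_add aQ mult_2 flip: a_eq)
  qed
  finally have "?\<delta> = 2 * (\<integral>\<^sup>+h. a h * indicator {0..M} h \<partial>lborel)"
    by (simp add: nn_integral_cmult)
  \<comment> \<open>The duplicated indicator is the second factor for Cauchy-Schwarz; its square
    integrates to \<open>M\<close>.\<close>
  then have "?\<delta>\<^sup>2 = 4 * (\<integral>\<^sup>+h. (a h * indicator {0..M} h) * indicator {0..M} h \<partial>lborel)\<^sup>2"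
    by (simp add: power_mult_distrib mult.assoc indicator_inter_arith[symmetric])
  also have "\<dots> \<le> 4 * ((\<integral>\<^sup>+h. (a h * indicator {0..M} h)\<^sup>2 \<partial>lborel) * (\<integral>\<^sup>+h. (indicator {0..M} h)\<^sup>2 \<partial>lborel))"
    by (intro mult_left_mono Cauchy_Schwarz_nn_integral) auto
  also have "(\<integral>\<^sup>+h. (a h * indicator {0..M} h)\<^sup>2 \<partial>lborel) = ?T"
    by (intro nn_integral_cong) (auto simp: indicator_def)
  also have "(\<integral>\<^sup>+h. (indicator {0..M} h)\<^sup>2 \<partial>lborel) = (\<integral>\<^sup>+h. indicator {0..M} h \<partial>lborel)"
    by (intro nn_integral_cong) (auto simp: indicator_def)
  also have "\<dots> = ennreal M" using M by simp
  finally have "ennreal ?\<kappa> * ?\<delta>\<^sup>2 \<le> ennreal ?\<kappa> * (4 * (?T * ennreal M))"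
    by (rule mult_left_mono) simp
  also have "\<dots> = 4 * ennreal M * (ennreal ?\<kappa> * ?T)"
    by (simp add: mult_ac)
  also have "\<dots> \<le> 4 * ennreal M * ?S" by (intro mult_left_mono S) simp
  finally show ?thesis .
qed

lemma ball_sets_borel[measurable, simp]:
  "ball (x::'a::metric_space) r \<in> sets borel" "cball x r \<in> sets borel"
  by simp_all

lemma indicator_ball_measurable[measurable, simp]:
  "indicator (ball (x::'a::metric_space) r) \<in> borel_measurable borel" "indicator (cball x r) \<in> borel_measurable borel"
  by (simp_all add: borel_measurable_indicator)

lemma density_on_L1_finite:
  fixes f g :: "'a::euclidean_space \<Rightarrow> real"
  assumes f: "density_on R M f" and g: "density_on R M g"
  shows "(\<integral>\<^sup>+x. ennreal \<bar>f x - g x\<bar> \<partial>lborel) < \<infinity>"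
proof -
  have "(\<integral>\<^sup>+x. ennreal \<bar>f x - g x\<bar> \<partial>lborel) \<le> (\<integral>\<^sup>+x. ennreal M * indicator (cball (0::'a) R) x \<partial>lborel)"
  proof (rule nn_integral_mono)
    fix x
    show "ennreal \<bar>f x - g x\<bar> \<le> ennreal M * indicator (cball 0 R) x"
      using density_onD(2-4)[OF f, of x] density_onD(2-4)[OF g, of x]
      by (cases "norm x \<le> R") (auto intro!: ennreal_leI)
  qed
  also have "\<dots> < \<infinity>"
    using emeasure_lborel_cball_finite[of "0::'a" R]
    by (simp add: nn_integral_cmult_indicator ennreal_mult_less_top less_top)
  finally show ?thesis .
qed

text \<open>Pigeonhole on \<open>gain_average\<close>: some reflection gains at least a fixed share
  of the average. It matters that \<open>\<eta>\<close> is chosen before \<open>f\<close>, because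
  the infimum argument applies it to all competitors at once.\<close>

lemma polarization_improves:
  fixes g :: "'a::euclidean_space \<Rightarrow> real"
  assumes g: "density_on R M g" and rad: "radially_decreasing g" and R: "R > 0" and M: "M > 0"
  obtains \<eta> :: real where "\<eta> > 0"
    and "\<And>f. density_on R M f \<Longrightarrow> equimeasurable f g \<Longrightarrow> \<exists>w t. w \<noteq> 0 \<and> t \<ge> 0 \<and>
      (\<integral>\<^sup>+x. ennreal \<bar>polarize w t f x - g x\<bar> \<partial>lborel) + ennreal \<eta> * (\<integral>\<^sup>+x. ennreal \<bar>f x - g x\<bar> \<partial>lborel)\<^sup>2
      \<le> (\<integral>\<^sup>+x. ennreal \<bar>f x - g x\<bar> \<partial>lborel)"
proof -
  define \<kappa> where "\<kappa> = 1 / (4 * (2 * R) ^ (DIM('a) - 1))"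
  define V where "V = measure lborel (cball (0::'a) 2)"
  have V: "V > 0" by (simp add: V_def content_cball)
  have \<kappa>: "\<kappa> > 0" using R by (simp add: \<kappa>_def)
  \<comment> \<open>Half of the threshold at which the averages would just balance: parameters have
    total measure at most \<open>V * (2 * R)\<close>, and too small gains everywhere would yield
    \<open>\<kappa> * \<delta>\<^sup>2 \<le> \<kappa> * \<delta>\<^sup>2 / 2\<close>.\<close>
  define \<eta> where "\<eta> = \<kappa> / (8 * M * R * V)"
  have \<eta>: "\<eta> > 0" using V \<kappa> M R by (simp add: \<eta>_def)
  show ?thesis
  proof (rule that[OF \<eta>])
    fix f :: "'a \<Rightarrow> real" assume f: "density_on R M f" and eq: "equimeasurable f g"
    note [measurable] = density_on_measurable[OF f] density_on_measurable[OF g]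
    have annulus_sets[measurable]: "annulus \<in> sets (borel :: 'a measure)" by measurable
    let ?S = "\<integral>\<^sup>+w. \<integral>\<^sup>+t. indicator annulus w * indicator {0..2*R} t
      * (\<integral>\<^sup>+x. ennreal (gain w t f g x) \<partial>lborel) \<partial>lborel \<partial>lborel"
    define \<delta> where "\<delta> = enn2real (\<integral>\<^sup>+x. ennreal \<bar>f x - g x\<bar> \<partial>lborel)"
    have \<delta>: "(\<integral>\<^sup>+x. ennreal \<bar>f x - g x\<bar> \<partial>lborel) = ennreal \<delta>" "\<delta> \<ge> 0"
      using density_on_L1_finite[OF f g] by (auto simp: \<delta>_def)
    have "\<exists>w t. w \<noteq> 0 \<and> t \<ge> 0 \<and> ennreal (\<eta> * \<delta>\<^sup>2) \<le> 2 * (\<integral>\<^sup>+x. ennreal (gain w t f g x) \<partial>lborel)"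
    proof (cases "\<delta> = 0")
      case True
      obtain w :: 'a where "w \<noteq> 0" using nonzero_Basis by blast
      then show ?thesis using True by (intro exI[of _ w] exI[of _ "0::real"]) simp
    next
      case False
      show ?thesis
      proof (rule ccontr)
        assume "\<not> ?thesis"
        then have G: "2 * (\<integral>\<^sup>+x. ennreal (gain w t f g x) \<partial>lborel) \<le> ennreal (\<eta> * \<delta>\<^sup>2)"
          if "w \<noteq> 0" "t \<ge> 0" for w t using that by (metis linear)
        have [measurable]: "(\<lambda>p. \<integral>\<^sup>+x. ennreal (gain (w p) (t p) f g x) \<partial>lborel) \<in> borel_measurable N"
          if [measurable]: "w \<in> borel_measurable N" "t \<in> borel_measurable N" for w t and N :: "'b measure"
          unfolding gain_def by measurable
        have "2 * ?S
          = (\<integral>\<^sup>+w. \<integral>\<^sup>+t. indicator annulus w * indicator {0..2*R} t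
            * (2 * (\<integral>\<^sup>+x. ennreal (gain w t f g x) \<partial>lborel)) \<partial>lborel \<partial>lborel)"
        proof (subst nn_integral_cmult[symmetric], measurable, rule nn_integral_cong)
          fix w :: 'a
          show "2 * (\<integral>\<^sup>+t. indicator annulus w * indicator {0..2*R} t * (\<integral>\<^sup>+x. ennreal (gain w t f g x) \<partial>lborel) \<partial>lborel)
            = (\<integral>\<^sup>+t. indicator annulus w * indicator {0..2*R} t * (2 * (\<integral>\<^sup>+x. ennreal (gain w t f g x) \<partial>lborel)) \<partial>lborel)"
            by (subst nn_integral_cmult[symmetric]) (auto simp: mult.left_commute)
        qed
        also have "\<dots> \<le> (\<integral>\<^sup>+w. \<integral>\<^sup>+t. indicator (cball 0 2) w * (ennreal (\<eta> * \<delta>\<^sup>2) * indicator {0..2*R} t) \<partial>lborel \<partial>(lborel :: 'a measure))"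
          by (intro nn_integral_mono) (auto simp: indicator_def intro!: G)
        also have "\<dots> = (\<integral>\<^sup>+w. indicator (cball (0::'a) 2) w * (ennreal (\<eta> * \<delta>\<^sup>2) * ennreal (2 * R)) \<partial>lborel)"
          using R by (simp add: nn_integral_cmult nn_integral_cmult_indicator)
        also have "\<dots> = emeasure lborel (cball (0::'a) 2) * (ennreal (\<eta> * \<delta>\<^sup>2) * ennreal (2 * R))"
          by (subst nn_integral_multc) simp_all
        also have "emeasure lborel (cball (0::'a) 2) = ennreal V"
          unfolding V_def by (rule emeasure_eq_ennreal_measure) (use emeasure_lborel_cball_finite[of "0::'a" 2] in auto)
        finally have S: "2 * ?S \<le> ennreal (V * (\<eta> * \<delta>\<^sup>2 * (2 * R)))"
          using V \<eta> R by (simp add: ennreal_mult)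
        have "ennreal (\<kappa> * \<delta>\<^sup>2) \<le> 4 * ennreal M * ?S"
          using gain_average[OF f g rad eq R] \<kappa> unfolding \<delta> \<kappa>_def[symmetric]
          by (simp add: ennreal_mult ennreal_power \<delta>)
        also have "\<dots> = ennreal (2 * M) * (2 * ?S)"
        proof -
          have "4 * ennreal M = ennreal (2 * M) * 2"
            using M by (subst mult.commute) (simp add: ennreal_mult mult.assoc[symmetric])
          then show ?thesis by (simp add: mult.assoc)
        qed
        also have "\<dots> \<le> ennreal (2 * M) * ennreal (V * (\<eta> * \<delta>\<^sup>2 * (2 * R)))"
          by (rule mult_left_mono[OF S]) simp
        also have "\<dots> = ennreal (\<kappa> * \<delta>\<^sup>2 / 2)"
          using M V R \<eta> \<kappa> by (subst ennreal_mult[symmetric]) (auto simp: \<eta>_def)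
        finally have "\<kappa> * \<delta>\<^sup>2 \<le> \<kappa> * \<delta>\<^sup>2 / 2"
          using \<kappa> by (subst (asm) ennreal_le_iff) auto
        moreover have "\<kappa> * \<delta>\<^sup>2 > 0" using \<kappa> False by simp
        ultimately show False by simp
      qed
    qed
    then obtain w t where w: "w \<noteq> 0" "t \<ge> 0"
      and g1: "ennreal (\<eta> * \<delta>\<^sup>2) \<le> 2 * (\<integral>\<^sup>+x. ennreal (gain w t f g x) \<partial>lborel)" by blast
    have "(\<integral>\<^sup>+x. ennreal \<bar>polarize w t f x - g x\<bar> \<partial>lborel) + ennreal \<eta> * (ennreal \<delta>)\<^sup>2
      \<le> (\<integral>\<^sup>+x. ennreal \<bar>polarize w t f x - g x\<bar> \<partial>lborel) + 2 * (\<integral>\<^sup>+x. ennreal (gain w t f g x) \<partial>lborel)"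
      using g1 \<eta> \<delta>(2) by (intro add_left_mono) (simp add: ennreal_mult ennreal_power)
    also have "\<dots> \<le> ennreal \<delta>"
      using polarize_L1_decrease[OF _ _ rad w, of f] by (simp add: \<delta>)
    finally show "\<exists>w t. w \<noteq> 0 \<and> t \<ge> 0 \<and>
      (\<integral>\<^sup>+x. ennreal \<bar>polarize w t f x - g x\<bar> \<partial>lborel) + ennreal \<eta> * (\<integral>\<^sup>+x. ennreal \<bar>f x - g x\<bar> \<partial>lborel)\<^sup>2
      \<le> (\<integral>\<^sup>+x. ennreal \<bar>f x - g x\<bar> \<partial>lborel)"
      using w unfolding \<delta> by blast
  qed
qed

text \<open>The infimum of the \<open>L\<^sup>1\<close> distance to \<open>g\<close> over the equimeasurable densities with at least the same
  value of \<open>\<Phi>\<close> is zero, since otherwise a near-minimizer could be polarized below it.\<close>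

theorem symmetrization_increases:
  fixes f g :: "'a::euclidean_space \<Rightarrow> real" and \<Phi> :: "('a \<Rightarrow> real) \<Rightarrow> ennreal"
  assumes f: "density_on R M f" and g: "density_on R M g" and rad: "radially_decreasing g"
    and eq: "equimeasurable f g" and R: "R > 0" and M: "M > 0"
    and mono: "\<And>f w t. density_on R M f \<Longrightarrow> w \<noteq> 0 \<Longrightarrow> t \<ge> 0 \<Longrightarrow> \<Phi> f \<le> \<Phi> (polarize w t f)"
    and cont: "\<And>f f'. density_on R M f \<Longrightarrow> density_on R M f' \<Longrightarrow>
      \<Phi> f \<le> \<Phi> f' + C * (\<integral>\<^sup>+x. ennreal \<bar>f x - f' x\<bar> \<partial>lborel)"
    and C: "C < \<infinity>"
  shows "\<Phi> f \<le> \<Phi> g"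
proof -
  define D where "D f' = (\<integral>\<^sup>+x. ennreal \<bar>f' x - g x\<bar> \<partial>lborel)" for f'
  define K where "K = {f'. density_on R M f' \<and> equimeasurable f' g \<and> \<Phi> f \<le> \<Phi> f'}"
  define d where "d = (INF f'\<in>K. D f')"
  have fK: "f \<in> K" using f eq by (simp add: K_def)
  have "d \<le> D f" unfolding d_def by (rule INF_lower[OF fK])
  then have d_fin: "d < \<infinity>" using density_on_L1_finite[OF f g] by (simp add: D_def)
  obtain \<eta> :: real where \<eta>: "\<eta> > 0" and improve: "\<And>f'. density_on R M f' \<Longrightarrow> equimeasurable f' g \<Longrightarrow> \<exists>w t. w \<noteq> 0 \<and> t \<ge> 0 \<and>
      D (polarize w t f') + ennreal \<eta> * (D f')\<^sup>2 \<le> D f'"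
    unfolding D_def using polarization_improves[OF g rad R M] by blast
  have "d + ennreal \<eta> * d\<^sup>2 \<le> D f'" if "f' \<in> K" for f'
  proof -
    have f': "density_on R M f'" "equimeasurable f' g" "\<Phi> f \<le> \<Phi> f'" using that by (auto simp: K_def)
    obtain w t where w: "w \<noteq> 0" "t \<ge> 0" and le: "D (polarize w t f') + ennreal \<eta> * (D f')\<^sup>2 \<le> D f'"
      using improve[OF f'(1,2)] by blast
    have "polarize w t f' \<in> K"
      using f' w polarize_density_on[OF f'(1) w] polarize_equimeasurable[OF density_on_measurable[OF f'(1)] w(1), of t]
        mono[OF f'(1) w] by (auto simp: K_def equimeasurable_def)
    then have "d \<le> D (polarize w t f')" unfolding d_def by (rule INF_lower)
    moreover have "d \<le> D f'" unfolding d_def by (rule INF_lower[OF that])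
    ultimately have "d + ennreal \<eta> * d\<^sup>2 \<le> D (polarize w t f') + ennreal \<eta> * (D f')\<^sup>2"
      by (intro add_mono mult_left_mono power_mono) auto
    then show ?thesis using le by (rule order_trans)
  qed
  then have "d + ennreal \<eta> * d\<^sup>2 \<le> d" unfolding d_def using fK by (intro INF_greatest) auto
  \<comment> \<open>Cancelling \<open>d\<close> in \<open>ennreal\<close> is legitimate because
    \<open>d\<close> is finite.\<close>
  then have "ennreal \<eta> * d\<^sup>2 = 0"
    using d_fin ennreal_add_left_cancel_le[of d "ennreal \<eta> * d\<^sup>2" 0] by auto
  then have d0: "d = 0" using \<eta> by (simp add: power2_eq_square)
  show ?thesis
  proof (rule ennreal_le_epsilon)
    fix e :: real assume e: "e > 0"
    obtain c where c: "C = ennreal c" "c \<ge> 0" using C by (metis infinity_ennreal_def less_top_ennreal)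
    \<comment> \<open>The added one keeps the quotient meaningful for \<open>c = 0\<close>, and
      \<open>c * (e / (c + 1))\<close> stays below \<open>e\<close>.\<close>
    have "d < ennreal (e / (c + 1))" using e c by (simp add: d0)
    then obtain f' where f': "f' \<in> K" and D: "D f' < ennreal (e / (c + 1))"
      unfolding d_def INF_less_iff by blast
    have "\<Phi> f \<le> \<Phi> f'" "\<Phi> f' \<le> \<Phi> g + C * D f'"
      using f' cont[OF _ g, of f'] by (auto simp: K_def D_def)
    then have "\<Phi> f \<le> \<Phi> g + C * D f'" by (rule order_trans)
    also have "C * D f' \<le> ennreal c * ennreal (e / (c + 1))"
      using D unfolding c(1) by (intro mult_left_mono) auto
    also have "\<dots> = ennreal (c * (e / (c + 1)))"
      using c e by (subst ennreal_mult) auto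
    also have "\<dots> \<le> ennreal e"
      using c e by (intro ennreal_leI) (simp add: field_simps)
    finally show "\<Phi> f \<le> \<Phi> g + ennreal e" by (simp add: add_left_mono)
  qed
qed

section \<open>Rearrangement inequalities\<close>

lemma equimeasurable_nn_integral:
  fixes f g :: "'a::euclidean_space \<Rightarrow> real"
  assumes eq: "equimeasurable f g" and [measurable]: "f \<in> borel_measurable borel" "g \<in> borel_measurable borel"
  shows "(\<integral>\<^sup>+x. ennreal (f x) \<partial>lborel) = (\<integral>\<^sup>+x. ennreal (g x) \<partial>lborel)"
proof -
  have layer: "(\<integral>\<^sup>+x. ennreal (u x) \<partial>lborel) = (\<integral>\<^sup>+h. indicator {0..} h * emeasure lborel {x. h < u x} \<partial>lborel)"
    if [measurable]: "u \<in> borel_measurable borel" for u :: "'a \<Rightarrow> real"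
  proof -
    have "(\<integral>\<^sup>+x. ennreal (u x) \<partial>lborel) = (\<integral>\<^sup>+x. \<integral>\<^sup>+h. of_bool (0 \<le> h \<and> h < u x) \<partial>lborel \<partial>lborel)"
    proof (rule nn_integral_cong)
      fix x
      have "(\<integral>\<^sup>+h. of_bool (0 \<le> h \<and> h < u x) \<partial>lborel) = (\<integral>\<^sup>+h. indicator {0..<u x} h \<partial>lborel)"
        by (intro nn_integral_cong) (auto simp: indicator_def)
      then show "ennreal (u x) = (\<integral>\<^sup>+h. of_bool (0 \<le> h \<and> h < u x) \<partial>lborel)"
        by (cases "0 \<le> u x") (auto simp: ennreal_neg)
    qed
    also have "\<dots> = (\<integral>\<^sup>+h. \<integral>\<^sup>+x. of_bool (0 \<le> h \<and> h < u x) \<partial>lborel \<partial>lborel)"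
      unfolding of_bool_def by (intro lborel_pair.Fubini') measurable
    also have "\<dots> = (\<integral>\<^sup>+h. indicator {0..} h * emeasure lborel {x. h < u x} \<partial>lborel)"
    proof (rule nn_integral_cong)
      fix h :: real
      have "(\<integral>\<^sup>+x. of_bool (0 \<le> h \<and> h < u x) \<partial>lborel) = (\<integral>\<^sup>+x. indicator {0..} h * indicator {x. h < u x} x \<partial>lborel)"
        by (intro nn_integral_cong) (auto simp: indicator_def)
      then show "(\<integral>\<^sup>+x. of_bool (0 \<le> h \<and> h < u x) \<partial>lborel) = indicator {0..} h * emeasure lborel {x. h < u x}"
        by (simp add: nn_integral_cmult_indicator)
    qed
    finally show ?thesis .
  qed
  show ?thesis
    using eq by (simp add: layer equimeasurable_def)
qed

text \<open>On each pair of mirror points polarization puts the larger value of \<open>f\<close>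
  where \<open>k\<close> is larger. The upper bound \<open>c\<close> of \<open>k\<close> is the
  Lipschitz constant of the weighted integral with respect to the \<open>L1\<close>
  distance.\<close>

lemma nn_integral_radial_weight_le:
  fixes f g :: "'a::euclidean_space \<Rightarrow> real" and k :: "'a \<Rightarrow> real"
  assumes f: "density_on R M f" and g: "density_on R M g" and rad: "radially_decreasing g"
    and eq: "equimeasurable f g" and R: "R > 0" and M: "M > 0"
    and [measurable]: "k \<in> borel_measurable borel" and k: "radially_decreasing k" "\<And>x. 0 \<le> k x" "\<And>x. k x \<le> c"
  shows "(\<integral>\<^sup>+x. ennreal (f x * k x) \<partial>lborel) \<le> (\<integral>\<^sup>+x. ennreal (g x * k x) \<partial>lborel)"
proof (rule symmetrization_increases[OF f g rad eq R M, where C="ennreal c"])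
  fix f :: "'a \<Rightarrow> real" and w :: 'a and t :: real
  assume f: "density_on R M f" and w: "w \<noteq> 0" and t: "t \<ge> 0"
  note [measurable] = density_on_measurable[OF f] density_on_measurable[OF polarize_density_on[OF f w t]]
  let ?m = "mirror w t"
  note nonneg = density_on_nonneg[OF f] density_on_nonneg[OF polarize_density_on[OF f w t]]
  have pt: "f x * k x + f (?m x) * k (?m x) \<le> polarize w t f x * k x + polarize w t f (?m x) * k (?m x)" for x
  proof -
    have two: "a * p + b * q \<le> max a b * p + min a b * q" if "q \<le> p" for a b p q :: real
    proof (cases "b \<le> a")
      case False
      then have "0 \<le> (b - a) * (p - q)" using that by simp
      then show ?thesis using False by (simp add: algebra_simps)
    qed simp
    show ?thesis
    proof (cases "x \<bullet> w \<le> t")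
      case True
      have "k (?m x) \<le> k x"
        using k(1) norm_mirror_ge[OF w t True] by (simp add: radially_decreasing_def)
      from two[OF this, of "f x" "f (?m x)"] show ?thesis by (simp add: polarize_low[OF w True])
    next
      case False
      then have le: "t \<le> x \<bullet> w" by simp
      have "k x \<le> k (?m x)"
        using k(1) norm_mirror_le[OF w t le] by (simp add: radially_decreasing_def)
      from two[OF this, of "f (?m x)" "f x"] show ?thesis
        by (simp add: polarize_high[OF w le] max.commute min.commute algebra_simps)
    qed
  qed
  have "2 * (\<integral>\<^sup>+x. ennreal (f x * k x) \<partial>lborel) = (\<integral>\<^sup>+x. ennreal (f x * k x) + ennreal (f (?m x) * k (?m x)) \<partial>lborel)"
    by (rule nn_integral_mirror_average[OF _ w, symmetric]) measurable
  also have "\<dots> \<le> (\<integral>\<^sup>+x. ennreal (polarize w t f x * k x) + ennreal (polarize w t f (?m x) * k (?m x)) \<partial>lborel)"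
    using pt by (intro nn_integral_mono) (simp add: nonneg k flip: ennreal_plus)
  also have "\<dots> = 2 * (\<integral>\<^sup>+x. ennreal (polarize w t f x * k x) \<partial>lborel)"
    by (rule nn_integral_mirror_average[OF _ w]) measurable
  finally show "(\<integral>\<^sup>+x. ennreal (f x * k x) \<partial>lborel) \<le> (\<integral>\<^sup>+x. ennreal (polarize w t f x * k x) \<partial>lborel)"
    by (subst (asm) ennreal_mult_le_mult_iff) simp_all
next
  fix f f' :: "'a \<Rightarrow> real"
  assume f: "density_on R M f" and f': "density_on R M f'"
  note [measurable] = density_on_measurable[OF f] density_on_measurable[OF f']
  have c: "0 \<le> c" using k(2,3)[of 0] by linarith
  have "(\<integral>\<^sup>+x. ennreal (f x * k x) \<partial>lborel) \<le> (\<integral>\<^sup>+x. ennreal (f' x * k x) + ennreal c * ennreal \<bar>f x - f' x\<bar> \<partial>lborel)"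
  proof (rule nn_integral_mono)
    fix x
    have "f x * k x \<le> (f' x + \<bar>f x - f' x\<bar>) * k x" using k(2) by (intro mult_right_mono) auto
    also have "\<dots> = f' x * k x + k x * \<bar>f x - f' x\<bar>" by (simp add: algebra_simps)
    also have "\<dots> \<le> f' x * k x + c * \<bar>f x - f' x\<bar>" using k(3) by (intro add_left_mono mult_right_mono) auto
    finally show "ennreal (f x * k x) \<le> ennreal (f' x * k x) + ennreal c * ennreal \<bar>f x - f' x\<bar>"
      using c density_on_nonneg[OF f'] k(2) by (simp add: ennreal_leI flip: ennreal_mult ennreal_plus)
  qed
  also have "\<dots> = (\<integral>\<^sup>+x. ennreal (f' x * k x) \<partial>lborel) + ennreal c * (\<integral>\<^sup>+x. ennreal \<bar>f x - f' x\<bar> \<partial>lborel)"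
    by (simp add: nn_integral_add nn_integral_cmult)
  finally show "(\<integral>\<^sup>+x. ennreal (f x * k x) \<partial>lborel)
    \<le> (\<integral>\<^sup>+x. ennreal (f' x * k x) \<partial>lborel) + ennreal c * (\<integral>\<^sup>+x. ennreal \<bar>f x - f' x\<bar> \<partial>lborel)" .
qed simp

text \<open>Values in \<open>ennreal\<close> admit kernels that are infinite at the origin and make
  every exchange of integrals unconditional.\<close>

definition nn_energy :: "('a::euclidean_space \<Rightarrow> ennreal) \<Rightarrow> ('a \<Rightarrow> real) \<Rightarrow> ennreal" where
  "nn_energy K f = (\<integral>\<^sup>+y. \<integral>\<^sup>+x. ennreal (f x * f y) * K (x - y) \<partial>lborel \<partial>lborel)"

text \<open>The amount \<open>p' - p = q - q'\<close> of weight is moved from \<open>k2\<close> to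
  the larger \<open>k1\<close>. The argument only adds, so it also covers infinite kernel
  values.\<close>

lemma ennreal_two_weights_mono:
  fixes k1 k2 :: ennreal and p q p' q' :: real
  assumes "p + q = p' + q'" "p \<le> p'" "0 \<le> p" "0 \<le> q'" "k2 \<le> k1"
  shows "ennreal p * k1 + ennreal q * k2 \<le> ennreal p' * k1 + ennreal q' * k2"
proof -
  define d where "d = p' - p"
  have d: "d \<ge> 0" and p': "p' = p + d" and q: "q = q' + d" using assms by (auto simp: d_def)
  have "ennreal p * k1 + ennreal q * k2 = ennreal p * k1 + ennreal q' * k2 + ennreal d * k2"
    using d assms by (simp add: q distrib_right add.assoc)
  also have "\<dots> \<le> ennreal p * k1 + ennreal q' * k2 + ennreal d * k1"
    using assms by (intro add_left_mono mult_left_mono) auto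
  also have "\<dots> = ennreal p' * k1 + ennreal q' * k2"
    using d assms by (simp add: p' distrib_right distrib_left ac_simps)
  finally show ?thesis .
qed

text \<open>Averages over reflecting either variable, so that polarization can be compared on the
  four pairs formed from \<open>x\<close>, \<open>y\<close> and their mirror images.\<close>

lemma nn_energy_four_point:
  fixes K :: "'a::euclidean_space \<Rightarrow> ennreal"
  assumes K[measurable]: "K \<in> borel_measurable borel" and [measurable]: "f \<in> borel_measurable borel" and w: "w \<noteq> 0"
  shows "4 * nn_energy K f = (\<integral>\<^sup>+y. \<integral>\<^sup>+x.
      (ennreal (f x * f y) * K (x - y) + ennreal (f (mirror w t x) * f y) * K (mirror w t x - y))
    + (ennreal (f x * f (mirror w t y)) * K (x - mirror w t y)
        + ennreal (f (mirror w t x) * f (mirror w t y)) * K (mirror w t x - mirror w t y)) \<partial>lborel \<partial>lborel)"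
proof -
  let ?m = "mirror w t"
  let ?F = "\<lambda>x y. ennreal (f x * f y) * K (x - y)"
  have inner: "(\<integral>\<^sup>+x. ?F x y + ?F (?m x) y \<partial>lborel) = 2 * (\<integral>\<^sup>+x. ?F x y \<partial>lborel)" for y
    by (rule nn_integral_mirror_average[OF _ w]) measurable
  have "(\<integral>\<^sup>+y. (\<integral>\<^sup>+x. ?F x y \<partial>lborel) + (\<integral>\<^sup>+x. ?F x (?m y) \<partial>lborel) \<partial>lborel) = 2 * nn_energy K f"
    unfolding nn_energy_def by (rule nn_integral_mirror_average[OF _ w]) measurable
  then have "2 * (2 * nn_energy K f)
    = (\<integral>\<^sup>+y. 2 * (\<integral>\<^sup>+x. ?F x y \<partial>lborel) + 2 * (\<integral>\<^sup>+x. ?F x (?m y) \<partial>lborel) \<partial>lborel)"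
    by (subst distrib_left[symmetric], subst nn_integral_cmult) simp_all
  also have "\<dots> = (\<integral>\<^sup>+y. \<integral>\<^sup>+x. (?F x y + ?F (?m x) y) + (?F x (?m y) + ?F (?m x) (?m y)) \<partial>lborel \<partial>lborel)"
    by (subst nn_integral_add) (simp_all add: inner)
  finally show ?thesis by (simp add: mult.assoc[symmetric])
qed

text \<open>The four pairs have only two distances, and the total of the four products of values is
  preserved by polarization. It remains to see that polarizing shifts product weight to the shorter
  distance. Which distance is shorter depends on whether \<open>x\<close> and \<open>y\<close> lie
  on the same side of the hyperplane, and so does the arrangement of maxima and minima.\<close>

lemma nn_energy_polarize:
  fixes K :: "'a::euclidean_space \<Rightarrow> ennreal"
  assumes K[measurable]: "K \<in> borel_measurable borel" and rad: "radially_decreasing K"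
    and f[measurable]: "f \<in> borel_measurable borel" and nonneg: "\<And>x. 0 \<le> f x" and w: "w \<noteq> 0"
  shows "nn_energy K f \<le> nn_energy K (polarize w t f)"
proof -
  let ?p = "polarize w t f"
  let ?m = "mirror w t"
  let ?S = "\<lambda>f x y. (ennreal (f x * f y) * K (x - y) + ennreal (f (?m x) * f y) * K (?m x - y))
    + (ennreal (f x * f (?m y)) * K (x - ?m y) + ennreal (f (?m x) * f (?m y)) * K (?m x - ?m y))"
  have K_norm: "K a = K b" if "norm a = norm b" for a b
    using rad that by (intro antisym) (auto simp: radially_decreasing_def)
  have S: "?S f x y = ennreal (f x * f y + f (?m x) * f (?m y)) * K (x - y)
      + ennreal (f (?m x) * f y + f x * f (?m y)) * K (?m x - y)" if nn: "\<And>x. 0 \<le> f x" for f x y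
  proof -
    have "K (?m x - ?m y) = K (x - y)" by (rule K_norm) (simp add: norm_mirror_diff_mirror[OF w])
    moreover have "K (x - ?m y) = K (?m x - y)"
      using norm_mirror_diff_mirror[OF w, of t x "?m y"] w by (intro K_norm) simp
    ultimately show ?thesis using nn by (simp add: distrib_right distrib_left ac_simps)
  qed
  have sq: "(norm (?m x - y))\<^sup>2 = (norm (x - y))\<^sup>2 + 4 * (x \<bullet> w - t) * (y \<bullet> w - t) / (w \<bullet> w)" for x y
    by (rule norm_mirror_diff_left[OF w])
  \<comment> \<open>The rearrangement inequality for two pairs of numbers, together with the
    conservation of the sum of all four products.\<close>
  have rearr: "a * b + a' * b' \<le> max a a' * max b b' + min a a' * min b b'"
    "max a a' * min b b' + min a a' * max b b' \<le> a * b + a' * b'"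
    "a * b + a' * b' + (a' * b + a * b') = max a a' * max b b' + min a a' * min b b' + (min a a' * max b b' + max a a' * min b b')"
    for a a' b b' :: real
  proof -
    have 1: "0 \<le> (a - a') * (b - b')" if "(a' \<le> a \<and> b' \<le> b) \<or> (a \<le> a' \<and> b \<le> b')"
      using that by (auto intro: mult_nonneg_nonneg mult_nonpos_nonpos)
    have 2: "(a - a') * (b - b') \<le> 0" if "(a' \<le> a \<and> b \<le> b') \<or> (a \<le> a' \<and> b' \<le> b)"
      using that by (auto intro: mult_nonneg_nonpos mult_nonpos_nonneg)
    show "a * b + a' * b' \<le> max a a' * max b b' + min a a' * min b b'"
      "max a a' * min b b' + min a a' * max b b' \<le> a * b + a' * b'"
      using 1 2 by (cases "a \<le> a'"; cases "b \<le> b'"; simp add: algebra_simps)+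
    show "a * b + a' * b' + (a' * b + a * b') = max a a' * max b b' + min a a' * min b b' + (min a a' * max b b' + max a a' * min b b')"
      by (cases "a \<le> a'"; cases "b \<le> b'"; simp add: algebra_simps)
  qed
  have pnn: "0 \<le> ?p x" for x using nonneg by (auto simp: polarize_def max_def)
  have same: "?S f x y \<le> ?S ?p x y" if side: "x \<bullet> w \<le> t \<and> y \<bullet> w \<le> t \<or> t \<le> x \<bullet> w \<and> t \<le> y \<bullet> w" for x y
  proof -
    have "0 \<le> 4 * (x \<bullet> w - t) * (y \<bullet> w - t) / (w \<bullet> w)"
      using side by (intro divide_nonneg_nonneg) (auto simp: mult.assoc intro: mult_nonneg_nonneg mult_nonpos_nonpos)
    then have "(norm (x - y))\<^sup>2 \<le> (norm (?m x - y))\<^sup>2" unfolding sq by linarith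
    then have "norm (x - y) \<le> norm (?m x - y)" by (rule power2_le_imp_le) simp
    then have k: "K (?m x - y) \<le> K (x - y)" using rad by (simp add: radially_decreasing_def)
    have "?p x * ?p y + ?p (?m x) * ?p (?m y)
       = max (f x) (f (?m x)) * max (f y) (f (?m y)) + min (f x) (f (?m x)) * min (f y) (f (?m y))"
      "?p (?m x) * ?p y + ?p x * ?p (?m y)
       = min (f x) (f (?m x)) * max (f y) (f (?m y)) + max (f x) (f (?m x)) * min (f y) (f (?m y))"
      using side by (elim disjE conjE; simp add: polarize_low[OF w] polarize_high[OF w] add.commute)+
    moreover have nn: "0 \<le> min (f x) (f (?m x)) * max (f y) (f (?m y)) + max (f x) (f (?m x)) * min (f y) (f (?m y))"
      using nonneg by (simp add: max_def min_def)
    ultimately have "ennreal (f x * f y + f (?m x) * f (?m y)) * K (x - y) + ennreal (f (?m x) * f y + f x * f (?m y)) * K (?m x - y)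
      \<le> ennreal (?p x * ?p y + ?p (?m x) * ?p (?m y)) * K (x - y)
        + ennreal (?p (?m x) * ?p y + ?p x * ?p (?m y)) * K (?m x - y)"
      using rearr(1,3)[of "f x" "f y" "f (?m x)" "f (?m y)"] nonneg pnn k
        nn
      by (intro ennreal_two_weights_mono) (auto simp: add_nonneg_nonneg)
    moreover have "?S f x y = ennreal (f x * f y + f (?m x) * f (?m y)) * K (x - y) + ennreal (f (?m x) * f y + f x * f (?m y)) * K (?m x - y)"
      by (rule S) (rule nonneg)
    moreover have "?S ?p x y
      = ennreal (?p x * ?p y + ?p (?m x) * ?p (?m y)) * K (x - y)
        + ennreal (?p (?m x) * ?p y + ?p x * ?p (?m y)) * K (?m x - y)"
      by (rule S) (rule pnn)
    ultimately show ?thesis by (simp only:)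
  qed
  \<comment> \<open>Separated points: now \<open>mirror w t x\<close> is the one closer to
    \<open>y\<close>, and the product of the two maxima sits exactly on that pair of
    distances.\<close>
  have opposite: "?S f x y \<le> ?S ?p x y" if side: "x \<bullet> w \<le> t \<and> t \<le> y \<bullet> w \<or> t \<le> x \<bullet> w \<and> y \<bullet> w \<le> t" for x y
  proof -
    have "4 * (x \<bullet> w - t) * (y \<bullet> w - t) / (w \<bullet> w) \<le> 0"
      using side by (intro divide_nonpos_nonneg) (auto simp: mult.assoc intro: mult_nonneg_nonpos mult_nonpos_nonneg)
    then have "(norm (?m x - y))\<^sup>2 \<le> (norm (x - y))\<^sup>2" unfolding sq by linarith
    then have "norm (?m x - y) \<le> norm (x - y)" by (rule power2_le_imp_le) simp
    then have k: "K (x - y) \<le> K (?m x - y)" using rad by (simp add: radially_decreasing_def)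
    have e: "?p x * ?p y + ?p (?m x) * ?p (?m y)
       = max (f x) (f (?m x)) * min (f y) (f (?m y)) + min (f x) (f (?m x)) * max (f y) (f (?m y))"
      "?p (?m x) * ?p y + ?p x * ?p (?m y)
       = max (f x) (f (?m x)) * max (f y) (f (?m y)) + min (f x) (f (?m x)) * min (f y) (f (?m y))"
      using side by (elim disjE conjE; simp add: polarize_low[OF w] polarize_high[OF w] add.commute)+
    have nn: "0 \<le> max (f x) (f (?m x)) * min (f y) (f (?m y)) + min (f x) (f (?m x)) * max (f y) (f (?m y))"
      using nonneg by (simp add: max_def min_def)
    have "ennreal (f (?m x) * f y + f x * f (?m y)) * K (?m x - y) + ennreal (f x * f y + f (?m x) * f (?m y)) * K (x - y)
      \<le> ennreal (?p (?m x) * ?p y + ?p x * ?p (?m y)) * K (?m x - y)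
        + ennreal (?p x * ?p y + ?p (?m x) * ?p (?m y)) * K (x - y)"
      using rearr(1)[of "f (?m x)" "f y" "f x" "f (?m y)"] rearr(3)[of "f x" "f y" "f (?m x)" "f (?m y)"] nonneg pnn k nn
      unfolding e by (intro ennreal_two_weights_mono) (auto simp: max.commute min.commute add_nonneg_nonneg)
    moreover have "?S f x y = ennreal (f x * f y + f (?m x) * f (?m y)) * K (x - y) + ennreal (f (?m x) * f y + f x * f (?m y)) * K (?m x - y)"
      by (rule S) (rule nonneg)
    moreover have "?S ?p x y
      = ennreal (?p x * ?p y + ?p (?m x) * ?p (?m y)) * K (x - y)
        + ennreal (?p (?m x) * ?p y + ?p x * ?p (?m y)) * K (?m x - y)"
      by (rule S) (rule pnn)
    ultimately show ?thesis by (simp only: add.commute)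
  qed
  have "4 * nn_energy K f = (\<integral>\<^sup>+y. \<integral>\<^sup>+x. ?S f x y \<partial>lborel \<partial>lborel)"
    by (rule nn_energy_four_point[OF K f w])
  also have "\<dots> \<le> (\<integral>\<^sup>+y. \<integral>\<^sup>+x. ?S ?p x y \<partial>lborel \<partial>lborel)"
  proof (rule nn_integral_mono, rule nn_integral_mono)
    fix x y
    have "(x \<bullet> w \<le> t \<and> y \<bullet> w \<le> t \<or> t \<le> x \<bullet> w \<and> t \<le> y \<bullet> w)
      \<or> (x \<bullet> w \<le> t \<and> t \<le> y \<bullet> w \<or> t \<le> x \<bullet> w \<and> y \<bullet> w \<le> t)" by linarith
    then show "?S f x y \<le> ?S ?p x y"
      by (rule disjE) (erule same, erule opposite)
  qed
  also have "\<dots> = 4 * nn_energy K ?p"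
    by (rule nn_energy_four_point[OF K polarize_measurable[OF f] w, symmetric])
  finally show ?thesis
    by (subst (asm) ennreal_mult_le_mult_iff) simp_all
qed

text \<open>The product \<open>f x * f y\<close> differs from \<open>f' x * f' y\<close> by two
  terms, each containing one difference. The other factor is bounded by \<open>M\<close>, and the
  kernel is integrated over the ball of radius \<open>2 * R\<close>, which contains all differences
  of points of the supports.\<close>

lemma nn_energy_continuous:
  fixes K :: "'a::euclidean_space \<Rightarrow> ennreal"
  assumes [measurable]: "K \<in> borel_measurable borel"
    and f: "density_on R M f" and f': "density_on R M f'"
  shows "nn_energy K f \<le> nn_energy K f' +
    2 * (ennreal M * (\<integral>\<^sup>+x. indicator (cball 0 (2 * R)) x * K x \<partial>lborel)) * (\<integral>\<^sup>+x. ennreal \<bar>f x - f' x\<bar> \<partial>lborel)"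
proof -
  note [measurable] = density_on_measurable[OF f] density_on_measurable[OF f']
  let ?d = "\<lambda>x. \<bar>f x - f' x\<bar>" and ?c = "ennreal M * (\<integral>\<^sup>+x. indicator (cball 0 (2 * R)) x * K x \<partial>lborel)"
  have near: "ennreal (u x * v y) * k \<le> ennreal (u x) * (ennreal M * (indicator (cball 0 (2 * R)) (x - y) * k))"
    "ennreal (u x * v y) * k \<le> ennreal (v y) * (ennreal M * (indicator (cball 0 (2 * R)) (x - y) * k))"
    if "\<And>x. 0 \<le> u x \<and> u x \<le> M" "\<And>x. R < norm x \<Longrightarrow> u x = 0" "\<And>x. 0 \<le> v x \<and> v x \<le> M" "\<And>x. R < norm x \<Longrightarrow> v x = 0"
    for u v :: "'a \<Rightarrow> real" and x y k
  proof -
    have M: "M \<ge> 0" using that(1)[of 0] by linarith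
    have "norm (x - y) \<le> 2 * R \<or> u x = 0 \<or> v y = 0"
      using that(2)[of x] that(4)[of y] norm_triangle_ineq4[of x y] by linarith
    moreover have "u x * v y \<le> u x * M" "u x * v y \<le> v y * M"
      using that(1)[of x] that(3)[of y] by (auto simp: mult.commute[of "v y" M] intro: mult_left_mono mult_right_mono)
    then have "ennreal (u x * v y) * k \<le> ennreal (u x * M) * k" "ennreal (u x * v y) * k \<le> ennreal (v y * M) * k"
      by (auto intro: mult_right_mono ennreal_leI)
    ultimately show "ennreal (u x * v y) * k \<le> ennreal (u x) * (ennreal M * (indicator (cball 0 (2 * R)) (x - y) * k))"
      "ennreal (u x * v y) * k \<le> ennreal (v y) * (ennreal M * (indicator (cball 0 (2 * R)) (x - y) * k))"
      using that(1)[of x] that(3)[of y] M by (auto simp: indicator_def ennreal_mult mult.assoc)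
  qed
  \<comment> \<open>The two bounds keep different factors outside the kernel integral. The
    difference stands in the first variable of one error term and in the second variable of the
    other, so each bound is used once.\<close>
  have int1: "(\<integral>\<^sup>+y. \<integral>\<^sup>+x. ennreal (u x * v y) * K (x - y) \<partial>lborel \<partial>lborel) \<le> (\<integral>\<^sup>+y. ennreal (v y) * ?c \<partial>lborel)"
    and int2: "(\<integral>\<^sup>+y. \<integral>\<^sup>+x. ennreal (u x * v y) * K (x - y) \<partial>lborel \<partial>lborel) \<le> (\<integral>\<^sup>+x. ennreal (u x) * ?c \<partial>lborel)"
    if uv: "\<And>x. 0 \<le> u x \<and> u x \<le> M" "\<And>x. R < norm x \<Longrightarrow> u x = 0" "\<And>x. 0 \<le> v x \<and> v x \<le> M" "\<And>x. R < norm x \<Longrightarrow> v x = 0"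
      and [measurable]: "u \<in> borel_measurable borel" "v \<in> borel_measurable borel" for u v :: "'a \<Rightarrow> real"
  proof -
    have t1: "(\<integral>\<^sup>+x. indicator (cball 0 (2 * R)) (x - y) * K (x - y) \<partial>lborel) = (\<integral>\<^sup>+x. indicator (cball 0 (2 * R)) x * K x \<partial>lborel)" for y
      using nn_integral_lborel_translate[of "\<lambda>x. indicator (cball 0 (2 * R)) x * K x" "- y"] by simp
    have t2: "(\<integral>\<^sup>+y. indicator (cball 0 (2 * R)) (x - y) * K (x - y) \<partial>lborel) = (\<integral>\<^sup>+x. indicator (cball 0 (2 * R)) x * K x \<partial>lborel)" for x
      by (rule nn_integral_lborel_point_reflection[of "\<lambda>x. indicator (cball 0 (2 * R)) x * K x"]) simp
    have [measurable]: "(\<lambda>p. indicator (cball 0 (2 * R)) (x p) :: ennreal) \<in> borel_measurable N"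
      if [measurable]: "x \<in> borel_measurable N" for x :: "'b \<Rightarrow> 'a" and N
      by (rule measurable_compose[OF that]) simp
    have "(\<integral>\<^sup>+y. \<integral>\<^sup>+x. ennreal (u x * v y) * K (x - y) \<partial>lborel \<partial>lborel)
      \<le> (\<integral>\<^sup>+y. \<integral>\<^sup>+x. ennreal (v y) * (ennreal M * (indicator (cball 0 (2 * R)) (x - y) * K (x - y))) \<partial>lborel \<partial>lborel)"
      using near(2)[OF uv] by (intro nn_integral_mono)
    also have "\<dots> = (\<integral>\<^sup>+y. ennreal (v y) * ?c \<partial>lborel)"
      by (simp add: nn_integral_cmult t1)
    finally show "(\<integral>\<^sup>+y. \<integral>\<^sup>+x. ennreal (u x * v y) * K (x - y) \<partial>lborel \<partial>lborel) \<le> (\<integral>\<^sup>+y. ennreal (v y) * ?c \<partial>lborel)" .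
    have "(\<integral>\<^sup>+y. \<integral>\<^sup>+x. ennreal (u x * v y) * K (x - y) \<partial>lborel \<partial>lborel) = (\<integral>\<^sup>+x. \<integral>\<^sup>+y. ennreal (u x * v y) * K (x - y) \<partial>lborel \<partial>lborel)"
      by (rule lborel_pair.Fubini') measurable
    also have "\<dots> \<le> (\<integral>\<^sup>+x. \<integral>\<^sup>+y. ennreal (u x) * (ennreal M * (indicator (cball 0 (2 * R)) (x - y) * K (x - y))) \<partial>lborel \<partial>lborel)"
      using near(1)[OF uv] by (intro nn_integral_mono)
    also have "\<dots> = (\<integral>\<^sup>+x. ennreal (u x) * ?c \<partial>lborel)"
      by (simp add: nn_integral_cmult t2)
    finally show "(\<integral>\<^sup>+y. \<integral>\<^sup>+x. ennreal (u x * v y) * K (x - y) \<partial>lborel \<partial>lborel) \<le> (\<integral>\<^sup>+x. ennreal (u x) * ?c \<partial>lborel)" .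
  qed
  have F: "0 \<le> f x \<and> f x \<le> M" "R < norm x \<Longrightarrow> f x = 0" "0 \<le> f' x \<and> f' x \<le> M" "R < norm x \<Longrightarrow> f' x = 0"
    "0 \<le> ?d x \<and> ?d x \<le> M" "R < norm x \<Longrightarrow> ?d x = 0" for x
    using density_onD(2-4)[OF f, of x] density_onD(2-4)[OF f', of x] by auto
  have "nn_energy K f \<le> (\<integral>\<^sup>+y. \<integral>\<^sup>+x. ennreal (f' x * f' y) * K (x - y)
      + (ennreal (?d x * f y) * K (x - y) + ennreal (f' x * ?d y) * K (x - y)) \<partial>lborel \<partial>lborel)"
    unfolding nn_energy_def
  proof (intro nn_integral_mono)
    fix x y
    have "f x * f y = f' x * f' y + (f x - f' x) * f y + f' x * (f y - f' y)" by (simp add: algebra_simps)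
    also have "\<dots> \<le> f' x * f' y + (?d x * f y + f' x * ?d y)"
      using F(1,3) by (simp add: add_mono mult_left_mono mult_right_mono)
    finally have "ennreal (f x * f y) \<le> ennreal (f' x * f' y) + (ennreal (?d x * f y) + ennreal (f' x * ?d y))"
      using F(1,3) by (simp add: ennreal_leI flip: ennreal_plus)
    then have "ennreal (f x * f y) * K (x - y) \<le> (ennreal (f' x * f' y) + (ennreal (?d x * f y) + ennreal (f' x * ?d y))) * K (x - y)"
      by (rule mult_right_mono) simp
    then show "ennreal (f x * f y) * K (x - y) \<le> ennreal (f' x * f' y) * K (x - y)
      + (ennreal (?d x * f y) * K (x - y) + ennreal (f' x * ?d y) * K (x - y))"
      by (simp add: distrib_right)
  qed
  also have "\<dots> = nn_energy K f' + ((\<integral>\<^sup>+y. \<integral>\<^sup>+x. ennreal (?d x * f y) * K (x - y) \<partial>lborel \<partial>lborel)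
      + (\<integral>\<^sup>+y. \<integral>\<^sup>+x. ennreal (f' x * ?d y) * K (x - y) \<partial>lborel \<partial>lborel))"
    unfolding nn_energy_def by (simp add: nn_integral_add)
  also have "\<dots> \<le> nn_energy K f' + ((\<integral>\<^sup>+x. ennreal (?d x) * ?c \<partial>lborel) + (\<integral>\<^sup>+y. ennreal (?d y) * ?c \<partial>lborel))"
    using F by (intro add_left_mono add_mono int1 int2) auto
  also have "\<dots> = nn_energy K f' + 2 * ?c * (\<integral>\<^sup>+x. ennreal (?d x) \<partial>lborel)"
  proof -
    have "X * c + X * c = 2 * c * X" for X c :: ennreal by (metis mult.assoc mult.commute mult_2)
    then show ?thesis by (simp add: nn_integral_multc)
  qed
  finally show ?thesis .
qed

text \<open>Polarization raises the energy, and finiteness of the kernel integral makes the energy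
  Lipschitz in the \<open>L1\<close> distance, so the infimum argument applies.\<close>

theorem riesz_rearrangement:
  fixes K :: "'a::euclidean_space \<Rightarrow> ennreal"
  assumes f: "density_on R M f" and g: "density_on R M g" and rad: "radially_decreasing g"
    and eq: "equimeasurable f g" and R: "R > 0" and M: "M > 0"
    and K: "K \<in> borel_measurable borel" "radially_decreasing K"
    and fin: "(\<integral>\<^sup>+x. indicator (cball 0 (2 * R)) x * K x \<partial>lborel) < \<infinity>"
  shows "nn_energy K f \<le> nn_energy K g"
proof (rule symmetrization_increases[OF f g rad eq R M])
  show "nn_energy K f \<le> nn_energy K (polarize w t f)" if "density_on R M f" "w \<noteq> 0" for f w t
    using that by (intro nn_energy_polarize[OF K]) (auto dest: density_onD)
  show "nn_energy K f \<le> nn_energy K f' +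
    2 * (ennreal M * (\<integral>\<^sup>+x. indicator (cball 0 (2 * R)) x * K x \<partial>lborel)) * (\<integral>\<^sup>+x. ennreal \<bar>f x - f' x\<bar> \<partial>lborel)"
    if "density_on R M f" "density_on R M f'" for f f'
    by (rule nn_energy_continuous[OF K(1) that])
  show "2 * (ennreal M * (\<integral>\<^sup>+x. indicator (cball 0 (2 * R)) x * K x \<partial>lborel)) < \<infinity>"
    using fin by (simp add: ennreal_mult_less_top)
qed

section \<open>The rearranged function\<close>

text \<open>Replaces the definite description of the radius by a volume comparison, which is the
  form used from here on.\<close>

lemma mem_set_rearrangement:
  fixes x :: "'a::euclidean_space"
  shows "x \<in> set_rearrangement D \<longleftrightarrow> unit_ball_vol (real DIM('a)) * norm x ^ DIM('a) < measure lebesgue D"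
    and set_rearrangement_is_ball: "\<exists>r\<ge>0. set_rearrangement D = ball (0::'a) r"
proof -
  define v where "v = unit_ball_vol (real DIM('a))"
  have v: "v > 0" by (simp add: v_def)
  have vol: "measure lebesgue (ball (0::'a) r) = v * r ^ DIM('a)" if "0 \<le> r" for r
    using that by (simp add: content_ball v_def)
  define r where "r = root DIM('a) (measure lebesgue D / v)"
  have r: "0 \<le> r" "v * r ^ DIM('a) = measure lebesgue D"
    using v by (simp_all add: r_def real_root_pow_pos2)
  have "set_rearrangement D = ball (0::'a) r"
    unfolding set_rearrangement_def
  proof (intro arg_cong[where f="ball 0"] the_equality conjI)
    show "measure lebesgue (ball (0::'a) r) = measure lebesgue D" using r vol by simp
    fix s assume s: "0 \<le> s \<and> measure lebesgue (ball (0::'a) s) = measure lebesgue D"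
    then have "s ^ DIM('a) = r ^ DIM('a)" using r vol[of s] v by (metis mult_left_cancel less_irrefl)
    then show "s = r" using s r by (simp add: power_eq_iff_eq_base)
  qed (rule r)
  then show "\<exists>r\<ge>0. set_rearrangement D = ball (0::'a) r" using r(1) by blast
  show "x \<in> set_rearrangement D \<longleftrightarrow> unit_ball_vol (real DIM('a)) * norm x ^ DIM('a) < measure lebesgue D"
    using v r(1) unfolding \<open>set_rearrangement D = ball 0 r\<close> r(2)[symmetric] v_def[symmetric]
    by (simp add: power_mono_iff flip: not_le)
qed

text \<open>For fixed \<open>x\<close>, the set \<open>S\<close> of heights whose rearranged
  superlevel set contains \<open>x\<close> is closed downwards and has no largest element. Hence it
  is an interval \<open>{0..<s}\<close>, and the integral defining the rearrangement is its length
  \<open>s\<close>.\<close>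

lemma rearrangement_superlevel:
  fixes f :: "'a::euclidean_space \<Rightarrow> real"
  assumes f: "density_on R M f" and h: "h \<ge> 0"
  shows "h < rearrangement f x \<longleftrightarrow> x \<in> set_rearrangement {y. h < f y}"
proof -
  note [measurable] = density_on_measurable[OF f]
  define m where "m h = measure lebesgue {y. h < f y}" for h
  define a where "a = unit_ball_vol (real DIM('a)) * norm x ^ DIM('a)"
  have a: "a \<ge> 0" by (simp add: a_def)
  have m_lborel: "m h = measure lborel {y. h < f y}" for h
    by (simp add: m_def)
  have fin: "emeasure lborel {y. h < f y} \<noteq> \<infinity>" if "h \<ge> 0" for h
    using density_on_emeasure_finite[OF f that] by simp
  have m_mono: "m h' \<le> m h" if "0 \<le> h" "h \<le> h'" for h h'
    unfolding m_lborel using that fin[of h] by (intro measure_mono_fmeasurable) (auto simp: fmeasurable_def less_top)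
  have m_M: "m h = 0" if "M \<le> h" for h
  proof -
    have "{y. h < f y} = {}" using density_on_le[OF f] that by (auto simp: not_less intro: order_trans)
    then show ?thesis by (simp only: m_def measure_empty)
  qed
  define S where "S = {h. 0 \<le> h \<and> a < m h}"
  have M: "M \<ge> 0" using density_on_nonneg[OF f, of 0] density_on_le[OF f, of 0] by linarith
  have S_bdd: "S \<subseteq> {0..<M}" using m_M a unfolding S_def by (auto simp: not_le[symmetric])
  \<comment> \<open>Continuity of the measure from below along the levels
    \<open>h + 1 / Suc i\<close>: the strict inequality at \<open>h\<close> persists slightly above
    \<open>h\<close>.\<close>
  have S_open: "\<exists>h'>h. h' \<in> S" if hS: "h \<in> S" for h
  proof -
    have h0: "0 \<le> h" and am: "a < m h" using hS by (auto simp: S_def)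
    have "(\<lambda>i. measure lborel {y. h + 1 / Suc i < f y}) \<longlonglongrightarrow> measure lborel (\<Union>i. {y. h + 1 / Suc i < f y})"
    proof (rule Lim_measure_incseq)
      show "incseq (\<lambda>i. {y. h + 1 / Suc i < f y})"
      proof (intro incseq_SucI subsetI CollectI)
        fix i y assume "y \<in> {y. h + 1 / Suc i < f y}"
        moreover have "1 / real (Suc (Suc i)) \<le> 1 / Suc i" by (intro divide_left_mono) auto
        ultimately show "h + 1 / Suc (Suc i) < f y" by auto
      qed
      have "(\<Union>i. {y. h + 1 / Suc i < f y}) \<subseteq> {y. h < f y}"
        by (auto intro: less_trans[rotated] simp: less_le_trans)
      then have "emeasure lborel (\<Union>i. {y. h + 1 / Suc i < f y}) \<le> emeasure lborel {y. h < f y}"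
        by (intro emeasure_mono) auto
      then show "emeasure lborel (\<Union>i. {y. h + 1 / Suc i < f y}) \<noteq> \<infinity>" using fin[OF h0] by (auto simp: top_unique)
    qed auto
    moreover have "(\<Union>i. {y. h + 1 / Suc i < f y}) = {y. h < f y}"
    proof (intro equalityI subsetI)
      fix y assume "y \<in> {y. h < f y}"
      then obtain i where "1 / real (Suc i) < f y - h" using reals_Archimedean[of "f y - h"] by (auto simp: inverse_eq_divide)
      then show "y \<in> (\<Union>i. {y. h + 1 / Suc i < f y})" by (auto intro!: exI[of _ i])
    next
      fix y assume "y \<in> (\<Union>i. {y. h + 1 / Suc i < f y})"
      then obtain i where "h + 1 / real (Suc i) < f y" by auto
      moreover have "0 < 1 / real (Suc i)" by simp
      ultimately show "y \<in> {y. h < f y}" unfolding mem_Collect_eq by linarith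
    qed
    ultimately have "(\<lambda>i. m (h + 1 / Suc i)) \<longlonglongrightarrow> m h" by (simp add: m_lborel)
    then have "eventually (\<lambda>i. a < m (h + 1 / Suc i)) sequentially" using am by (rule order_tendstoD)
    then obtain i where "a < m (h + 1 / Suc i)" by (auto dest: eventually_happens)
    then show ?thesis using h0 by (intro exI[of _ "h + 1 / Suc i"]) (auto simp: S_def)
  qed
  have S_down: "h' \<in> S" if "h \<in> S" "0 \<le> h'" "h' \<le> h" for h h'
    using that m_mono[of h' h] by (auto simp: S_def)
  \<comment> \<open>The supremum of the empty set of reals is unspecified, hence the separate value
    0.\<close>
  define s where "s = (if S = {} then 0 else Sup S)"
  have S_eq: "S = {0..<s}"
  proof (cases "S = {}")
    case False
    have bdd: "bdd_above S" using S_bdd by (meson bdd_above.I2 bdd_above_Ico bdd_above_mono)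
    show ?thesis
    proof (intro equalityI subsetI)
      fix h assume hS: "h \<in> S"
      obtain h' where "h' > h" "h' \<in> S" using S_open[OF hS] by blast
      then have "h < Sup S" using cSup_upper[OF _ bdd, of h'] by linarith
      then show "h \<in> {0..<s}" using hS False by (simp add: s_def S_def)
    next
      fix h assume "h \<in> {0..<s}"
      then have "0 \<le> h" "h < Sup S" using False by (auto simp: s_def)
      then show "h \<in> S" using less_cSup_iff[OF False bdd] S_down by (meson less_imp_le)
    qed
  qed (simp add: s_def)
  have s: "0 \<le> s"
  proof (cases "S = {}")
    case False
    then show ?thesis using S_eq by (meson atLeastLessThan_empty_iff less_imp_le not_le)
  qed (simp add: s_def)
  have "rearrangement f x = (LINT h|lborel. indicator S h)"
    unfolding rearrangement_def set_lebesgue_integral_def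
    by (intro Bochner_Integration.integral_cong)
       (auto simp: indicator_def S_def mem_set_rearrangement a_def m_def)
  also have "\<dots> = s" using s by (simp add: S_eq)
  finally have "h < rearrangement f x \<longleftrightarrow> h \<in> S" using h by (simp add: S_eq)
  then show ?thesis using h by (simp add: S_def mem_set_rearrangement a_def m_def)
qed

lemma rearrangement_nonneg: "0 \<le> rearrangement f x"
  unfolding rearrangement_def set_lebesgue_integral_def by (rule integral_nonneg_AE) simp

text \<open>Superlevel sets at heights \<open>h \<ge> 0\<close> are open balls centred at the origin
  with the measure of the original ones. The ball property is recorded separately because the
  potential of the rearrangement is later estimated slice by slice.\<close>

lemma rearrangement_properties:
  fixes f :: "'a::euclidean_space \<Rightarrow> real"
  assumes f: "density_on R M f" and R: "R \<ge> 0"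
  shows rearrangement_density_on: "density_on R M (rearrangement f)"
    and rearrangement_radially_decreasing: "radially_decreasing (rearrangement f)"
    and rearrangement_equimeasurable: "equimeasurable f (rearrangement f)"
    and rearrangement_superlevel_ball: "h \<ge> 0 \<Longrightarrow> \<exists>r\<ge>0. {x. h < rearrangement f x} = ball 0 r"
proof -
  note [measurable] = density_on_measurable[OF f]
  let ?g = "rearrangement f"
  have sup: "{x. h < ?g x} = set_rearrangement {y. h < f y}" if "h \<ge> 0" for h
    using rearrangement_superlevel[OF f that] by auto
  show ball: "\<exists>r\<ge>0. {x. h < ?g x} = ball 0 r" if "h \<ge> 0" for h
    using set_rearrangement_is_ball sup[OF that] by metis
  have neg: "{x. h < ?g x} = UNIV" if "h < 0" for h
    using that rearrangement_nonneg[of f] by (auto intro: less_le_trans)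
  have g_meas[measurable]: "?g \<in> borel_measurable borel"
  proof (rule borel_measurableI_greater)
    fix h
    show "{x \<in> space borel. h < ?g x} \<in> sets borel"
      using ball[of h] neg[of h] by (cases "h \<ge> 0") auto
  qed
  show "radially_decreasing ?g"
    unfolding radially_decreasing_def
  proof (intro allI impI, rule ccontr)
    fix x y :: 'a assume xy: "norm x \<le> norm y" and "\<not> ?g y \<le> ?g x"
    then have "?g x < ?g y" by simp
    \<comment> \<open>The height \<open>?g x\<close> itself is the separating level: its superlevel
      ball would contain \<open>y\<close>, hence also \<open>x\<close>.\<close>
    then have "y \<in> set_rearrangement {z. ?g x < f z}"
      using rearrangement_superlevel[OF f rearrangement_nonneg] by blast
    then have "x \<in> set_rearrangement {z. ?g x < f z}"
      unfolding mem_set_rearrangement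
      by (rule le_less_trans[rotated]) (intro mult_left_mono power_mono xy, auto)
    then show False using rearrangement_superlevel[OF f rearrangement_nonneg[of f x]] by blast
  qed
  show "density_on R M ?g"
    unfolding density_on_def
  proof (intro conjI allI impI)
    fix x
    show "0 \<le> ?g x" by (rule rearrangement_nonneg)
    have M: "M \<ge> 0" using density_on_nonneg[OF f, of 0] density_on_le[OF f, of 0] by linarith
    have no: "\<not> h < ?g x" if "h \<ge> 0" "measure lebesgue {y. h < f y} \<le> unit_ball_vol (real DIM('a)) * norm x ^ DIM('a)" for h
      using that rearrangement_superlevel[OF f] by (simp add: mem_set_rearrangement)
    have "{y. M < f y} = {}" using density_on_le[OF f] by (auto simp: not_less)
    then have "measure lebesgue {y. M < f y} = 0" by (simp only: measure_empty)
    then show "?g x \<le> M" using no[OF M] by simp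
    assume x: "R < norm x"
    have "measure lebesgue {y. 0 < f y} \<le> measure lebesgue (cball (0::'a) R)"
    proof (rule measure_mono_fmeasurable)
      show "{y. 0 < f y} \<subseteq> cball 0 R"
        using density_on_outside[OF f] by (auto, metis less_irrefl not_le)
    qed auto
    also have "\<dots> = unit_ball_vol (real DIM('a)) * R ^ DIM('a)"
      using R by (simp add: content_cball)
    also have "\<dots> \<le> unit_ball_vol (real DIM('a)) * norm x ^ DIM('a)"
      using x R by (intro mult_left_mono power_mono) auto
    finally show "?g x = 0" using no[of 0] rearrangement_nonneg[of f x] by simp
  qed (rule g_meas)
  show "equimeasurable f ?g"
    unfolding equimeasurable_def
  proof
    fix h
    show "emeasure lborel {x. h < f x} = emeasure lborel {x. h < ?g x}"
    proof (cases "h \<ge> 0")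
      case True
      have "emeasure lborel {x. h < f x} = ennreal (measure lebesgue {x. h < f x})"
        using density_on_emeasure_finite[OF f True] by (simp add: emeasure_eq_ennreal_measure less_top)
      also have "\<dots> = ennreal (measure lebesgue {x. h < ?g x})"
        by (simp add: sup[OF True] measure_set_rearrangement)
      also have "\<dots> = emeasure lborel {x. h < ?g x}"
      proof -
        obtain r where "{x. h < ?g x} = ball 0 r" using ball[OF True] by blast
        then have "emeasure lborel {x. h < ?g x} \<noteq> \<infinity>" using emeasure_lborel_ball_finite[of "0::'a" r] by simp
        then show ?thesis by (simp add: emeasure_eq_ennreal_measure)
      qed
      finally show ?thesis .
    next
      case False
      have "{x. h < f x} = UNIV" using False density_on_nonneg[OF f] by (auto simp: not_le intro: less_le_trans)
      then show ?thesis using False neg by simp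
    qed
  qed
qed

section \<open>The Newtonian kernel\<close>

abbreviation sphere_area :: "'a::euclidean_space itself \<Rightarrow> real" where
  "sphere_area _ \<equiv> real DIM('a) * unit_ball_vol (real DIM('a))"

lemma newtonian_norm_cong:
  fixes x y :: "'a::euclidean_space"
  shows "norm x = norm y \<Longrightarrow> newtonian x = newtonian y"
  by (simp add: newtonian_def)

lemma newtonian_measurable[measurable]: "newtonian \<in> borel_measurable borel"
  unfolding newtonian_def[abs_def] by measurable

text \<open>Mean value theorem for the radial profile, whose derivative at \<open>r\<close> is minus
  the reciprocal of the area of the sphere of radius \<open>r\<close> in every dimension. The three
  cases of the kernel are merged here and do not reappear.\<close>

lemma newtonian_diff:
  fixes a b :: "'a::euclidean_space"
  assumes "0 < norm a" "norm a \<le> norm b"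
  obtains \<xi> where "norm a \<le> \<xi>" "\<xi> \<le> norm b"
    "newtonian a - newtonian b = (norm b - norm a) / (sphere_area TYPE('a) * \<xi> ^ (DIM('a) - 1))"
proof (cases "norm a = norm b")
  case True
  then show ?thesis using that[of "norm a"] newtonian_norm_cong[OF True] by simp
next
  case False
  let ?n = "DIM('a)"
  define \<nu> :: "real \<Rightarrow> real" where "\<nu> r =
    (if ?n = 1 then - r / 2 else if ?n = 2 then - ln r / (2 * pi)
     else r powr (2 - real ?n) / (real ?n * (real ?n - 2) * unit_ball_vol (real ?n)))" for r
  have N: "newtonian x = \<nu> (norm x)" for x :: 'a by (simp add: newtonian_def \<nu>_def)
  have \<omega>: "unit_ball_vol (real ?n) > 0" by simp
  have deriv: "(\<nu> has_real_derivative - 1 / (sphere_area TYPE('a) * r ^ (?n - 1))) (at r)" if r: "r > 0" for r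
  proof -
    consider "?n = 1" | "?n = 2" | "?n > 2" using DIM_positive[where 'a='a] by linarith
    then show ?thesis
    proof cases
      case 1
      have "((\<lambda>r. - r / 2) has_real_derivative - 1 / 2) (at r)" by (auto intro!: derivative_eq_intros)
      then show ?thesis using 1 by (simp add: \<nu>_def[abs_def])
    next
      case 2
      have "((\<lambda>r. - ln r / (2 * pi)) has_real_derivative - 1 / (2 * pi * r)) (at r)"
        using r by (auto intro!: derivative_eq_intros simp: field_simps)
      then show ?thesis using 2 by (simp add: \<nu>_def[abs_def] unit_ball_vol_2)
    next
      case 3
      have p: "r powr (1 - real ?n) = 1 / r ^ (?n - 1)"
      proof -
        have "r powr (1 - real ?n) = r powr (- real (?n - 1))" using 3 by (simp add: of_nat_diff)
        also have "\<dots> = 1 / r ^ (?n - 1)" by (simp only: powr_minus powr_realpow[OF r] divide_inverse mult_1_left)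
        finally show ?thesis .
      qed
      have "((\<lambda>r. r powr (2 - real ?n) / (real ?n * (real ?n - 2) * unit_ball_vol (real ?n)))
        has_real_derivative ((2 - real ?n) * r powr (2 - real ?n - 1)) / (real ?n * (real ?n - 2) * unit_ball_vol (real ?n))) (at r)"
        using r by (intro DERIV_cdivide has_real_derivative_powr)
      moreover have "((2 - real ?n) * r powr (2 - real ?n - 1)) / (real ?n * (real ?n - 2) * unit_ball_vol (real ?n))
        = - 1 / (sphere_area TYPE('a) * r ^ (?n - 1))"
      proof -
        have "(2 - real ?n) * r powr (2 - real ?n - 1) = - ((real ?n - 2) * (1 / r ^ (?n - 1)))"
        proof -
          have e: "2 - real ?n - 1 = 1 - real ?n" by simp
          show ?thesis unfolding e p by (metis minus_diff_eq mult_minus_left)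
        qed
        moreover have "real ?n - 2 \<noteq> 0" using 3 by simp
        ultimately show ?thesis using r \<omega> by (simp add: divide_simps)
      qed
      ultimately show ?thesis using 3 by (simp add: \<nu>_def[abs_def])
    qed
  qed
  have "norm a < norm b" using assms False by simp
  then obtain \<xi> where \<xi>: "\<xi> > norm a" "\<xi> < norm b"
    "\<nu> (norm b) - \<nu> (norm a) = (norm b - norm a) * (- 1 / (sphere_area TYPE('a) * \<xi> ^ (?n - 1)))"
    using MVT2[of "norm a" "norm b" \<nu> "\<lambda>r. - 1 / (sphere_area TYPE('a) * r ^ (?n - 1))"] deriv assms
    by (meson less_le_trans)
  show ?thesis
    using that[of \<xi>] \<xi> by (simp add: N)
qed

lemma newtonian_decreasing:
  fixes a b :: "'a::euclidean_space"
  assumes "0 < norm a" "norm a \<le> norm b"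
  shows "newtonian b \<le> newtonian a"
proof -
  obtain \<xi> where "norm a \<le> \<xi>" "newtonian a - newtonian b = (norm b - norm a) / (sphere_area TYPE('a) * \<xi> ^ (DIM('a) - 1))"
    using newtonian_diff[OF assms] by metis
  moreover have "0 \<le> (norm b - norm a) / (sphere_area TYPE('a) * \<xi> ^ (DIM('a) - 1))"
    using assms order_trans[OF norm_ge_zero \<open>norm a \<le> \<xi>\<close>] by (intro divide_nonneg_nonneg mult_nonneg_nonneg) auto
  ultimately show ?thesis by linarith
qed

text \<open>The intermediate radius is at least the smaller of the two norms. Summing over both
  points makes the bound symmetric and convenient to integrate.\<close>

lemma newtonian_diff_le:
  fixes a b :: "'a::euclidean_space"
  assumes "a \<noteq> 0" "b \<noteq> 0"
  shows "\<bar>newtonian a - newtonian b\<bar> \<le> norm (a - b) / sphere_area TYPE('a) *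
    (1 / norm a ^ (DIM('a) - 1) + 1 / norm b ^ (DIM('a) - 1))"
proof -
  have *: "\<bar>newtonian a - newtonian b\<bar> \<le> norm (a - b) / sphere_area TYPE('a) *
    (1 / norm a ^ (DIM('a) - 1) + 1 / norm b ^ (DIM('a) - 1))" if ab: "a \<noteq> 0" "norm a \<le> norm b" for a b :: 'a
  proof -
    have pos: "0 < norm a" using ab by simp
    obtain \<xi> where \<xi>: "norm a \<le> \<xi>" "\<xi> \<le> norm b"
      and eq: "newtonian a - newtonian b = (norm b - norm a) / (sphere_area TYPE('a) * \<xi> ^ (DIM('a) - 1))"
      using newtonian_diff[OF pos ab(2)] by metis
    have "\<bar>newtonian a - newtonian b\<bar> = (norm b - norm a) / (sphere_area TYPE('a) * \<xi> ^ (DIM('a) - 1))"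
      using newtonian_decreasing[OF pos ab(2)] unfolding eq[symmetric] by linarith
    also have "\<dots> \<le> norm (a - b) / (sphere_area TYPE('a) * norm a ^ (DIM('a) - 1))"
      using \<xi> ab norm_triangle_ineq2[of b a]
      by (intro frac_le mult_left_mono power_mono) (auto simp: norm_minus_commute)
    also have "\<dots> = norm (a - b) / sphere_area TYPE('a) * (1 / norm a ^ (DIM('a) - 1))" by simp
    also have "\<dots> \<le> norm (a - b) / sphere_area TYPE('a) * (1 / norm a ^ (DIM('a) - 1) + 1 / norm b ^ (DIM('a) - 1))"
      by (intro mult_left_mono) auto
    finally show ?thesis .
  qed
  show ?thesis
  proof (cases "norm a \<le> norm b")
    case False
    then have le: "norm b \<le> norm a" by simp
    have "\<bar>newtonian a - newtonian b\<bar> = \<bar>newtonian b - newtonian a\<bar>" by (rule abs_minus_commute)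
    also have "\<dots> \<le> norm (b - a) / sphere_area TYPE('a) * (1 / norm b ^ (DIM('a) - 1) + 1 / norm a ^ (DIM('a) - 1))"
      by (rule *[OF assms(2) le])
    also have "\<dots> = norm (a - b) / sphere_area TYPE('a) * (1 / norm a ^ (DIM('a) - 1) + 1 / norm b ^ (DIM('a) - 1))"
      by (simp add: norm_minus_commute add.commute)
    finally show ?thesis .
  qed (rule *[OF assms(1)])
qed

text \<open>The quadratic term has slope \<open>2 * c * r\<close>, the kernel slope
  \<open>- 1 / (s * r ^ (n - 1))\<close> with \<open>s\<close> the area of the unit sphere. The sum
  is nonpositive as long as \<open>2 * c * s * r ^ n \<le> 1\<close>, and \<open>c\<close> makes
  this an equality at \<open>r = L\<close>.\<close>

lemma newtonian_plus_square_decreasing: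
  fixes a b :: "'a::euclidean_space"
  assumes "0 < norm a" "norm a \<le> norm b" "norm b \<le> L"
  defines "c \<equiv> 1 / (2 * sphere_area TYPE('a) * L ^ DIM('a))"
  shows "newtonian b + c * (norm b)\<^sup>2 \<le> newtonian a + c * (norm a)\<^sup>2"
proof -
  let ?s = "sphere_area TYPE('a)"
  have s: "?s > 0" by simp
  have b: "norm b > 0" using assms(1,2) by (rule less_le_trans)
  then have L: "L > 0" using assms(3) by (rule less_le_trans)
  obtain \<xi> where \<xi>: "norm a \<le> \<xi>" "\<xi> \<le> norm b"
    and eq: "newtonian a - newtonian b = (norm b - norm a) / (?s * \<xi> ^ (DIM('a) - 1))"
    using newtonian_diff[OF assms(1,2)] by metis
  have n: "norm b ^ DIM('a) = norm b * norm b ^ (DIM('a) - 1)"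
    using DIM_positive[where 'a='a] by (metis power_eq_if neq0_conv)
  have c: "c \<ge> 0" using L by (simp add: c_def)
  have "c * (norm b)\<^sup>2 - c * (norm a)\<^sup>2 = (norm b - norm a) * (c * (norm b + norm a))"
    by (simp add: power2_eq_square algebra_simps)
  also have "\<dots> \<le> (norm b - norm a) * (c * (norm b + norm b))"
    using assms(2) c by (intro mult_left_mono) auto
  also have "c * (norm b + norm b) = norm b / (?s * L ^ DIM('a))"
    using s L by (simp add: c_def field_simps)
  also have "(norm b - norm a) * \<dots> \<le> (norm b - norm a) * (norm b / (?s * norm b ^ DIM('a)))"
    using assms b L s by (intro mult_left_mono divide_left_mono power_mono mult_pos_pos) auto
  also have "norm b / (?s * norm b ^ DIM('a)) = 1 / (?s * norm b ^ (DIM('a) - 1))"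
    using b by (simp add: n)
  also have "(norm b - norm a) * \<dots> \<le> (norm b - norm a) * (1 / (?s * \<xi> ^ (DIM('a) - 1)))"
    using \<xi> less_le_trans[OF assms(1) \<xi>(1)] assms(2) b s
    by (intro mult_left_mono divide_left_mono power_mono mult_pos_pos zero_less_power) auto
  also have "\<dots> = newtonian a - newtonian b" by (simp add: eq)
  finally show ?thesis by simp
qed

text \<open>The singularity \<open>1 / norm x ^ (n - 1)\<close> is dominated by the integral of \<open>1 / s ^ n\<close> over the dyadic
  interval from \<open>norm x\<close> to \<open>2 * norm x\<close>.\<close>

lemma nn_integral_singularity_le:
  fixes r :: real
  assumes r: "r > 0"
  shows "(\<integral>\<^sup>+x. indicator (cball (0::'a::euclidean_space) r) x * ennreal (1 / norm x ^ (DIM('a) - 1)) \<partial>lborel)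
    \<le> ennreal (2 ^ (DIM('a) + 1) * unit_ball_vol (real DIM('a)) * r)" (is "nn_integral lborel ?f \<le> _")
proof -
  let ?n = "DIM('a)"
  let ?\<omega> = "unit_ball_vol (real ?n)"
  have \<omega>: "?\<omega> \<ge> 0" by simp
  let ?F = "\<lambda>(x::'a) (s::real). ennreal (2 ^ ?n / s ^ ?n) * of_bool (0 < s \<and> s \<le> 2 * r \<and> norm x \<le> s \<and> s \<le> 2 * norm x)"
  have pt: "indicator (cball 0 r) x * ennreal (1 / norm x ^ (?n - 1)) \<le> (\<integral>\<^sup>+s. ?F x s \<partial>lborel)" if x: "x \<noteq> 0" for x :: 'a
  proof (cases "norm x \<le> r")
    case True
    let ?d = "norm x"
    have d: "?d > 0" using x by simp
    have n: "(2 * ?d) ^ ?n = 2 ^ ?n * (?d * ?d ^ (?n - 1))"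
      using DIM_positive[where 'a='a] by (metis power_eq_if neq0_conv power_mult_distrib)
    have "1 / ?d ^ (?n - 1) = (2 ^ ?n / (2 * ?d) ^ ?n) * ?d" using d by (subst n) simp
    then have "ennreal (1 / ?d ^ (?n - 1)) = ennreal (2 ^ ?n / (2 * ?d) ^ ?n) * emeasure lborel {?d..2 * ?d}"
      using d by (simp flip: ennreal_mult)
    also have "\<dots> = (\<integral>\<^sup>+s. ennreal (2 ^ ?n / (2 * ?d) ^ ?n) * indicator {?d..2 * ?d} s \<partial>lborel)"
      by (simp add: nn_integral_cmult_indicator)
    also have "\<dots> \<le> (\<integral>\<^sup>+s. ?F x s \<partial>lborel)"
    proof (rule nn_integral_mono)
      fix s
      have "2 ^ ?n / (2 * ?d) ^ ?n \<le> 2 ^ ?n / s ^ ?n" if "?d \<le> s" "s \<le> 2 * ?d"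
        using that d less_le_trans[OF d that(1)]
        by (intro divide_left_mono power_mono mult_pos_pos zero_less_power) auto
      then show "ennreal (2 ^ ?n / (2 * ?d) ^ ?n) * indicator {?d..2 * ?d} s \<le> ?F x s"
        using True less_le_trans[OF d] by (auto simp: indicator_def intro: ennreal_leI simp del: zero_less_norm_iff)
    qed
    finally show ?thesis using True by simp
  qed simp
  have "nn_integral lborel ?f \<le> (\<integral>\<^sup>+x. \<integral>\<^sup>+s. ?F x s \<partial>lborel \<partial>lborel)"
    using pt AE_lborel_singleton[of "0::'a"] by (intro nn_integral_mono_AE) auto
  also have "\<dots> = (\<integral>\<^sup>+s. \<integral>\<^sup>+x. ?F x s \<partial>lborel \<partial>lborel)"
    unfolding of_bool_def by (rule lborel_pair.Fubini') measurable
  also have "\<dots> \<le> (\<integral>\<^sup>+s. ennreal (2 ^ ?n * ?\<omega>) * indicator {0..2 * r} s \<partial>lborel)"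
  proof (rule nn_integral_mono)
    fix s :: real
    show "(\<integral>\<^sup>+x. ?F x s \<partial>lborel) \<le> ennreal (2 ^ ?n * ?\<omega>) * indicator {0..2 * r} s"
    proof (cases "0 < s \<and> s \<le> 2 * r")
      case True
      \<comment> \<open>For fixed \<open>s\<close> the points lie in a ball whose volume is
        proportional to \<open>s ^ n\<close>; this cancels the denominator, so each \<open>s\<close>
        up to \<open>2 * r\<close> contributes a bounded amount.\<close>
      have "(\<integral>\<^sup>+x. ?F x s \<partial>lborel) \<le> (\<integral>\<^sup>+x. ennreal (2 ^ ?n / s ^ ?n) * indicator (cball (0::'a) s) x \<partial>lborel)"
        by (intro nn_integral_mono) (auto simp: indicator_def)
      also have "\<dots> = ennreal (2 ^ ?n / s ^ ?n) * ennreal (?\<omega> * s ^ ?n)"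
        using True by (simp add: nn_integral_cmult_indicator emeasure_cball)
      also have "\<dots> = ennreal (2 ^ ?n * ?\<omega>)"
        using True by (simp flip: ennreal_mult)
      finally show ?thesis using True by simp
    qed (auto simp: not_le not_less)
  qed
  also have "\<dots> = ennreal (2 ^ ?n * ?\<omega>) * ennreal (2 * r)"
    using r by (simp add: nn_integral_cmult_indicator)
  also have "\<dots> = ennreal (2 ^ (?n + 1) * ?\<omega> * r)"
    using r \<omega> by (subst ennreal_mult[symmetric]) (auto simp: mult_ac)
  finally show ?thesis .
qed

section \<open>Newtonian potentials\<close>

lemma distr_lborel_point_reflection: "distr lborel borel (\<lambda>x. c - x) = (lborel :: 'a::euclidean_space measure)"
  using lborel_affine[of "-1" c] by (simp add: density_1)

lemma distr_lborel_mirror: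
  fixes w :: "'a::euclidean_space"
  assumes w: "w \<noteq> 0"
  shows "distr lborel borel (mirror w t) = lborel"
proof (rule measure_eqI)
  fix A assume "A \<in> sets (distr lborel borel (mirror w t))"
  then have [measurable]: "A \<in> sets borel" by simp
  have "emeasure (distr lborel borel (mirror w t)) A = (\<integral>\<^sup>+x. indicator A x \<partial>distr lborel borel (mirror w t))"
    by simp
  also have "\<dots> = (\<integral>\<^sup>+x. indicator A (mirror w t x) \<partial>lborel)"
    by (rule nn_integral_distr) simp_all
  also have "\<dots> = emeasure lborel A"
    by (subst nn_integral_mirror[OF _ w]) simp_all
  finally show "emeasure (distr lborel borel (mirror w t)) A = emeasure lborel A" .
qed simp

lemma integral_lborel_point_reflection:
  fixes f :: "'a::euclidean_space \<Rightarrow> real"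
  assumes [measurable]: "f \<in> borel_measurable borel"
  shows "(\<integral>x. f (c - x) \<partial>lborel) = (\<integral>x. f x \<partial>lborel)"
  by (subst (2) distr_lborel_point_reflection[of c, symmetric]) (simp add: integral_distr)

lemma integral_lborel_translate:
  fixes f :: "'a::euclidean_space \<Rightarrow> 'b::{banach, second_countable_topology}"
  assumes [measurable]: "f \<in> borel_measurable borel"
  shows "(\<integral>x. f (c + x) \<partial>lborel) = (\<integral>x. f x \<partial>lborel)"
  by (subst (2) lborel_distr_plus[of c, symmetric]) (simp add: integral_distr)

lemma integral_lborel_mirror:
  fixes f :: "'a::euclidean_space \<Rightarrow> real"
  assumes [measurable]: "f \<in> borel_measurable borel" and w: "w \<noteq> 0"
  shows "(\<integral>x. f (mirror w t x) \<partial>lborel) = (\<integral>x. f x \<partial>lborel)"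
  by (subst (2) distr_lborel_mirror[OF w, of t, symmetric]) (simp add: integral_distr)

text \<open>Comparing with the value at a unit vector bounds the kernel in every dimension by a
  constant plus a multiple of \<open>1 / norm x ^ (n - 1)\<close>, whose local integral is already
  estimated.\<close>

lemma nn_integral_newtonian_finite:
  "(\<integral>\<^sup>+x. indicator (cball (0::'a::euclidean_space) r) x * ennreal \<bar>newtonian x\<bar> \<partial>lborel) < \<infinity>"
proof -
  define r' where "r' = max r 1"
  have r': "r' > 0" by (simp add: r'_def)
  obtain e :: 'a where e: "norm e = 1" using SOME_Basis norm_Basis by blast
  define A where "A = (r' + 1) / sphere_area TYPE('a)"
  have A: "A \<ge> 0" using r' by (simp add: A_def)
  let ?s = "\<lambda>x::'a. 1 / norm x ^ (DIM('a) - 1)"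
  have bound: "indicator (cball 0 r) x * ennreal \<bar>newtonian x\<bar>
    \<le> ennreal (\<bar>newtonian e\<bar> + A) * indicator (cball 0 r') x + ennreal A * (indicator (cball 0 r') x * ennreal (?s x))"
    if x: "x \<noteq> 0" for x :: 'a
  proof (cases "norm x \<le> r")
    case True
    then have xr: "norm x \<le> r'" by (simp add: r'_def)
    have "\<bar>newtonian x - newtonian e\<bar> \<le> norm (x - e) / sphere_area TYPE('a) * (?s x + 1 / norm e ^ (DIM('a) - 1))"
      using x e by (intro newtonian_diff_le) auto
    also have "\<dots> \<le> A * (?s x + 1 / norm e ^ (DIM('a) - 1))"
      unfolding A_def using xr e norm_triangle_ineq4[of x e] by (intro mult_right_mono divide_right_mono) auto
    finally have "\<bar>newtonian x\<bar> \<le> \<bar>newtonian e\<bar> + A + A * ?s x" using e by (simp add: algebra_simps)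
    then have "ennreal \<bar>newtonian x\<bar> \<le> ennreal (\<bar>newtonian e\<bar> + A + A * ?s x)" by (rule ennreal_leI)
    also have "\<dots> = ennreal (\<bar>newtonian e\<bar> + A) + ennreal A * ennreal (?s x)"
      using A by (simp flip: ennreal_mult ennreal_plus)
    finally show ?thesis using xr by (simp add: indicator_def)
  qed simp
  have "(\<integral>\<^sup>+x. indicator (cball (0::'a) r) x * ennreal \<bar>newtonian x\<bar> \<partial>lborel)
    \<le> (\<integral>\<^sup>+x. ennreal (\<bar>newtonian e\<bar> + A) * indicator (cball 0 r') x + ennreal A * (indicator (cball 0 r') x * ennreal (?s x)) \<partial>lborel)"
    using bound AE_lborel_singleton[of "0::'a"] by (intro nn_integral_mono_AE) auto
  also have "\<dots> = ennreal (\<bar>newtonian e\<bar> + A) * emeasure lborel (cball (0::'a) r') + ennreal A * (\<integral>\<^sup>+x. indicator (cball (0::'a) r') x * ennreal (?s x) \<partial>lborel)"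
    by (simp add: nn_integral_add nn_integral_cmult nn_integral_cmult_indicator)
  also have "\<dots> < \<infinity>"
    using nn_integral_singularity_le[OF r', where 'a='a] emeasure_lborel_cball_finite[of "0::'a" r']
    by (auto simp: ennreal_mult_less_top less_top intro: le_less_trans)
  finally show ?thesis .
qed

lemma nn_integral_shifted_newtonian_le:
  fixes y :: "'a::euclidean_space"
  assumes [measurable]: "u \<in> borel_measurable borel" and u: "\<And>x. \<bar>u x\<bar> \<le> M" "\<And>x. R < norm x \<Longrightarrow> u x = 0"
    and y: "norm y \<le> L"
  shows "(\<integral>\<^sup>+x. ennreal \<bar>u x * newtonian (x - y)\<bar> \<partial>lborel)
    \<le> ennreal M * (\<integral>\<^sup>+x. indicator (cball (0::'a) (R + L)) x * ennreal \<bar>newtonian x\<bar> \<partial>lborel)"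
proof -
  have M: "M \<ge> 0" using u(1)[of 0] by linarith
  let ?f = "\<lambda>x::'a. indicator (cball 0 (R + L)) x * ennreal \<bar>newtonian x\<bar>"
  have "(\<integral>\<^sup>+x. ennreal \<bar>u x * newtonian (x - y)\<bar> \<partial>lborel) \<le> (\<integral>\<^sup>+x. ennreal M * ?f (- y + x) \<partial>lborel)"
  proof (rule nn_integral_mono)
    fix x
    show "ennreal \<bar>u x * newtonian (x - y)\<bar> \<le> ennreal M * ?f (- y + x)"
    proof (cases "norm x \<le> R")
      case True
      then have "norm (x - y) \<le> R + L" using y norm_triangle_ineq4[of x y] by linarith
      moreover have "\<bar>u x * newtonian (x - y)\<bar> \<le> M * \<bar>newtonian (x - y)\<bar>"
        unfolding abs_mult using u(1) by (intro mult_right_mono) auto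
      ultimately show ?thesis using M by (simp add: ennreal_leI flip: ennreal_mult)
    qed (simp add: u(2))
  qed
  also have "\<dots> = ennreal M * (\<integral>\<^sup>+x. ?f (- y + x) \<partial>lborel)"
    by (rule nn_integral_cmult) measurable
  also have "(\<integral>\<^sup>+x. ?f (- y + x) \<partial>lborel) = (\<integral>\<^sup>+x. ?f x \<partial>lborel)"
    by (rule nn_integral_lborel_translate) measurable
  finally show ?thesis .
qed

lemma integrable_shifted_newtonian:
  fixes y :: "'a::euclidean_space"
  assumes [measurable]: "u \<in> borel_measurable borel" and u: "\<And>x. \<bar>u x\<bar> \<le> M" "\<And>x. R < norm x \<Longrightarrow> u x = 0"
  shows "integrable lborel (\<lambda>x. u x * newtonian (x - y))"
proof (rule integrableI_bounded)
  have "(\<integral>\<^sup>+x. ennreal (norm (u x * newtonian (x - y))) \<partial>lborel)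
    \<le> ennreal M * (\<integral>\<^sup>+x. indicator (cball (0::'a) (R + norm y)) x * ennreal \<bar>newtonian x\<bar> \<partial>lborel)"
    using nn_integral_shifted_newtonian_le[OF assms(1) u(1) u(2) order_refl, where y=y] by simp
  also have "\<dots> < \<infinity>" using nn_integral_newtonian_finite[where 'a='a] by (simp add: ennreal_mult_less_top)
  finally show "(\<integral>\<^sup>+x. ennreal (norm (u x * newtonian (x - y))) \<partial>lborel) < \<infinity>" .
qed measurable

section \<open>Potentials of centred balls\<close>

definition ball_potential :: "real \<Rightarrow> 'a::euclidean_space \<Rightarrow> real" where
  "ball_potential r x = (\<integral>z. indicator (ball 0 r) z * newtonian (z - x) \<partial>lborel)"

lemma ball_potential_integrable:
  "integrable lborel (\<lambda>z::'a::euclidean_space. indicator (ball 0 r) z * newtonian (z - x))"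
  by (rule integrable_shifted_newtonian[where M=1 and R=r]) (auto simp: indicator_def)

text \<open>For points of equal norm, the hyperplane through the origin orthogonal to
  \<open>x - y\<close> gives a reflection that exchanges them and preserves the ball and all
  distances.\<close>

lemma ball_potential_norm_cong:
  fixes x y :: "'a::euclidean_space"
  assumes "norm x = norm y"
  shows "ball_potential r x = ball_potential r y"
proof (cases "x = y")
  case False
  define w where "w = x - y"
  have w: "w \<noteq> 0" using False by (simp add: w_def)
  have xx: "x \<bullet> x = y \<bullet> y" using assms by (simp flip: power2_norm_eq_inner)
  have ww: "w \<bullet> w = 2 * (x \<bullet> w)" using xx by (simp add: w_def algebra_simps inner_commute)
  then have "2 * (x \<bullet> w) / (w \<bullet> w) = 1" using w ww by (metis divide_self inner_eq_zero_iff)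
  then have "mirror w 0 x = x - w" by (simp only: mirror_def diff_zero scaleR_one)
  then have m: "mirror w 0 x = y" by (simp add: w_def)
  have nm: "norm (mirror w 0 z) = norm z" for z using norm_mirror[OF w, of 0 z] by simp
  have "ball_potential r y = (\<integral>z. indicator (ball 0 r) (mirror w 0 z) * newtonian (mirror w 0 z - y) \<partial>lborel)"
    unfolding ball_potential_def by (rule integral_lborel_mirror[OF _ w, symmetric]) measurable
  also have "\<dots> = ball_potential r x"
    unfolding ball_potential_def
  proof (rule Bochner_Integration.integral_cong)
    fix z
    have "newtonian (mirror w 0 z - y) = newtonian (z - x)"
      using norm_mirror_diff_mirror[OF w, of 0 z x] by (intro newtonian_norm_cong) (simp add: m)
    then show "indicator (ball 0 r) (mirror w 0 z) * newtonian (mirror w 0 z - y) = indicator (ball 0 r) z * newtonian (z - x)"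
      by (simp add: indicator_def nm)
  qed simp
  finally show ?thesis by simp
qed simp

text \<open>Integrates the mean value bound for the kernel over the ball. The resulting integral of
  \<open>1 / norm (z - x) ^ (n - 1)\<close> is of order \<open>r\<close> uniformly in
  \<open>x\<close>, so the Lipschitz constant grows only linearly with the radius.\<close>

lemma ball_potential_lipschitz:
  fixes x y :: "'a::euclidean_space"
  assumes r: "r > 0"
  shows "\<bar>ball_potential r x - ball_potential r y\<bar> \<le> 2 * (2 ^ (DIM('a) + 1) + 1) * r * norm (x - y)"
proof -
  let ?k = "\<lambda>a z::'a. indicator (ball 0 r) z * newtonian (z - a)"
  let ?n = "DIM('a)"
  let ?\<omega> = "unit_ball_vol (real ?n)"
  let ?C = "2 ^ (?n + 1) + 1 :: real"
  let ?s = "\<lambda>z::'a. 1 / norm z ^ (?n - 1)"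
  have \<omega>: "?\<omega> > 0" by simp
  have n: "r ^ ?n = r * r ^ (?n - 1)" using DIM_positive[where 'a='a] by (metis power_eq_if neq0_conv)
  \<comment> \<open>Points within distance \<open>r\<close> of \<open>x\<close> fall under the
    singularity estimate; at all others the integrand is at most \<open>1 / r ^ (n - 1)\<close>, and
    the ball has volume of order \<open>r ^ n\<close>.\<close>
  have sing: "(\<integral>\<^sup>+z. indicator (ball 0 r) z * ennreal (?s (z - x)) \<partial>lborel) \<le> ennreal (?C * ?\<omega> * r)" for x :: 'a
  proof -
    let ?f = "\<lambda>z::'a. indicator (cball 0 r) z * ennreal (?s z)"
    have "(\<integral>\<^sup>+z. indicator (ball 0 r) z * ennreal (?s (z - x)) \<partial>lborel)
      \<le> (\<integral>\<^sup>+z. ?f (- x + z) + ennreal (1 / r ^ (?n - 1)) * indicator (ball 0 r) z \<partial>lborel)"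
    proof (rule nn_integral_mono)
      fix z :: 'a
      show "indicator (ball 0 r) z * ennreal (?s (z - x)) \<le> ?f (- x + z) + ennreal (1 / r ^ (?n - 1)) * indicator (ball 0 r) z"
      proof (cases "norm (z - x) \<le> r")
        case True
        then show ?thesis by (simp add: indicator_def)
      next
        case False
        then have "?s (z - x) \<le> 1 / r ^ (?n - 1)"
          using r by (intro divide_left_mono power_mono mult_pos_pos zero_less_power) auto
        then show ?thesis using False by (simp add: indicator_def ennreal_leI)
      qed
    qed
    also have "\<dots> = (\<integral>\<^sup>+z. ?f (- x + z) \<partial>lborel) + ennreal (1 / r ^ (?n - 1)) * emeasure lborel (ball (0::'a) r)"
      by (subst nn_integral_add) (auto simp: nn_integral_cmult_indicator)
    also have "(\<integral>\<^sup>+z. ?f (- x + z) \<partial>lborel) = (\<integral>\<^sup>+z. ?f z \<partial>lborel)"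
      by (rule nn_integral_lborel_translate) measurable
    also have "\<dots> + ennreal (1 / r ^ (?n - 1)) * emeasure lborel (ball (0::'a) r)
      \<le> ennreal (2 ^ (?n + 1) * ?\<omega> * r) + ennreal (?\<omega> * r)"
    proof (rule add_mono[OF nn_integral_singularity_le[OF r]])
      show "ennreal (1 / r ^ (?n - 1)) * emeasure lborel (ball (0::'a) r) \<le> ennreal (?\<omega> * r)"
        using r by (simp add: emeasure_ball n flip: ennreal_mult)
    qed
    also have "\<dots> = ennreal (?C * ?\<omega> * r)" using r by (simp add: distrib_right flip: ennreal_plus)
    finally show ?thesis .
  qed
  let ?d = "norm (x - y) / sphere_area TYPE('a)"
  have d: "?d \<ge> 0" by simp
  have "ennreal \<bar>ball_potential r x - ball_potential r y\<bar>
    = ennreal \<bar>\<integral>z. ?k x z - ?k y z \<partial>lborel\<bar>"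
    unfolding ball_potential_def by (subst Bochner_Integration.integral_diff) (auto intro: ball_potential_integrable)
  also have "\<dots> \<le> (\<integral>\<^sup>+z. ennreal (norm (?k x z - ?k y z)) \<partial>lborel)"
    using integral_norm_bound_ennreal[OF Bochner_Integration.integrable_diff[OF ball_potential_integrable ball_potential_integrable], of r x r y]
    by simp
  also have "\<dots> \<le> (\<integral>\<^sup>+z. ennreal ?d * (indicator (ball 0 r) z * ennreal (?s (z - x)) + indicator (ball 0 r) z * ennreal (?s (z - y))) \<partial>lborel)"
  proof (rule nn_integral_mono_AE)
    show "AE z in lborel. ennreal (norm (?k x z - ?k y z))
      \<le> ennreal ?d * (indicator (ball 0 r) z * ennreal (?s (z - x)) + indicator (ball 0 r) z * ennreal (?s (z - y)))"
      using AE_lborel_singleton[of x] AE_lborel_singleton[of y]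
    proof eventually_elim
      case (elim z)
      show ?case
      proof (cases "z \<in> ball 0 r")
        case True
        have "\<bar>newtonian (z - x) - newtonian (z - y)\<bar> \<le> norm ((z - x) - (z - y)) / sphere_area TYPE('a) * (?s (z - x) + ?s (z - y))"
          using elim by (intro newtonian_diff_le) auto
        then have "\<bar>newtonian (z - x) - newtonian (z - y)\<bar> \<le> ?d * (?s (z - x) + ?s (z - y))"
          by (simp add: norm_minus_commute)
        then have "ennreal \<bar>newtonian (z - x) - newtonian (z - y)\<bar> \<le> ennreal (?d * (?s (z - x) + ?s (z - y)))"
          by (rule ennreal_leI)
        also have "\<dots> = ennreal ?d * (ennreal (?s (z - x)) + ennreal (?s (z - y)))"
          by (subst ennreal_mult) (auto simp flip: ennreal_plus)
        finally show ?thesis using True by simp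
      qed simp
    qed
  qed
  also have "\<dots> = ennreal ?d * ((\<integral>\<^sup>+z. indicator (ball 0 r) z * ennreal (?s (z - x)) \<partial>lborel) + (\<integral>\<^sup>+z. indicator (ball 0 r) z * ennreal (?s (z - y)) \<partial>lborel))"
    by (subst nn_integral_cmult, measurable, subst nn_integral_add) auto
  also have "\<dots> \<le> ennreal ?d * (ennreal (?C * ?\<omega> * r) + ennreal (?C * ?\<omega> * r))"
    by (intro mult_left_mono add_mono sing) simp
  also have "\<dots> = ennreal (?d * (2 * (?C * ?\<omega> * r)))"
  proof -
    have "ennreal D * (ennreal A + ennreal A) = ennreal (D * (2 * A))" if "D \<ge> 0" "A \<ge> 0" for D A
      using that by (simp flip: ennreal_mult ennreal_plus)
    then show ?thesis using r \<omega> d by simp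
  qed
  finally have "\<bar>ball_potential r x - ball_potential r y\<bar> \<le> ?d * (2 * (?C * ?\<omega> * r))"
    using r d by (subst (asm) ennreal_le_iff) (intro mult_nonneg_nonneg d, simp_all)
  also have "\<dots> = (2 * ?C * r * norm (x - y)) / real ?n"
    using less_imp_neq[OF \<omega>] by (simp add: field_simps)
  also have "\<dots> \<le> (2 * ?C * r * norm (x - y)) / 1"
    using r DIM_positive[where 'a='a] by (intro divide_left_mono) (auto simp del: DIM_positive)
  finally show ?thesis by simp
qed

lemma power_diff_le:
  fixes a b :: real
  assumes "0 \<le> a" "a \<le> b"
  shows "b ^ Suc m - a ^ Suc m \<le> real (Suc m) * b ^ m * (b - a)"
proof (induction m)
  case (Suc m)
  have "b ^ Suc (Suc m) - a ^ Suc (Suc m) = b * (b ^ Suc m - a ^ Suc m) + a ^ Suc m * (b - a)"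
    by (simp add: algebra_simps)
  also have "\<dots> \<le> b * (real (Suc m) * b ^ m * (b - a)) + b ^ Suc m * (b - a)"
    using assms Suc by (intro add_mono mult_left_mono mult_right_mono power_mono) auto
  also have "\<dots> = real (Suc (Suc m)) * b ^ Suc m * (b - a)"
    by (simp add: algebra_simps)
  finally show ?case .
qed simp

text \<open>The point reflection in \<open>(x + y) / 2\<close> exchanges the balls around \<open>x\<close> and \<open>y\<close>. Away from the
  origin it changes the kernel by \<open>O(norm (x + y))\<close>, and the symmetric difference of the balls has measure
  \<open>O(norm (x - y))\<close>.\<close>

lemma ball_potential_near:
  fixes x y :: "'a::euclidean_space"
  assumes r: "r > 0" and x: "norm x \<le> r / 2" and y: "norm y \<le> r / 2"
  shows "ball_potential r x - ball_potential r y \<le> 2 ^ DIM('a) * norm (x + y) * norm (x - y)"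
proof -
  let ?n = "DIM('a)"
  let ?\<omega> = "unit_ball_vol (real ?n)"
  have \<omega>: "?\<omega> > 0" by simp
  obtain m where m: "?n = Suc m" using DIM_positive[where 'a='a] by (metis Suc_pred)
  define p where "p = x + y"
  define d where "d = norm (x - y)"
  have d: "0 \<le> d" "d \<le> r" using x y norm_triangle_ineq4[of x y] by (auto simp: d_def)
  define \<iota> :: "'a \<Rightarrow> 'a \<Rightarrow> real" where "\<iota> a z = indicator (ball 0 r) (a - z)" for a z
  have \<iota>_ball: "\<iota> a z = indicator (ball a r) z" for a z
    by (simp add: \<iota>_def indicator_def dist_norm norm_minus_commute[of a z])
  have [measurable]: "\<iota> a \<in> borel_measurable borel" for a
    unfolding \<iota>_ball[abs_def] by simp
  have pot1: "ball_potential r a = (\<integral>z. \<iota> a z * newtonian z \<partial>lborel)" for a :: 'a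
  proof -
    have "ball_potential r a = (\<integral>z. \<iota> a (a - z) * newtonian (a - z) \<partial>lborel)"
      unfolding ball_potential_def \<iota>_def
      by (intro Bochner_Integration.integral_cong refl arg_cong2[where f="(*)"] newtonian_norm_cong)
        (simp_all add: norm_minus_commute)
    also have "\<dots> = (\<integral>z. \<iota> a z * newtonian z \<partial>lborel)"
      by (rule integral_lborel_point_reflection) measurable
    finally show ?thesis .
  qed
  \<comment> \<open>Second representation, obtained from the first by the reflection of
    \<open>z\<close> to \<open>p - z\<close>. It centres the ball at \<open>p - a\<close>, which is
    \<open>y\<close> for \<open>a = x\<close> and \<open>x\<close> for \<open>a = y\<close>.\<close>
  have pot2: "ball_potential r a = (\<integral>z. \<iota> (p - a) z * newtonian (z - p) \<partial>lborel)" for a :: 'a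
  proof -
    have "ball_potential r a = (\<integral>z. \<iota> a (p - z) * newtonian (p - z) \<partial>lborel)"
      unfolding pot1 by (rule integral_lborel_point_reflection[symmetric]) measurable
    also have "\<dots> = (\<integral>z. \<iota> (p - a) z * newtonian (z - p) \<partial>lborel)"
    proof (rule Bochner_Integration.integral_cong)
      fix z
      have "\<iota> a (p - z) = \<iota> (p - a) z"
        by (simp add: \<iota>_def indicator_def) (metis diff_diff_eq2 diff_right_commute minus_diff_eq norm_minus_cancel add_diff_eq diff_diff_add add.commute)
      moreover have "newtonian (p - z) = newtonian (z - p)" by (rule newtonian_norm_cong) (rule norm_minus_commute)
      ultimately show "\<iota> a (p - z) * newtonian (p - z) = \<iota> (p - a) z * newtonian (z - p)" by simp
    qed simp
    finally show ?thesis .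
  qed
  have int: "integrable lborel (\<lambda>z. \<iota> a z * newtonian (z - q))" for a q :: 'a
  proof (rule integrable_shifted_newtonian[where M=1 and R="r + norm a"])
    show "\<iota> a z = 0" if "r + norm a < norm z" for z
      using that norm_triangle_ineq2[of z a] by (simp add: \<iota>_def indicator_def norm_minus_commute)
  qed (auto simp: \<iota>_def indicator_def)
  have int0: "integrable lborel (\<lambda>z. \<iota> a z * newtonian z)" for a using int[of a 0] by simp
  define Lb where "Lb = norm p / sphere_area TYPE('a) * (2 * (2 / r) ^ m)"
  have Lb: "Lb \<ge> 0" using r by (simp add: Lb_def)
  \<comment> \<open>A point in exactly one of the two balls lies in the outer layer of width
    \<open>d\<close> of the ball containing it.\<close>
  let ?shell = "\<lambda>a. ball a r - ball a (r - d)"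
  have shell_measure: "measure lborel (?shell a) \<le> ?\<omega> * (real ?n * r ^ m * d)" for a :: 'a
  proof -
    have "measure lborel (?shell a) = measure lborel (ball a r) - measure lborel (ball a (r - d))"
      using d emeasure_lborel_ball_finite by (intro measure_Diff) (auto simp: less_top)
    also have "\<dots> = ?\<omega> * (r ^ ?n - (r - d) ^ ?n)"
      using d r by (simp add: content_ball algebra_simps)
    also have "\<dots> \<le> ?\<omega> * (real ?n * r ^ m * d)"
      using power_diff_le[of "r - d" r m] d \<omega> unfolding m by (intro mult_left_mono) auto
    finally show ?thesis .
  qed
  have shell_int: "integrable lborel (indicator (?shell a) :: 'a \<Rightarrow> real)" for a :: 'a
    using emeasure_mono[of "?shell a" "ball a r" lborel] emeasure_lborel_ball_finite[of a r]
    by (intro integrable_real_indicator) (auto intro: le_less_trans)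
  have pt: "(\<iota> x z - \<iota> y z) * (newtonian z - newtonian (z - p)) \<le> Lb * (indicator (?shell x) z + indicator (?shell y) z)" for z
  proof (cases "\<iota> x z = \<iota> y z")
    case True
    then show ?thesis using Lb by simp
  next
    case False
    have zx: "r \<le> norm (z - x) \<or> r \<le> norm (z - y)" and zs: "z \<in> ?shell x \<or> z \<in> ?shell y"
      using False norm_triangle_ineq[of "z - x" "x - y"] norm_triangle_ineq[of "z - y" "y - x"]
      by (auto simp: \<iota>_ball indicator_def dist_norm norm_minus_commute d_def split: if_splits)
    \<comment> \<open>A point of the symmetric difference is at distance at least \<open>r\<close>
      from \<open>x\<close> or from \<open>y\<close>, hence at least \<open>r / 2\<close> from both
      singularities \<open>0\<close> and \<open>p\<close>.\<close>
    have z1: "r / 2 \<le> norm z"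
      using zx x y norm_triangle_ineq4[of z x] norm_triangle_ineq4[of z y] by linarith
      have "norm (z - x) \<le> norm (z - p) + norm y" "norm (z - y) \<le> norm (z - p) + norm x"
      using norm_triangle_ineq[of "z - p" y] norm_triangle_ineq[of "z - p" x] by (simp_all add: p_def)
    then have z2: "r / 2 \<le> norm (z - p)" using zx x y by linarith
    have inv: "1 / norm v ^ m \<le> (2 / r) ^ m" if "r / 2 \<le> norm v" for v :: 'a
    proof -
      have "1 / norm v ^ m \<le> 1 / (r / 2) ^ m"
        using that r by (intro divide_left_mono power_mono mult_pos_pos zero_less_power) auto
      then show ?thesis by (simp add: power_divide)
    qed
    have "z \<noteq> 0" "z - p \<noteq> 0" using z1 z2 r by auto
    then have "\<bar>newtonian z - newtonian (z - p)\<bar> \<le> norm (z - (z - p)) / sphere_area TYPE('a) * (1 / norm z ^ (?n - 1) + 1 / norm (z - p) ^ (?n - 1))"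
      by (rule newtonian_diff_le)
    also have "\<dots> \<le> norm p / sphere_area TYPE('a) * ((2 / r) ^ m + (2 / r) ^ m)"
      using inv[OF z1] inv[OF z2] m by (intro mult_mono add_mono) auto
    also have "\<dots> = Lb" by (simp add: Lb_def)
    finally have N: "\<bar>newtonian z - newtonian (z - p)\<bar> \<le> Lb" .
    have "(\<iota> x z - \<iota> y z) * (newtonian z - newtonian (z - p)) \<le> \<bar>\<iota> x z - \<iota> y z\<bar> * \<bar>newtonian z - newtonian (z - p)\<bar>"
      by (metis abs_ge_self abs_mult)
    also have "\<dots> \<le> 1 * Lb" using N by (intro mult_mono) (auto simp: \<iota>_def indicator_def)
    also have "\<dots> \<le> Lb * (indicator (?shell x) z + indicator (?shell y) z)"
      using zs Lb by (auto simp: indicator_def)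
    finally show ?thesis .
  qed
  \<comment> \<open>Adding the differences obtained from both representations pairs the difference
    of the indicators with a difference of kernel values. One factor is small in measure, the other
    in size, which gives the product of \<open>norm (x - y)\<close> and
    \<open>norm (x + y)\<close>.\<close>
  have "2 * (ball_potential r x - ball_potential r y)
    = ((\<integral>z. \<iota> x z * newtonian z \<partial>lborel) - (\<integral>z. \<iota> y z * newtonian z \<partial>lborel))
      - ((\<integral>z. \<iota> x z * newtonian (z - p) \<partial>lborel) - (\<integral>z. \<iota> y z * newtonian (z - p) \<partial>lborel))"
    using pot1[of x] pot1[of y] pot2[of x] pot2[of y] by (simp add: p_def)
  also have "\<dots> = (\<integral>z. (\<iota> x z * newtonian z - \<iota> y z * newtonian z) - (\<iota> x z * newtonian (z - p) - \<iota> y z * newtonian (z - p)) \<partial>lborel)"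
    by (simp add: int int0)
  also have "\<dots> = (\<integral>z. (\<iota> x z - \<iota> y z) * (newtonian z - newtonian (z - p)) \<partial>lborel)"
    by (intro Bochner_Integration.integral_cong) (simp_all add: algebra_simps)
  also have "\<dots> \<le> (\<integral>z. Lb * (indicator (?shell x) z + indicator (?shell y) z) \<partial>lborel)"
  proof (rule integral_mono[OF _ _ pt])
    have "integrable lborel (\<lambda>z. (\<iota> x z * newtonian z - \<iota> y z * newtonian z) - (\<iota> x z * newtonian (z - p) - \<iota> y z * newtonian (z - p)))"
      by (intro Bochner_Integration.integrable_diff int int0)
    then show "integrable lborel (\<lambda>z. (\<iota> x z - \<iota> y z) * (newtonian z - newtonian (z - p)))"
      by (rule back_subst) (auto simp: algebra_simps)
    show "integrable lborel (\<lambda>z. Lb * (indicator (?shell x) z + indicator (?shell y) z))"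
      by (intro integrable_mult_right Bochner_Integration.integrable_add shell_int)
  qed
  also have "\<dots> = Lb * (measure lborel (?shell x) + measure lborel (?shell y))"
    by (simp add: shell_int)
  also have "\<dots> \<le> Lb * (?\<omega> * (real ?n * r ^ m * d) + ?\<omega> * (real ?n * r ^ m * d))"
    by (intro mult_left_mono add_mono shell_measure Lb)
  also have "\<dots> = 2 * (2 * 2 ^ m * norm p * d)"
    using r less_imp_neq[OF \<omega>] m by (simp add: Lb_def power_divide field_simps del: of_nat_Suc)
  finally show ?thesis by (simp add: m p_def d_def)
qed

text \<open>By radial symmetry \<open>x\<close> may be moved to the ray through \<open>y\<close>,
  where \<open>norm (x + y) * norm (x - y)\<close> equals the difference of the squared norms. If
  \<open>y\<close> is close to the centre, \<open>ball_potential_near\<close> gives exactly this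
  product. Otherwise \<open>r\<close> is at most twice the sum of the norms and turns the Lipschitz
  bound into the same product. Both constants are rounded up to \<open>32 * 2 ^ n\<close>, which
  explains the exponent.\<close>

lemma ball_potential_difference:
  fixes x y :: "'a::euclidean_space"
  assumes xy: "norm x \<le> norm y"
  shows "ball_potential r x - ball_potential r y \<le> 2 ^ (DIM('a) + 5) * ((norm y)\<^sup>2 - (norm x)\<^sup>2)"
proof (cases "r > 0 \<and> y \<noteq> 0")
  case True
  then have r: "r > 0" and y: "norm y > 0" by auto
  let ?c = "2 ^ DIM('a) :: real"
  have c: "?c \<ge> 1" by simp
  define x' where "x' = (norm x / norm y) *\<^sub>R y"
  have x': "norm x' = norm x" using y by (simp add: x'_def)
  have diff: "norm (x' - y) = norm y - norm x"
  proof -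
    have "x' - y = (norm x / norm y - 1) *\<^sub>R y" by (simp add: x'_def scaleR_left_diff_distrib)
    then have "norm (x' - y) = \<bar>norm x / norm y - 1\<bar> * norm y" by simp
    also have "\<dots> = norm y - norm x" using y xy by (simp add: field_simps abs_if)
    finally show ?thesis .
  qed
  have sum: "norm (x' + y) = norm y + norm x"
  proof -
    have "x' + y = (norm x / norm y + 1) *\<^sub>R y" by (simp add: x'_def scaleR_left_distrib)
    then have "norm (x' + y) = \<bar>norm x / norm y + 1\<bar> * norm y" by simp
    also have "\<dots> = (norm x / norm y + 1) * norm y" by (simp add: abs_of_nonneg)
    also have "\<dots> = norm y + norm x" using y by (simp add: field_simps)
    finally show ?thesis .
  qed
  define S where "S = (norm y)\<^sup>2 - (norm x)\<^sup>2"
  have S: "S = (norm y + norm x) * (norm y - norm x)" by (simp add: S_def power2_eq_square algebra_simps)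
  have S0: "S \<ge> 0" using xy by (simp add: S)
  have "ball_potential r x' - ball_potential r y \<le> 32 * ?c * S"
  proof (cases "norm y \<le> r / 2")
    case True
    then have "ball_potential r x' - ball_potential r y \<le> ?c * norm (x' + y) * norm (x' - y)"
      using xy x' by (intro ball_potential_near[OF r]) auto
    also have "\<dots> = ?c * S" by (simp add: sum diff S mult.assoc)
    also have "\<dots> \<le> 32 * ?c * S" using S0 c by (intro mult_right_mono) auto
    finally show ?thesis .
  next
    case False
    then have r2: "r \<le> 2 * (norm y + norm x)" by (simp add: distrib_left add_increasing2)
    have "ball_potential r x' - ball_potential r y \<le> 2 * (2 * ?c + 1) * r * norm (x' - y)"
      using ball_potential_lipschitz[OF r, of x' y] by simp
    also have "\<dots> \<le> 2 * (2 * ?c + 1) * (2 * (norm y + norm x)) * norm (x' - y)"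
      using r2 c by (intro mult_right_mono mult_left_mono) auto
    also have "\<dots> = 4 * (2 * ?c + 1) * S" by (simp add: diff S algebra_simps)
    also have "\<dots> \<le> 32 * ?c * S"
    proof (rule mult_right_mono[OF _ S0])
      have "4 * (2 * k + 1) \<le> 32 * k" if "1 \<le> k" for k :: real using that by simp
      then show "4 * (2 * ?c + 1) \<le> 32 * ?c" using c .
    qed
    finally show ?thesis .
  qed
  then show ?thesis
    using ball_potential_norm_cong[OF x', of r] by (simp add: S_def power_add mult_ac)
next
  case False
  have "ball_potential r x - ball_potential r y = 0"
  proof (cases "r > 0")
    case True
    then show ?thesis using False xy by simp
  next
    case False
    then have "indicator (ball (0::'a) r) = (\<lambda>_. 0 :: real)" by (simp add: fun_eq_iff ball_empty)
    then show ?thesis by (simp add: ball_potential_def)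
  qed
  then show ?thesis using xy by (simp add: power_mono)
qed

section \<open>Bounded densities integrated against radial weights\<close>

lemma integrable_bounded_support:
  fixes u P :: "'a::euclidean_space \<Rightarrow> real"
  assumes [measurable]: "u \<in> borel_measurable borel" "P \<in> borel_measurable borel"
    and u: "\<And>x. \<bar>u x\<bar> \<le> M" "\<And>x. R < norm x \<Longrightarrow> u x = 0" and P: "\<And>x. norm x \<le> R \<Longrightarrow> \<bar>P x\<bar> \<le> \<kappa>"
  shows "integrable lborel (\<lambda>x. u x * P x)"
proof (rule Bochner_Integration.integrable_bound[where f="\<lambda>x. (M * \<kappa>) * indicator (cball 0 R) x"])
  show "integrable lborel (\<lambda>x::'a. (M * \<kappa>) * indicator (cball 0 R) x)"
    using emeasure_lborel_cball_finite[of "0::'a" R] by (intro integrable_mult_right integrable_real_indicator) auto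
  have "norm (u x * P x) \<le> norm ((M * \<kappa>) * indicator (cball 0 R) x)" for x
  proof (cases "norm x \<le> R")
    case True
    have "\<bar>u x\<bar> * \<bar>P x\<bar> \<le> \<bar>M\<bar> * \<bar>\<kappa>\<bar>"
      using u(1)[of x] P[OF True] by (intro mult_mono; linarith)
    then show ?thesis using True by (simp add: abs_mult)
  qed (simp add: u(2))
  then show "AE x in lborel. norm (u x * P x) \<le> norm ((M * \<kappa>) * indicator (cball 0 R) x)" by simp
qed measurable

lemma density_on_abs_le: "density_on R M f \<Longrightarrow> \<bar>f x\<bar> \<le> M"
  using density_onD(2,3)[of R M f x] by simp

lemma density_on_integrable_mult:
  assumes f: "density_on R M f" and "P \<in> borel_measurable borel" "\<And>x. norm x \<le> R \<Longrightarrow> \<bar>P x\<bar> \<le> \<kappa>"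
  shows "integrable lborel (\<lambda>x. f x * P x)"
  using assms density_onD(1,4)[OF f] density_on_abs_le[OF f] by (intro integrable_bounded_support) auto

lemma density_on_integrable: "density_on R M f \<Longrightarrow> integrable lborel f"
  using density_on_integrable_mult[of R M f "\<lambda>_. 1" 1] by simp

lemma equimeasurable_integral:
  assumes f: "density_on R M f" and g: "density_on R' M' g" and eq: "equimeasurable f g"
  shows "(\<integral>x. f x \<partial>lborel) = (\<integral>x. g x \<partial>lborel)"
  using equimeasurable_nn_integral[OF eq density_onD(1)[OF f] density_onD(1)[OF g]]
    density_onD(1,2)[OF f] density_onD(1,2)[OF g] by (simp add: integral_eq_nn_integral)

lemma radially_increasing_bounded:
  fixes G :: "'a::euclidean_space \<Rightarrow> real"
  assumes "\<And>x y. norm x \<le> norm y \<Longrightarrow> G x \<le> G y"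
  obtains p where "\<And>x. norm x \<le> R \<Longrightarrow> G x \<le> G p" "\<And>x. G 0 \<le> G x"
proof -
  obtain b :: 'a where b: "norm b = 1" using SOME_Basis norm_Basis by blast
  show ?thesis
    using that[of "\<bar>R\<bar> *\<^sub>R b"] assms b by fastforce
qed

lemma integrable_radially_increasing:
  assumes f: "density_on R M f" and [measurable]: "G \<in> borel_measurable borel"
    and G: "\<And>x y. norm x \<le> norm y \<Longrightarrow> G x \<le> G y"
  shows "integrable lborel (\<lambda>x. f x * G x)"
proof -
  obtain p where p: "\<And>x. norm x \<le> R \<Longrightarrow> G x \<le> G p" "\<And>x. G 0 \<le> G x"
    using radially_increasing_bounded[of G R] G by blast
  have "\<bar>G x\<bar> \<le> \<bar>G p\<bar> + \<bar>G 0\<bar>" if "norm x \<le> R" for x using p(1)[OF that] p(2)[of x] by linarith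
  then show ?thesis by (intro density_on_integrable_mult[OF f]) auto
qed

text \<open>Subtracting \<open>G\<close> from its value at a point \<open>p\<close> that dominates
  it on the support gives a decreasing weight, which truncation at 0 makes nonnegative everywhere.
  The constant \<open>G p\<close> contributes equally on both sides because the masses
  agree.\<close>

lemma integral_radially_increasing_le:
  fixes f g :: "'a::euclidean_space \<Rightarrow> real"
  assumes f: "density_on R M f" and g: "density_on R M g" and rad: "radially_decreasing g"
    and eq: "equimeasurable f g" and R: "R > 0" and M: "M > 0"
    and [measurable]: "G \<in> borel_measurable borel" and G: "\<And>x y. norm x \<le> norm y \<Longrightarrow> G x \<le> G y"
  shows "(\<integral>x. g x * G x \<partial>lborel) \<le> (\<integral>x. f x * G x \<partial>lborel)"
proof -
  obtain p where p: "\<And>x. norm x \<le> R \<Longrightarrow> G x \<le> G p" "\<And>x. G 0 \<le> G x"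
    using radially_increasing_bounded[of G R] G by blast
  define k where "k x = max 0 (G p - G x)" for x
  have [measurable]: "k \<in> borel_measurable borel" unfolding k_def[abs_def] by measurable
  have k1: "radially_decreasing k"
    using G unfolding radially_decreasing_def k_def by (intro allI impI max.mono diff_left_mono) auto
  have k: "0 \<le> k x" "k x \<le> max 0 (G p - G 0)" for x
    unfolding k_def by (rule max.cobounded1) (intro max.mono diff_left_mono order_refl p(2))
  have kint: "(\<integral>\<^sup>+x. ennreal (u x * k x) \<partial>lborel) = ennreal (G p * (\<integral>x. u x \<partial>lborel) - (\<integral>x. u x * G x \<partial>lborel))"
    and knn: "0 \<le> G p * (\<integral>x. u x \<partial>lborel) - (\<integral>x. u x * G x \<partial>lborel)"
    if u: "density_on R M u" for u
  proof -
    have eq: "u x * k x = G p * u x - u x * G x" for x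
      using p(1)[of x] density_onD(4)[OF u, of x] by (cases "norm x \<le> R") (auto simp: k_def algebra_simps)
    have int: "integrable lborel (\<lambda>x. G p * u x)" "integrable lborel (\<lambda>x. u x * G x)"
      using density_on_integrable[OF u] integrable_radially_increasing[OF u _ G] by simp_all
    have I: "(\<integral>x. u x * k x \<partial>lborel) = G p * (\<integral>x. u x \<partial>lborel) - (\<integral>x. u x * G x \<partial>lborel)"
      unfolding eq using int by simp
    have "integrable lborel (\<lambda>x. u x * k x)" unfolding eq using int by simp
    then show "(\<integral>\<^sup>+x. ennreal (u x * k x) \<partial>lborel) = ennreal (G p * (\<integral>x. u x \<partial>lborel) - (\<integral>x. u x * G x \<partial>lborel))"
      unfolding I[symmetric] using k(1) density_onD(2)[OF u] by (intro nn_integral_eq_integral) auto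
    show "0 \<le> G p * (\<integral>x. u x \<partial>lborel) - (\<integral>x. u x * G x \<partial>lborel)"
      unfolding I[symmetric] using k(1) density_onD(2)[OF u] by (intro integral_nonneg_AE) auto
  qed
  have "ennreal (G p * (\<integral>x. f x \<partial>lborel) - (\<integral>x. f x * G x \<partial>lborel))
    \<le> ennreal (G p * (\<integral>x. g x \<partial>lborel) - (\<integral>x. g x * G x \<partial>lborel))"
    unfolding kint[OF f, symmetric] kint[OF g, symmetric]
    by (rule nn_integral_radial_weight_le[OF f g rad eq R M _ k1 k]) measurable
  then show ?thesis
    using knn[OF g] equimeasurable_integral[OF f g eq] by (simp add: ennreal_le_iff)
qed

section \<open>The energy as a bilinear form\<close>

definition potential :: "('a::euclidean_space \<Rightarrow> real) \<Rightarrow> 'a \<Rightarrow> real" where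
  "potential u y = (\<integral>x. u x * newtonian (x - y) \<partial>lborel)"

definition energy_form :: "('a::euclidean_space \<Rightarrow> real) \<Rightarrow> ('a \<Rightarrow> real) \<Rightarrow> real" where
  "energy_form u v = (\<integral>y. v y * potential u y \<partial>lborel)"

lemma potential_measurable[measurable]:
  assumes [measurable]: "u \<in> borel_measurable borel"
  shows "potential u \<in> borel_measurable borel"
  unfolding potential_def[abs_def] by measurable

lemma density_on_newtonian_integrable:
  assumes u: "density_on R M u"
  shows "integrable lborel (\<lambda>x. u x * newtonian (x - y))"
  using density_onD(1,4)[OF u] density_on_abs_le[OF u] by (intro integrable_shifted_newtonian) auto

text \<open>The bound with the absolute value inside the integral provides the integrability on the
  product space that Fubini needs for the symmetry of \<open>energy_form\<close>.\<close>

lemma potential_bounded: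
  assumes u: "density_on R M u"
  obtains \<kappa> where "\<And>y. norm y \<le> L \<Longrightarrow> (\<integral>x. \<bar>u x * newtonian (x - y)\<bar> \<partial>lborel) \<le> \<kappa>"
    "\<And>y. norm y \<le> L \<Longrightarrow> \<bar>potential u y\<bar> \<le> \<kappa>"
proof -
  define k where "k = ennreal M * (\<integral>\<^sup>+x. indicator (cball (0::'a) (R + L)) x * ennreal \<bar>newtonian x\<bar> \<partial>lborel)"
  have k: "k < \<infinity>" using nn_integral_newtonian_finite[where 'a='a] by (simp add: k_def ennreal_mult_less_top)
  have *: "(\<integral>x. \<bar>u x * newtonian (x - y)\<bar> \<partial>lborel) \<le> enn2real k" if y: "norm y \<le> L" for y
  proof -
    have "ennreal (\<integral>x. \<bar>u x * newtonian (x - y)\<bar> \<partial>lborel) = (\<integral>\<^sup>+x. ennreal \<bar>u x * newtonian (x - y)\<bar> \<partial>lborel)"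
      by (intro nn_integral_eq_integral[symmetric] integrable_abs density_on_newtonian_integrable[OF u]) auto
    also have "\<dots> \<le> k"
      unfolding k_def using density_onD(1,4)[OF u] density_on_abs_le[OF u] y
      by (intro nn_integral_shifted_newtonian_le) auto
    finally have "ennreal (\<integral>x. \<bar>u x * newtonian (x - y)\<bar> \<partial>lborel) \<le> ennreal (enn2real k)" using k by simp
    then show ?thesis by (simp only: ennreal_le_iff[OF enn2real_nonneg])
  qed
  have "\<bar>potential u y\<bar> \<le> enn2real k" if "norm y \<le> L" for y
    unfolding potential_def using integral_abs_bound *[OF that] by (rule order_trans)
  with * show ?thesis using that by blast
qed

lemma potential_mult_integrable:
  assumes u: "density_on R M u" and v: "density_on L M' v"
  shows "integrable lborel (\<lambda>y. v y * potential u y)"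
proof -
  obtain \<kappa> where "\<And>y. norm y \<le> L \<Longrightarrow> \<bar>potential u y\<bar> \<le> \<kappa>" using potential_bounded[OF u] by metis
  then show ?thesis
    using density_onD(1)[OF u] by (intro density_on_integrable_mult[OF v]) auto
qed

lemma energy_form_commute:
  fixes u v :: "'a::euclidean_space \<Rightarrow> real"
  assumes u: "density_on R M u" and v: "density_on L M' v"
  shows "energy_form u v = energy_form v u"
proof -
  note [measurable] = density_onD(1)[OF u] density_onD(1)[OF v]
  let ?f = "\<lambda>(x, y). u x * v y * newtonian (x - y)"
  obtain \<kappa> where \<kappa>: "\<And>x. norm x \<le> R \<Longrightarrow> (\<integral>y. \<bar>v y * newtonian (y - x)\<bar> \<partial>lborel) \<le> \<kappa>"
    using potential_bounded[OF v] by metis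
  have sym: "newtonian (x - y) = newtonian (y - x)" for x y :: 'a
    by (rule newtonian_norm_cong) (rule norm_minus_commute)
  have int: "integrable (lborel \<Otimes>\<^sub>M lborel) ?f"
  proof (rule lborel_pair.Fubini_integrable)
    have "(\<integral>y. norm (?f (x, y)) \<partial>lborel) = u x * (\<integral>y. \<bar>v y * newtonian (y - x)\<bar> \<partial>lborel)" for x
      using density_onD(2)[OF u, of x] by (simp add: abs_mult mult.assoc sym)
    moreover have "integrable lborel (\<lambda>x. u x * (\<integral>y. \<bar>v y * newtonian (y - x)\<bar> \<partial>lborel))"
      using \<kappa> by (intro density_on_integrable_mult[OF u, where \<kappa>=\<kappa>]) auto
    ultimately show "integrable lborel (\<lambda>x. \<integral>y. norm (?f (x, y)) \<partial>lborel)" by simp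
    show "AE x in lborel. integrable lborel (\<lambda>y. ?f (x, y))"
      using density_on_newtonian_integrable[OF v] by (simp add: mult.assoc sym)
  qed measurable
  have "energy_form u v = (\<integral>y. \<integral>x. ?f (x, y) \<partial>lborel \<partial>lborel)"
    unfolding energy_form_def potential_def
    by (intro Bochner_Integration.integral_cong refl, subst integral_mult_right_zero[symmetric])
      (intro Bochner_Integration.integral_cong refl, simp)
  also have "\<dots> = (\<integral>x. \<integral>y. ?f (x, y) \<partial>lborel \<partial>lborel)"
    using lborel_pair.Fubini_integral[OF int] by simp
  also have "\<dots> = energy_form v u"
  proof -
    have "(\<integral>y. ?f (x, y) \<partial>lborel) = u x * potential v x" for x
      by (simp add: potential_def mult.assoc sym)
    then show ?thesis by (simp add: energy_form_def)
  qed
  finally show ?thesis .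
qed

text \<open>Layer by layer, the potential of \<open>g\<close> is an integral of potentials of
  centred balls over the heights from 0 to \<open>M\<close>. Each ball contributes at most
  \<open>2 ^ (n + 5)\<close> times the difference of the squared norms, whatever its radius, and the
  number of heights gives the factor \<open>M\<close>.\<close>

lemma potential_plus_square_increasing:
  fixes g :: "'a::euclidean_space \<Rightarrow> real"
  assumes g: "density_on R M g" and balls: "\<And>h. h \<ge> 0 \<Longrightarrow> \<exists>r\<ge>0. {x. h < g x} = ball 0 r"
    and xy: "norm x \<le> norm y"
  shows "potential g x + 2 ^ (DIM('a) + 5) * M * (norm x)\<^sup>2 \<le> potential g y + 2 ^ (DIM('a) + 5) * M * (norm y)\<^sup>2"
proof -
  note [measurable] = density_onD(1)[OF g]
  define S where "S = 2 ^ (DIM('a) + 5) * ((norm y)\<^sup>2 - (norm x)\<^sup>2)"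
  have S: "S \<ge> 0" using xy by (simp add: S_def power_mono)
  have M: "M \<ge> 0" using density_on_nonneg[OF g, of 0] density_on_le[OF g, of 0] by linarith
  define D where "D z = newtonian (z - x) - newtonian (z - y)" for z
  have [measurable]: "D \<in> borel_measurable borel" unfolding D_def[abs_def] by measurable
  have gD: "integrable lborel (\<lambda>z. g z * D z)"
    unfolding D_def right_diff_distrib by (intro Bochner_Integration.integrable_diff density_on_newtonian_integrable[OF g])
  let ?f = "\<lambda>(z, h). indicator {0..<g z} h * D z"
  have layer: "(\<integral>h. indicator {0..<g z} h * c \<partial>lborel) = g z * c" "integrable lborel (\<lambda>h. indicator {0..<g z} h * c)" for z and c :: real
    using density_onD(2)[OF g, of z] by simp_all
  have int: "integrable (lborel \<Otimes>\<^sub>M lborel) ?f"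
  proof (rule lborel_pair.Fubini_integrable)
    have "?f = (\<lambda>p. (if 0 \<le> snd p \<and> snd p < g (fst p) then 1 else 0) * D (fst p))"
      by (auto simp: fun_eq_iff indicator_def)
    then show "?f \<in> borel_measurable (lborel \<Otimes>\<^sub>M lborel)" by simp
    have "(\<integral>h. norm (?f (z, h)) \<partial>lborel) = \<bar>g z * D z\<bar>" for z
      using layer(1)[of z "\<bar>D z\<bar>"] density_onD(2)[OF g, of z] by (simp add: abs_mult)
    then show "integrable lborel (\<lambda>z. \<integral>h. norm (?f (z, h)) \<partial>lborel)" using gD by simp
    show "AE z in lborel. integrable lborel (\<lambda>h. ?f (z, h))" using layer(2) by simp
  qed
  have slice: "(\<integral>z. ?f (z, h) \<partial>lborel) \<le> S * indicator {0..<M} h" for h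
  proof (cases "0 \<le> h \<and> h < M")
    case True
    then obtain r where r: "{x. h < g x} = ball 0 r" using balls by blast
    have "(\<integral>z. ?f (z, h) \<partial>lborel) = (\<integral>z. indicator (ball 0 r) z * newtonian (z - x) - indicator (ball 0 r) z * newtonian (z - y) \<partial>lborel)"
      using True by (intro Bochner_Integration.integral_cong) (auto simp: r[symmetric] indicator_def D_def)
    also have "\<dots> = ball_potential r x - ball_potential r y"
      unfolding ball_potential_def by (intro Bochner_Integration.integral_diff ball_potential_integrable)
    also have "\<dots> \<le> S" unfolding S_def by (rule ball_potential_difference[OF xy])
    finally show ?thesis using True by simp
  next
    case False
    then have "?f (z, h) = 0" for z using density_onD(3)[OF g, of z] by (auto simp: indicator_def)
    then have "(\<integral>z. ?f (z, h) \<partial>lborel) = 0" by (simp only: Bochner_Integration.integral_zero)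
    then show ?thesis using S by (simp add: indicator_def)
  qed
  have "potential g x - potential g y = (\<integral>z. g z * D z \<partial>lborel)"
    unfolding potential_def D_def right_diff_distrib
    by (intro Bochner_Integration.integral_diff[symmetric] density_on_newtonian_integrable[OF g])
  also have "\<dots> = (\<integral>z. \<integral>h. ?f (z, h) \<partial>lborel \<partial>lborel)"
    by (simp only: prod.case layer(1))
  also have "\<dots> = (\<integral>h. \<integral>z. ?f (z, h) \<partial>lborel \<partial>lborel)"
    using lborel_pair.Fubini_integral[OF int] by simp
  also have "\<dots> \<le> (\<integral>h. S * indicator {0..<M} h \<partial>lborel)"
  proof (rule integral_mono[OF _ _ slice])
    show "integrable lborel (\<lambda>h. \<integral>z. ?f (z, h) \<partial>lborel)"
      using lborel_pair.integrable_snd[OF int] by simp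
    have "integrable lborel (indicator {0..<M} :: real \<Rightarrow> real)"
      using M by (intro integrable_real_indicator) auto
    then show "integrable lborel (\<lambda>h. S * indicator {0..<M} h)" by simp
  qed
  also have "\<dots> = S * M" using M by simp
  finally show ?thesis by (simp add: S_def algebra_simps)
qed

lemma energy_form_diff:
  fixes u v :: "'a::euclidean_space \<Rightarrow> real"
  assumes u: "density_on R M u" and v: "density_on L M' v"
  shows "(\<integral>y. \<integral>x. (u x - v x) * (u y - v y) * newtonian (x - y) \<partial>lborel \<partial>lborel)
    = energy_form u u - 2 * energy_form v u + energy_form v v"
proof -
  have inner: "(\<integral>x. (u x - v x) * (u y - v y) * newtonian (x - y) \<partial>lborel) = (u y - v y) * (potential u y - potential v y)" for y
  proof -
    have "(\<integral>x. (u x - v x) * (u y - v y) * newtonian (x - y) \<partial>lborel)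
      = (\<integral>x. (u y - v y) * (u x * newtonian (x - y) - v x * newtonian (x - y)) \<partial>lborel)"
      by (intro Bochner_Integration.integral_cong) (simp_all add: algebra_simps)
    also have "\<dots> = (u y - v y) * (potential u y - potential v y)"
      using density_on_newtonian_integrable[OF u] density_on_newtonian_integrable[OF v]
      by (simp add: potential_def)
    finally show ?thesis .
  qed
  have "(\<integral>y. \<integral>x. (u x - v x) * (u y - v y) * newtonian (x - y) \<partial>lborel \<partial>lborel)
    = (\<integral>y. (u y * potential u y - u y * potential v y) - (v y * potential u y - v y * potential v y) \<partial>lborel)"
    unfolding inner by (intro Bochner_Integration.integral_cong) (simp_all add: algebra_simps)
  also have "\<dots> = (energy_form u u - energy_form v u) - (energy_form u v - energy_form v v)"
    unfolding energy_form_def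
    using potential_mult_integrable[OF u u] potential_mult_integrable[OF u v]
      potential_mult_integrable[OF v u] potential_mult_integrable[OF v v] by simp
  finally show ?thesis using energy_form_commute[OF u v] by simp
qed

section \<open>Stability of the Newtonian energy\<close>

definition mass :: "('a::euclidean_space \<Rightarrow> real) \<Rightarrow> real" where
  "mass f = (\<integral>x. f x \<partial>lborel)"

definition first_moment :: "('a::euclidean_space \<Rightarrow> real) \<Rightarrow> 'a" where
  "first_moment f = (\<integral>x. f x *\<^sub>R x \<partial>lborel)"

definition second_moment :: "('a::euclidean_space \<Rightarrow> real) \<Rightarrow> real" where
  "second_moment f = (\<integral>x. f x * (norm x)\<^sup>2 \<partial>lborel)"

lemma density_on_moments_integrable:
  assumes f: "density_on R M f"
  shows first_moment_integrable: "integrable lborel (\<lambda>x. f x *\<^sub>R x)"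
    and second_moment_integrable: "integrable lborel (\<lambda>x. f x * (norm x)\<^sup>2)"
proof -
  note [measurable] = density_onD(1)[OF f]
  have "integrable lborel (\<lambda>x. f x * norm x)"
    by (rule density_on_integrable_mult[OF f, where \<kappa>=R]) auto
  then show "integrable lborel (\<lambda>x. f x *\<^sub>R x)"
    by (rule Bochner_Integration.integrable_bound) (auto simp: abs_mult)
  have "\<bar>(norm x)\<^sup>2\<bar> \<le> \<bar>R\<bar>\<^sup>2" if "norm x \<le> R" for x :: 'a
    using that by (simp add: abs_le_square_iff[symmetric])
  then show "integrable lborel (\<lambda>x. f x * (norm x)\<^sup>2)"
    by (intro density_on_integrable_mult[OF f]) auto
qed

lemma first_moment_inner:
  assumes f: "density_on R M f"
  shows "integrable lborel (\<lambda>x. f x * (x \<bullet> y))" and "(\<integral>x. f x * (x \<bullet> y) \<partial>lborel) = first_moment f \<bullet> y"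
proof -
  have "integrable lborel (\<lambda>x. (f x *\<^sub>R x) \<bullet> y)"
    by (intro integrable_inner_left first_moment_integrable[OF f])
  moreover have "(\<integral>x. (f x *\<^sub>R x) \<bullet> y \<partial>lborel) = first_moment f \<bullet> y"
    unfolding first_moment_def by (intro integral_inner_left first_moment_integrable[OF f])
  ultimately show "integrable lborel (\<lambda>x. f x * (x \<bullet> y))" and "(\<integral>x. f x * (x \<bullet> y) \<partial>lborel) = first_moment f \<bullet> y"
    by simp_all
qed

lemma integral_dist_square:
  assumes f: "density_on R M f"
  shows "integrable lborel (\<lambda>x. f x * (norm (x - y))\<^sup>2)"
    and "(\<integral>x. f x * (norm (x - y))\<^sup>2 \<partial>lborel) = second_moment f - 2 * (first_moment f \<bullet> y) + mass f * (norm y)\<^sup>2"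
proof -
  have eq: "f x * (norm (x - y))\<^sup>2 = f x * (norm x)\<^sup>2 - 2 * (f x * (x \<bullet> y)) + f x * (norm y)\<^sup>2" for x
    by (simp add: power2_norm_eq_inner algebra_simps inner_commute)
  note int = second_moment_integrable[OF f] first_moment_inner(1)[OF f] density_on_integrable[OF f]
  show "integrable lborel (\<lambda>x. f x * (norm (x - y))\<^sup>2)"
    unfolding eq using int by simp
  show "(\<integral>x. f x * (norm (x - y))\<^sup>2 \<partial>lborel) = second_moment f - 2 * (first_moment f \<bullet> y) + mass f * (norm y)\<^sup>2"
    unfolding eq using int by (simp add: second_moment_def mass_def first_moment_inner(2)[OF f])
qed

text \<open>Within distance \<open>2 * R\<close> the kernel stays decreasing after adding \<open>c * (norm x)\<^sup>2\<close>; subtracting the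
  boundary value makes it nonnegative and allows cutting it off. The junk value at the origin is
  replaced by \<open>top\<close>.\<close>

definition square_gap :: "real \<Rightarrow> 'a::euclidean_space itself \<Rightarrow> real" where
  "square_gap R _ = 1 / (2 * sphere_area TYPE('a) * (2 * R) ^ DIM('a))"

lemma corrected_kernel:
  fixes R :: real
  assumes R: "R > 0"
  defines "c \<equiv> square_gap R TYPE('a::euclidean_space)"
  obtains A and K :: "'a::euclidean_space \<Rightarrow> ennreal" where "K \<in> borel_measurable borel" "radially_decreasing K"
    "(\<integral>\<^sup>+x. indicator (cball 0 (2 * R)) x * K x \<partial>lborel) < \<infinity>"
    "\<And>x. x \<noteq> 0 \<Longrightarrow> norm x \<le> 2 * R \<Longrightarrow> K x = ennreal (newtonian x + c * (norm x)\<^sup>2 - A)"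
    "\<And>x::'a. x \<noteq> 0 \<Longrightarrow> norm x \<le> 2 * R \<Longrightarrow> 0 \<le> newtonian x + c * (norm x)\<^sup>2 - A"
proof -
  obtain b :: 'a where b: "norm b = 1" using SOME_Basis norm_Basis by blast
  define p where "p = (2 * R) *\<^sub>R b"
  have p: "norm p = 2 * R" using R b by (simp add: p_def)
  define N where "N x = newtonian x + c * (norm x)\<^sup>2" for x :: 'a
  define A where "A = N p"
  define K :: "'a \<Rightarrow> ennreal" where
    "K x = (if x = 0 then top else if norm x \<le> 2 * R then ennreal (N x - A) else 0)" for x
  have c: "c \<ge> 0" using R by (simp add: c_def square_gap_def)
  have mono: "N y \<le> N x" if "x \<noteq> 0" "norm x \<le> norm y" "norm y \<le> 2 * R" for x y
    using newtonian_plus_square_decreasing[of x y "2 * R"] that by (simp add: N_def c_def square_gap_def)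
  have nonneg: "0 \<le> N x - A" if "x \<noteq> 0" "norm x \<le> 2 * R" for x
    using mono[of x p] that p by (simp add: A_def)
  have [measurable]: "N \<in> borel_measurable borel" unfolding N_def[abs_def] by measurable
  have K_meas[measurable]: "K \<in> borel_measurable borel" unfolding K_def[abs_def] by measurable
  have rad: "radially_decreasing K"
    unfolding radially_decreasing_def
  proof (intro allI impI)
    fix x y :: 'a assume xy: "norm x \<le> norm y"
    show "K y \<le> K x"
    proof (cases "x = 0 \<or> 2 * R < norm y")
      case True
      then show ?thesis using R by (auto simp: K_def)
    next
      case False
      then have "N y \<le> N x" using xy by (intro mono) auto
      then show ?thesis using False xy by (auto simp: K_def intro: ennreal_leI)
    qed
  qed
  have fin: "(\<integral>\<^sup>+x. indicator (cball 0 (2 * R)) x * K x \<partial>lborel) < \<infinity>"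
  proof -
    let ?B = "c * (2 * R)\<^sup>2 + \<bar>A\<bar>"
    have "(\<integral>\<^sup>+x. indicator (cball 0 (2 * R)) x * K x \<partial>lborel)
      \<le> (\<integral>\<^sup>+x. indicator (cball 0 (2 * R)) x * ennreal \<bar>newtonian x\<bar> + ennreal ?B * indicator (cball (0::'a) (2 * R)) x \<partial>lborel)"
    proof (rule nn_integral_mono_AE)
      have "indicator (cball 0 (2 * R)) x * K x
        \<le> indicator (cball 0 (2 * R)) x * ennreal \<bar>newtonian x\<bar> + ennreal ?B * indicator (cball 0 (2 * R)) x" if "x \<noteq> 0" for x
      proof (cases "norm x \<le> 2 * R")
        case True
        have "c * (norm x)\<^sup>2 \<le> c * (2 * R)\<^sup>2" using True c by (intro mult_left_mono power_mono) auto
        then have "N x - A \<le> \<bar>newtonian x\<bar> + ?B" by (simp add: N_def)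
        then have "ennreal (N x - A) \<le> ennreal (\<bar>newtonian x\<bar> + ?B)" by (rule ennreal_leI)
        also have "\<dots> = ennreal \<bar>newtonian x\<bar> + ennreal ?B" using c by (intro ennreal_plus) auto
        finally show ?thesis using True that by (simp add: K_def)
      qed simp
      then show "AE x in lborel. indicator (cball 0 (2 * R)) x * K x
        \<le> indicator (cball 0 (2 * R)) x * ennreal \<bar>newtonian x\<bar> + ennreal ?B * indicator (cball 0 (2 * R)) x"
        using AE_lborel_singleton[of "0::'a"] by auto
    qed
    also have "\<dots> = (\<integral>\<^sup>+x. indicator (cball 0 (2 * R)) x * ennreal \<bar>newtonian (x::'a)\<bar> \<partial>lborel) + ennreal ?B * emeasure lborel (cball (0::'a) (2 * R))"
      by (subst nn_integral_add) (auto simp: nn_integral_cmult_indicator)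
    also have "\<dots> < \<infinity>"
      using nn_integral_newtonian_finite[where 'a='a] emeasure_lborel_cball_finite[of "0::'a" "2 * R"]
      by (simp add: ennreal_mult_less_top less_top)
    finally show ?thesis .
  qed
  show ?thesis
    using that[OF K_meas rad fin, of A] nonneg by (simp add: K_def N_def)
qed

text \<open>Differences of support points have norm at most \<open>2 * R\<close> and the diagonal is
  a null set, so \<open>K\<close> may be replaced by the explicit expression. Expanding the squared
  distance leaves only mass, first and second moment. The claim \<open>0 \<le> J\<close> is what
  later allows an inequality in \<open>ennreal\<close> to be read in the reals.\<close>

lemma nn_energy_corrected_kernel:
  fixes f :: "'a::euclidean_space \<Rightarrow> real" and K :: "'a \<Rightarrow> ennreal" and c A R :: real
  assumes f: "density_on R M f"
    and K[measurable]: "K \<in> borel_measurable borel"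
    and K_eq: "\<And>x. x \<noteq> 0 \<Longrightarrow> norm x \<le> 2 * R \<Longrightarrow> K x = ennreal (newtonian x + c * (norm x)\<^sup>2 - A)"
    and K_nonneg: "\<And>x::'a. x \<noteq> 0 \<Longrightarrow> norm x \<le> 2 * R \<Longrightarrow> 0 \<le> newtonian x + c * (norm x)\<^sup>2 - A"
  defines "J \<equiv> energy_form f f + c * (2 * mass f * second_moment f - 2 * (norm (first_moment f))\<^sup>2) - A * (mass f)\<^sup>2"
  shows "nn_energy K f = ennreal J" and "0 \<le> J"
proof -
  note [measurable] = density_onD(1)[OF f]
  have nonneg: "0 \<le> f x" for x by (rule density_onD(2)[OF f])
  let ?k = "\<lambda>x y. f x * f y * (newtonian (x - y) + c * (norm (x - y))\<^sup>2 - A)"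
  have supp: "f x = 0 \<or> f y = 0 \<or> norm (x - y) \<le> 2 * R" for x y
    using density_onD(4)[OF f, of x] density_onD(4)[OF f, of y] norm_triangle_ineq4[of x y] by linarith
  have k_nonneg: "0 \<le> ?k x y" if "x \<noteq> y" for x y
    using supp[of x y] K_nonneg[of "x - y"] that nonneg by auto
  have k_eq: "ennreal (f x * f y) * K (x - y) = ennreal (?k x y)" if "x \<noteq> y" for x y
    using supp[of x y] K_eq[of "x - y"] K_nonneg[of "x - y"] that nonneg by (auto simp: ennreal_mult)
  \<comment> \<open>The inner integral over \<open>x\<close>, with the factor \<open>f y\<close>
    taken out.\<close>
  define P where "P y = potential f y + c * (second_moment f - 2 * (first_moment f \<bullet> y) + mass f * (norm y)\<^sup>2) - A * mass f" for y
  have split: "?k x y = f y * (f x * newtonian (x - y) + c * (f x * (norm (x - y))\<^sup>2) - A * f x)" for x y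
    by (simp add: algebra_simps)
  have int_in: "integrable lborel (\<lambda>x. ?k x y)" for y
    unfolding split using density_on_newtonian_integrable[OF f] integral_dist_square(1)[OF f] density_on_integrable[OF f] by simp
  have val_in: "(\<integral>x. ?k x y \<partial>lborel) = f y * P y" for y
    unfolding split using density_on_newtonian_integrable[OF f] integral_dist_square[OF f] density_on_integrable[OF f]
    by (simp add: P_def potential_def mass_def)
  have nn_in: "(\<integral>\<^sup>+x. ennreal (f x * f y) * K (x - y) \<partial>lborel) = ennreal (f y * P y)" for y
  proof -
    have "(\<integral>\<^sup>+x. ennreal (f x * f y) * K (x - y) \<partial>lborel) = (\<integral>\<^sup>+x. ennreal (?k x y) \<partial>lborel)"
      using AE_lborel_singleton[of y] k_eq by (intro nn_integral_cong_AE) auto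
    also have "\<dots> = ennreal (\<integral>x. ?k x y \<partial>lborel)"
      using AE_lborel_singleton[of y] k_nonneg by (intro nn_integral_eq_integral int_in) auto
    finally show ?thesis by (simp only: val_in)
  qed
  have P_nonneg: "0 \<le> f y * P y" for y
    unfolding val_in[symmetric] using AE_lborel_singleton[of y] k_nonneg by (intro integral_nonneg_AE) auto
  have fP: "f y * P y = f y * potential f y + (c * (second_moment f * f y - 2 * (f y * (y \<bullet> first_moment f)) + mass f * (f y * (norm y)\<^sup>2)) - A * mass f * f y)" for y
    by (simp add: P_def algebra_simps inner_commute)
  note ints = potential_mult_integrable[OF f f] density_on_integrable[OF f] first_moment_inner(1)[OF f] second_moment_integrable[OF f]
  have int_out: "integrable lborel (\<lambda>y. f y * P y)"
    unfolding fP using ints by simp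
  have "(\<integral>y. f y * P y \<partial>lborel) = energy_form f f + (c * (second_moment f * mass f - 2 * (first_moment f \<bullet> first_moment f) + mass f * second_moment f) - A * mass f * mass f)"
    unfolding fP using ints by (simp add: energy_form_def mass_def second_moment_def first_moment_inner(2)[OF f])
  also have "\<dots> = J"
    by (simp add: J_def power2_norm_eq_inner power2_eq_square[of "mass f"] algebra_simps)
  finally have J: "(\<integral>y. f y * P y \<partial>lborel) = J" .
  show "0 \<le> J" unfolding J[symmetric] using P_nonneg by (intro integral_nonneg_AE) auto
  show "nn_energy K f = ennreal J"
    unfolding nn_energy_def nn_in J[symmetric] using P_nonneg by (intro nn_integral_eq_integral int_out) auto
qed

text \<open>Riesz' inequality for the corrected kernel. The terms with the boundary value
  \<open>A\<close> cancel because the masses agree, and what is left is the second moment of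
  \<open>f\<close> about its centre of mass against that of \<open>g\<close>.\<close>

lemma energy_gap_ge_moments:
  fixes f g :: "'a::euclidean_space \<Rightarrow> real"
  assumes f: "density_on R M f" and g: "density_on R M g" and rad: "radially_decreasing g"
    and eq: "equimeasurable f g" and R: "R > 0" and M: "M > 0" and m: "mass f > 0"
  shows "2 * square_gap R TYPE('a) * mass f * (second_moment f - (norm (first_moment f))\<^sup>2 / mass f - second_moment g)
    \<le> energy_form g g - energy_form f f"
proof -
  let ?c = "square_gap R TYPE('a)"
  have c: "?c \<ge> 0" using R by (simp add: square_gap_def)
  obtain A and K :: "'a \<Rightarrow> ennreal" where K: "K \<in> borel_measurable borel" "radially_decreasing K"
    "(\<integral>\<^sup>+x. indicator (cball 0 (2 * R)) x * K x \<partial>lborel) < \<infinity>"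
    "\<And>x. x \<noteq> 0 \<Longrightarrow> norm x \<le> 2 * R \<Longrightarrow> K x = ennreal (newtonian x + ?c * (norm x)\<^sup>2 - A)"
    "\<And>x::'a. x \<noteq> 0 \<Longrightarrow> norm x \<le> 2 * R \<Longrightarrow> 0 \<le> newtonian x + ?c * (norm x)\<^sup>2 - A"
    by (rule corrected_kernel[OF R, where 'a='a]) (rule that; assumption)
  have mg: "mass g = mass f" unfolding mass_def by (rule equimeasurable_integral[OF f g eq, symmetric])
  define J where "J u = energy_form u u + ?c * (2 * mass u * second_moment u - 2 * (norm (first_moment u))\<^sup>2) - A * (mass u)\<^sup>2"
    for u :: "'a \<Rightarrow> real"
  have J: "nn_energy K u = ennreal (J u)" "0 \<le> J u" if u: "density_on R M u" for u
    unfolding J_def by (rule nn_energy_corrected_kernel[OF u K(1)]; erule (1) K(4,5))+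
  have "ennreal (J f) \<le> ennreal (J g)"
    unfolding J(1)[OF f, symmetric] J(1)[OF g, symmetric] by (rule riesz_rearrangement[OF f g rad eq R M K(1-3)])
  then have "J f \<le> J g" using J(2)[OF g] by (simp only: ennreal_le_iff)
  then have "energy_form f f + ?c * (2 * mass f * second_moment f - 2 * (norm (first_moment f))\<^sup>2) - A * (mass f)\<^sup>2
    \<le> energy_form g g + ?c * (2 * mass g * second_moment g - 2 * (norm (first_moment g))\<^sup>2) - A * (mass g)\<^sup>2"
    by (simp only: J_def)
  \<comment> \<open>The first moment of \<open>g\<close> enters with a favourable sign and is
    dropped.\<close>
  moreover have "?c * (2 * mass g * second_moment g - 2 * (norm (first_moment g))\<^sup>2) \<le> ?c * (2 * mass f * second_moment g)"
    using c by (intro mult_left_mono) (simp_all add: mg)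
  ultimately have "?c * (2 * mass f * second_moment f - 2 * (norm (first_moment f))\<^sup>2) - ?c * (2 * mass f * second_moment g)
    \<le> energy_form g g - energy_form f f" unfolding mg by linarith
  moreover have "?c * (2 * mass f * second_moment f - 2 * (norm (first_moment f))\<^sup>2) - ?c * (2 * mass f * second_moment g)
    = 2 * ?c * mass f * (second_moment f - (norm (first_moment f))\<^sup>2 / mass f - second_moment g)"
    using m by (simp add: field_simps)
  ultimately show ?thesis by simp
qed

section \<open>Translation to the centre of mass\<close>

lemma density_on_mono: "density_on R M f \<Longrightarrow> R \<le> R' \<Longrightarrow> density_on R' M f"
  by (auto simp: density_on_def)

lemma translate_density_on:
  assumes f: "density_on R M f" and a: "norm a \<le> R"
  shows "density_on (2 * R) M (translate a f)"
  unfolding density_on_def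
proof (intro conjI allI impI)
  note [measurable] = density_onD(1)[OF f]
  show "translate a f \<in> borel_measurable borel" unfolding translate_def by measurable
  fix x
  show "0 \<le> translate a f x" "translate a f x \<le> M"
    using density_onD(2,3)[OF f] by (auto simp: translate_def)
  assume "2 * R < norm x"
  then have "R < norm (x + a)" using a norm_triangle_ineq4[of "x + a" a] by simp
  then show "translate a f x = 0" using density_onD(4)[OF f] by (simp add: translate_def)
qed

lemma translate_equimeasurable:
  assumes [measurable]: "f \<in> borel_measurable borel"
  shows "equimeasurable f (translate a f)"
  unfolding equimeasurable_def
proof
  fix h
  have "emeasure lborel {x. h < f x} = (\<integral>\<^sup>+x. indicator {x. h < f x} (a + x) \<partial>lborel)"
    by (subst nn_integral_lborel_translate) simp_all
  also have "\<dots> = (\<integral>\<^sup>+x. indicator {x. h < translate a f x} x \<partial>lborel)"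
    by (intro nn_integral_cong) (simp add: translate_def indicator_def add.commute)
  also have "\<dots> = emeasure lborel {x. h < translate a f x}"
    unfolding translate_def by simp
  finally show "emeasure lborel {x. h < f x} = emeasure lborel {x. h < translate a f x}" .
qed

lemma energy_form_translate:
  fixes f :: "'a::euclidean_space \<Rightarrow> real"
  assumes [measurable]: "f \<in> borel_measurable borel"
  shows "energy_form (translate a f) (translate a f) = energy_form f f"
proof -
  have "potential (translate a f) y = potential f (a + y)" for y
  proof -
    have "potential (translate a f) y = (\<integral>x. f (a + x) * newtonian (a + x - (a + y)) \<partial>lborel)"
      unfolding potential_def translate_def by (simp add: add.commute)
    also have "\<dots> = potential f (a + y)"
      unfolding potential_def by (rule integral_lborel_translate) measurable
    finally show ?thesis .
  qed
  then have "energy_form (translate a f) (translate a f) = (\<integral>y. f (a + y) * potential f (a + y) \<partial>lborel)"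
    unfolding energy_form_def by (simp add: translate_def add.commute)
  also have "\<dots> = energy_form f f"
    unfolding energy_form_def by (rule integral_lborel_translate) measurable
  finally show ?thesis .
qed

text \<open>The parallel axis theorem. It identifies the expression in the lower bound for the
  energy gap with the second moment of the centred density.\<close>

lemma second_moment_translate:
  assumes f: "density_on R M f" and m: "mass f > 0"
  shows "second_moment (translate (first_moment f /\<^sub>R mass f) f) = second_moment f - (norm (first_moment f))\<^sup>2 / mass f"
proof -
  note [measurable] = density_onD(1)[OF f]
  define a where "a = first_moment f /\<^sub>R mass f"
  have "second_moment (translate a f) = (\<integral>x. f (a + x) * (norm (a + x - a))\<^sup>2 \<partial>lborel)"
    unfolding second_moment_def translate_def by (simp add: add.commute)
  also have "\<dots> = (\<integral>x. f x * (norm (x - a))\<^sup>2 \<partial>lborel)"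
    by (rule integral_lborel_translate) measurable
  also have "\<dots> = second_moment f - 2 * (first_moment f \<bullet> a) + mass f * (norm a)\<^sup>2"
    by (rule integral_dist_square(2)[OF f])
  also have "\<dots> = second_moment f - (norm (first_moment f))\<^sup>2 / mass f"
    using m by (simp add: a_def dot_square_norm power2_eq_square field_simps)
  finally show ?thesis by (simp add: a_def)
qed

lemma norm_first_moment_le:
  assumes f: "density_on R M f" and m: "mass f > 0"
  shows "norm (first_moment f /\<^sub>R mass f) \<le> R"
proof -
  have "norm (first_moment f) \<le> (\<integral>x. norm (f x *\<^sub>R x) \<partial>lborel)"
    unfolding first_moment_def by (rule integral_norm_bound)
  also have "\<dots> \<le> (\<integral>x. f x * R \<partial>lborel)"
  proof (rule integral_mono)
    show "integrable lborel (\<lambda>x. norm (f x *\<^sub>R x))" by (rule integrable_norm[OF first_moment_integrable[OF f]])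
    show "integrable lborel (\<lambda>x. f x * R)" using density_on_integrable[OF f] by simp
    show "norm (f x *\<^sub>R x) \<le> f x * R" for x
      using density_onD(2,4)[OF f, of x] by (cases "norm x \<le> R") (auto intro: mult_left_mono)
  qed
  also have "\<dots> = mass f * R" by (simp add: mass_def)
  finally show ?thesis using m by (simp add: divide_simps mult.commute)
qed

theorem newtonian_stability:
  fixes f g :: "'a::euclidean_space \<Rightarrow> real"
  assumes f: "density_on R M f" and g: "density_on R M g" and rad: "radially_decreasing g"
    and eq: "equimeasurable f g" and R: "R > 0" and M: "M > 0" and m: "mass f > 0"
    and balls: "\<And>h. h \<ge> 0 \<Longrightarrow> \<exists>r\<ge>0. {x. h < g x} = ball 0 r"
  defines "f' \<equiv> translate (first_moment f /\<^sub>R mass f) f"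
  shows "1 / (sphere_area TYPE('a) * 4 ^ (DIM('a) + 3)) * mass f / (M * R ^ DIM('a))
      * (energy_form f' f' - 2 * energy_form g f' + energy_form g g)
    \<le> energy_form g g - energy_form f f"
proof -
  let ?n = "DIM('a)" and ?s = "sphere_area TYPE('a)"
  define C where "C = 2 ^ (?n + 5) * M"
  have C: "C > 0" using M by (simp add: C_def)
  define W where "W = second_moment f' - second_moment g"
  define c where "c = square_gap R TYPE('a)"
  have c: "c > 0" using R by (simp add: c_def square_gap_def)
  define E where "E = energy_form f' f' - 2 * energy_form g f' + energy_form g g"
  have f': "density_on (2 * R) M f'" and g': "density_on (2 * R) M g"
    unfolding f'_def using translate_density_on[OF f norm_first_moment_le[OF f m]] density_on_mono[OF g] R by auto
  have eq': "equimeasurable f' g"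
    using eq translate_equimeasurable[OF density_onD(1)[OF f]] by (simp add: equimeasurable_def f'_def)
  have R2: "2 * R > 0" using R by simp
  note [measurable] = density_onD(1)[OF g]
  have gap: "2 * c * mass f * W \<le> energy_form g g - energy_form f f"
    using energy_gap_ge_moments[OF f g rad eq R M m]
    by (simp add: W_def c_def f'_def second_moment_translate[OF f m])
  have "second_moment g \<le> second_moment f'"
    unfolding second_moment_def
    by (rule integral_radially_increasing_le[OF f' g' rad eq' R2 M]) (auto intro: power_mono)
  then have W: "0 \<le> W" by (simp add: W_def)
  have form': "energy_form f' f' = energy_form f f"
    unfolding f'_def by (rule energy_form_translate[OF density_onD(1)[OF f]])
  \<comment> \<open>With this \<open>C\<close> the weight is radially increasing, so among
    equimeasurable densities it has the smaller integral against \<open>g\<close>. This converts a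
    difference of energies into a difference of second moments.\<close>
  have "(\<integral>x. g x * (potential g x + C * (norm x)\<^sup>2) \<partial>lborel) \<le> (\<integral>x. f' x * (potential g x + C * (norm x)\<^sup>2) \<partial>lborel)"
    using potential_plus_square_increasing[OF g balls] unfolding C_def[symmetric]
    by (intro integral_radially_increasing_le[OF f' g' rad eq' R2 M]) auto
  moreover have "(\<integral>x. u x * (potential g x + C * (norm x)\<^sup>2) \<partial>lborel) = energy_form g u + C * second_moment u"
    if u: "density_on (2 * R) M u" for u
  proof -
    have "(\<integral>x. u x * (potential g x + C * (norm x)\<^sup>2) \<partial>lborel) = (\<integral>x. u x * potential g x + C * (u x * (norm x)\<^sup>2) \<partial>lborel)"
      by (intro Bochner_Integration.integral_cong) (simp_all add: algebra_simps)
    also have "\<dots> = energy_form g u + C * second_moment u"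
      using potential_mult_integrable[OF g u] second_moment_integrable[OF u]
      by (simp add: energy_form_def second_moment_def)
    finally show ?thesis .
  qed
  ultimately have "energy_form g g - energy_form g f' \<le> C * W"
    using f' g' by (simp add: W_def algebra_simps)
  \<comment> \<open>The gap is nonnegative, hence \<open>energy_form f f\<close> in \<open>E\<close>
    may be replaced by \<open>energy_form g g\<close>, which leaves twice the difference just
    estimated.\<close>
  moreover have "0 \<le> 2 * c * mass f * W" using c m W by simp
  then have "energy_form f f \<le> energy_form g g" using gap by linarith
  ultimately have E: "E \<le> 2 * (C * W)"
    unfolding E_def form' by linarith
  \<comment> \<open>The factors 2 in \<open>2 * c * mass f * W\<close> and in
    \<open>2 * (C * W)\<close> cancel. The quotient \<open>c / C\<close> collects the powers of two
    \<open>2\<close>, \<open>2 ^ n\<close> and \<open>2 ^ (n + 5)\<close>, whose product is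
    \<open>4 ^ (n + 3)\<close>.\<close>
  have k: "1 / (?s * 4 ^ (?n + 3)) * mass f / (M * R ^ ?n) = c * mass f / C"
  proof -
    have "(4::real) ^ ?n = 2 ^ ?n * 2 ^ ?n" by (simp add: power_mult_distrib[symmetric])
    then show ?thesis
      using R M by (simp add: c_def square_gap_def C_def power_add power_mult_distrib)
  qed
  have "1 / (?s * 4 ^ (?n + 3)) * mass f / (M * R ^ ?n) * E \<le> c * mass f / C * (2 * (C * W))"
    unfolding k by (rule mult_left_mono[OF E]) (use c C m in simp)
  also have "\<dots> = 2 * c * mass f * W" using C by simp
  also have "\<dots> \<le> energy_form g g - energy_form f f" by (rule gap)
  finally show ?thesis by (simp add: E_def)
qed

section \<open>From Lebesgue classes to Borel representatives\<close>

lemma borel_measurable_lebesgue_AE: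
  fixes F G :: "'a::euclidean_space \<Rightarrow> 'b::topological_space"
  assumes F: "F \<in> borel_measurable borel" and ae: "AE x in lborel. G x = F x"
  shows "G \<in> borel_measurable lebesgue"
proof (rule borel_measurableI)
  fix S :: "'b set" assume S: "open S"
  obtain N where N: "\<And>x. x \<in> space lborel - N \<Longrightarrow> G x = F x" "N \<in> null_sets lborel"
    by (rule AE_E3[OF ae]) (rule that; blast)
  have FS: "F -` S \<in> sets lborel" using measurable_sets[OF F, of S] S by simp
  have eq: "(F -` S - N) \<union> (G -` S \<inter> N) = G -` S" using N(1) by auto
  have "G -` S \<inter> N \<in> sets lebesgue"
    by (rule sets_completionI_sub[OF N(2)]) auto
  moreover have "F -` S - N \<in> sets lebesgue"
    using FS null_setsD2[OF N(2)] by (intro sets_completionI_sets sets.Diff)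
  ultimately have "(F -` S - N) \<union> (G -` S \<inter> N) \<in> sets lebesgue" by (intro sets.Un)
  then show "G -` S \<inter> space lebesgue \<in> sets lebesgue" unfolding eq by simp
qed

text \<open>Measurability of \<open>G\<close> comes from its agreement with \<open>F\<close> off a
  null set. This suits the outer integral of the energy, whose integrand is itself an inner integral
  known only almost everywhere.\<close>

lemma lebesgue_integral_eq_lborel_AE:
  fixes F G :: "'a::euclidean_space \<Rightarrow> 'b::{banach, second_countable_topology}"
  assumes F: "F \<in> borel_measurable borel" and ae: "AE x in lborel. G x = F x"
  shows "(\<integral>x. G x \<partial>lebesgue) = (\<integral>x. F x \<partial>lborel)"
proof -
  have "(\<integral>x. G x \<partial>lebesgue) = (\<integral>x. F x \<partial>lebesgue)"
    using F ae by (intro integral_cong_AE borel_measurable_lebesgue_AE[OF F ae] AE_completion)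
      (auto intro: measurable_completion)
  also have "\<dots> = (\<integral>x. F x \<partial>lborel)" using F by (intro integral_completion) simp
  finally show ?thesis .
qed

lemma interaction_energy_eq_lborel:
  fixes u v :: "'a::euclidean_space \<Rightarrow> real"
  assumes [measurable]: "v \<in> borel_measurable borel" and ae: "AE x in lborel. u x = v x"
  shows "interaction_energy newtonian u = (\<integral>y. \<integral>x. v x * v y * newtonian (x - y) \<partial>lborel \<partial>lborel)"
  unfolding interaction_energy_def
proof (rule lebesgue_integral_eq_lborel_AE)
  show "(\<lambda>y. \<integral>x. v x * v y * newtonian (x - y) \<partial>lborel) \<in> borel_measurable borel" by measurable
  show "AE y in lborel. (\<integral>x. u x * u y * newtonian (x - y) \<partial>lebesgue) = (\<integral>x. v x * v y * newtonian (x - y) \<partial>lborel)"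
    using ae
  proof eventually_elim
    case (elim y)
    show ?case
    proof (rule lebesgue_integral_eq_lborel_AE)
      show "AE x in lborel. u x * u y * newtonian (x - y) = v x * v y * newtonian (x - y)"
        using ae by eventually_elim (simp add: elim)
    qed measurable
  qed
qed

lemma interaction_energy_eq_energy_form:
  assumes f: "density_on R M f" and ae: "AE x in lborel. u x = f x"
  shows "interaction_energy newtonian u = energy_form f f"
proof -
  have "(\<integral>x. f x * f y * newtonian (x - y) \<partial>lborel) = f y * potential f y" for y
  proof -
    have "(\<integral>x. f x * f y * newtonian (x - y) \<partial>lborel) = (\<integral>x. f y * (f x * newtonian (x - y)) \<partial>lborel)"
      by (intro Bochner_Integration.integral_cong) simp_all
    then show ?thesis by (simp add: potential_def)
  qed
  then show ?thesis
    using interaction_energy_eq_lborel[OF density_onD(1)[OF f] ae] by (simp add: energy_form_def)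
qed

text \<open>The complement of the support is a possibly uncountable union of open sets on which
  \<open>f\<close> vanishes almost everywhere. By the Lindelof property countably many of them cover
  it, and countably many null sets can be united.\<close>

lemma ess_support_AE:
  fixes f :: "'a::euclidean_space \<Rightarrow> real"
  assumes "ess_support f \<subseteq> S"
  shows "AE x in lebesgue. x \<notin> S \<longrightarrow> f x = 0"
proof -
  let ?\<U> = "{U. open U \<and> (AE x in lebesgue. x \<in> U \<longrightarrow> f x = 0)}"
  obtain \<V> where \<V>: "\<V> \<subseteq> ?\<U>" "countable \<V>" "\<Union>\<V> = \<Union>?\<U>"
    using Lindelof[of ?\<U>] by auto
  have "AE x in lebesgue. \<forall>U\<in>\<V>. x \<in> U \<longrightarrow> f x = 0"
    using \<V>(1) by (subst AE_ball_countable[OF \<V>(2)]) auto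
  then show ?thesis
  proof eventually_elim
    case (elim x)
    show ?case
    proof
      assume "x \<notin> S"
      then have "x \<in> \<Union>\<V>" using assms unfolding \<V>(3) ess_support_def by blast
      then show "f x = 0" using elim by blast
    qed
  qed
qed

lemma Linf_norm_AE:
  assumes "f \<in> L_infinity"
  shows "AE x in lebesgue. \<bar>f x\<bar> \<le> Linf_norm f"
proof -
  have fin: "esssup lebesgue (\<lambda>x. ereal \<bar>f x\<bar>) < \<infinity>" using assms by (simp add: L_infinity_def)
  show ?thesis
    using esssup_AE[of "\<lambda>x. ereal \<bar>f x\<bar>" lebesgue]
  proof eventually_elim
    case (elim x)
    then show ?case using fin unfolding Linf_norm_def
      by (cases "esssup lebesgue (\<lambda>x. ereal \<bar>f x\<bar>)") auto
  qed
qed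

text \<open>The rearrangement sees a function only through the measures of its superlevel sets, so
  the conclusion is equality at every point.\<close>

lemma rearrangement_cong_AE:
  fixes f g :: "'a::euclidean_space \<Rightarrow> real"
  assumes [measurable]: "f \<in> borel_measurable lebesgue" "g \<in> borel_measurable lebesgue"
    and ae: "AE x in lebesgue. f x = g x"
  shows "rearrangement f = rearrangement g"
proof -
  have "measure lebesgue {y. f y > h} = measure lebesgue {y. g y > h}" for h
  proof (rule measure_eq_AE)
    show "AE x in lebesgue. x \<in> {y. f y > h} \<longleftrightarrow> x \<in> {y. g y > h}" using ae by eventually_elim simp
    have "{x \<in> space lebesgue. f x > h} \<in> sets lebesgue" "{x \<in> space lebesgue. g x > h} \<in> sets lebesgue"
      by measurable
    then show "{y. f y > h} \<in> sets lebesgue" "{y. g y > h} \<in> sets lebesgue" by simp_all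
  qed
  then have "set_rearrangement {y. f y > h} = set_rearrangement {y. g y > h}" for h
    by (simp add: set_rearrangement_def)
  then show ?thesis by (simp add: fun_eq_iff rearrangement_def)
qed

lemma AE_lborel_translate:
  fixes a :: "'a::euclidean_space"
  assumes "AE x in lborel. P x"
  shows "AE x in lborel. P (x + a)"
proof -
  have "AE x in distr lborel borel ((+) a). P x" unfolding lborel_distr_plus by (rule assms)
  then have "AE x in lborel. P (a + x)" by (rule AE_distrD[rotated]) simp
  then show ?thesis by (simp add: add.commute)
qed

text \<open>The constant is \<open>1 / (n * \<omega> * 4 ^ (n + 3))\<close> with
  \<open>\<omega>\<close> the volume of the unit ball. Allowing the closed ball as container of the
  support covers the open ball as well. What is left is to pass to a representative satisfying all
  bounds everywhere and to translate each quantity to it.\<close>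

theorem theorem1p3:
  shows "\<exists>c::real. c > 0 \<and>
    (\<forall>R::real. R > 0 \<longrightarrow>
      (\<forall>\<rho> :: real ^ 'n::finite \<Rightarrow> real.
        \<rho> \<in> L1_plus \<inter> L_infinity \<longrightarrow>
        \<not> (AE x in lebesgue. \<rho> x = 0) \<longrightarrow>
        ess_support \<rho> \<subseteq> cball 0 R \<longrightarrow>
        interaction_energy newtonian (rearrangement \<rho>) - interaction_energy newtonian \<rho>
          \<ge> c * L1_norm \<rho> / (Linf_norm \<rho> * R ^ CARD('n)) *
            interaction_energy newtonian
              (\<lambda>x. translate (center_of_mass \<rho>) \<rho> x - rearrangement \<rho> x)))"
proof (intro exI[of _ "1 / (sphere_area TYPE(real ^ 'n) * 4 ^ (DIM(real ^ 'n) + 3))"] conjI allI impI)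
  show "0 < 1 / (sphere_area TYPE(real ^ 'n) * 4 ^ (DIM(real ^ 'n) + 3))" by simp
  fix R :: real and \<rho> :: "real ^ 'n \<Rightarrow> real"
  assume R: "R > 0" and \<rho>: "\<rho> \<in> L1_plus \<inter> L_infinity" and nz: "\<not> (AE x in lebesgue. \<rho> x = 0)"
    and supp: "ess_support \<rho> \<subseteq> cball 0 R"
  define M where "M = Linf_norm \<rho>"
  have \<rho>_meas[measurable]: "\<rho> \<in> borel_measurable lebesgue" using \<rho> by (simp add: L_infinity_def)
  have bounds: "AE x in lebesgue. 0 \<le> \<rho> x" "AE x in lebesgue. \<bar>\<rho> x\<bar> \<le> M" "AE x in lebesgue. x \<notin> cball 0 R \<longrightarrow> \<rho> x = 0"
    using \<rho> Linf_norm_AE[of \<rho>] ess_support_AE[OF supp] by (auto simp: L1_plus_def M_def)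
  have M: "M > 0"
  proof (rule ccontr)
    assume "\<not> M > 0"
    then have "AE x in lebesgue. \<rho> x = 0" using bounds(2) by (auto elim!: eventually_mono)
    with nz show False by blast
  qed
  obtain f\<^sub>0 where f\<^sub>0[measurable]: "f\<^sub>0 \<in> borel_measurable lborel" and ae\<^sub>0: "AE x in lborel. \<rho> x = f\<^sub>0 x"
    using completion_ex_borel_measurable_real[OF \<rho>_meas] by blast
  \<comment> \<open>Clipping to the range from 0 to \<open>M\<close> and to the closed ball changes
    the Borel representative only on a null set, and makes the bounds valid at every point.\<close>
  define f where "f x = (if norm x \<le> R then min M (max 0 (f\<^sub>0 x)) else 0)" for x
  have f: "density_on R M f"
    using f\<^sub>0 M by (auto simp: density_on_def f_def[abs_def])
  have [measurable]: "f \<in> borel_measurable borel" by (rule density_onD(1)[OF f])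
  have ae: "AE x in lborel. \<rho> x = f x"
    using ae\<^sub>0 bounds[unfolded AE_completion_iff]
    by eventually_elim (auto simp: f_def)
  have m: "mass f = L1_norm \<rho>"
    unfolding L1_norm_def mass_def
  proof (rule lebesgue_integral_eq_lborel_AE[symmetric])
    show "AE x in lborel. \<bar>\<rho> x\<bar> = f x" using ae by eventually_elim (simp add: density_onD(2)[OF f])
  qed measurable
  have m_pos: "mass f > 0"
  proof -
    have "mass f \<noteq> 0"
    proof
      assume "mass f = 0"
      then have "AE x in lborel. f x = 0"
        unfolding mass_def using density_on_integrable[OF f] density_onD(2)[OF f]
        by (subst (asm) integral_nonneg_eq_0_iff_AE) auto
      then have "AE x in lborel. \<rho> x = 0" using ae by eventually_elim simp
      with nz show False by (simp add: AE_completion_iff)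
    qed
    moreover have "0 \<le> mass f" unfolding mass_def using density_onD(2)[OF f] by (intro integral_nonneg_AE) auto
    ultimately show ?thesis by simp
  qed
  have "(\<integral>x. \<rho> x *\<^sub>R x \<partial>lebesgue) = first_moment f"
    unfolding first_moment_def by (rule lebesgue_integral_eq_lborel_AE) (use ae in auto)
  then have com: "center_of_mass \<rho> = first_moment f /\<^sub>R mass f" by (simp add: center_of_mass_def m)
  define g where "g = rearrangement f"
  have rearr: "rearrangement \<rho> = g"
    unfolding g_def using ae by (intro rearrangement_cong_AE AE_completion) (auto intro: measurable_completion)
  have R0: "R \<ge> 0" using R by simp
  note g = rearrangement_properties[OF f R0, folded g_def]
  define f' where "f' = translate (first_moment f /\<^sub>R mass f) f"
  have f': "density_on (2 * R) M f'"
    unfolding f'_def by (rule translate_density_on[OF f norm_first_moment_le[OF f m_pos]])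
  \<comment> \<open>Null sets are invariant under translation, and the two rearrangements agree
    everywhere, so the difference needs to be compared only up to a null set.\<close>
  have "AE x in lborel. translate (center_of_mass \<rho>) \<rho> x - rearrangement \<rho> x = f' x - g x"
    using AE_lborel_translate[OF ae, of "center_of_mass \<rho>"]
    by eventually_elim (simp add: translate_def f'_def rearr com)
  then have "interaction_energy newtonian (\<lambda>x. translate (center_of_mass \<rho>) \<rho> x - rearrangement \<rho> x)
    = (\<integral>y. \<integral>x. (f' x - g x) * (f' y - g y) * newtonian (x - y) \<partial>lborel \<partial>lborel)"
    using density_onD(1)[OF f'] density_onD(1)[OF g(1)] by (intro interaction_energy_eq_lborel) auto
  also have "\<dots> = energy_form f' f' - 2 * energy_form g f' + energy_form g g"
    by (rule energy_form_diff[OF f' g(1)])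
  finally have diff: "interaction_energy newtonian (\<lambda>x. translate (center_of_mass \<rho>) \<rho> x - rearrangement \<rho> x)
    = energy_form f' f' - 2 * energy_form g f' + energy_form g g" .
  have "interaction_energy newtonian \<rho> = energy_form f f" "interaction_energy newtonian (rearrangement \<rho>) = energy_form g g"
    using interaction_energy_eq_energy_form[OF f ae] interaction_energy_eq_energy_form[OF g(1), of g] by (simp_all add: rearr)
  then show "1 / (sphere_area TYPE(real ^ 'n) * 4 ^ (DIM(real ^ 'n) + 3)) * L1_norm \<rho> / (Linf_norm \<rho> * R ^ CARD('n)) *
      interaction_energy newtonian (\<lambda>x. translate (center_of_mass \<rho>) \<rho> x - rearrangement \<rho> x)
    \<le> interaction_energy newtonian (rearrangement \<rho>) - interaction_energy newtonian \<rho>"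
    using newtonian_stability[OF f g(1-3) R M m_pos g(4)] by (simp add: diff m M_def f'_def)
qed

end
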